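(* Let $\boldsymbol n=(n_1,n_2)$, $\boldsymbol m=(m_1,m_2)$ be vectors of nonnegative integers with $n_1+n_2=m_1+m_2$, and let $\boldsymbol\lambda=(\lambda_1,\lambda_2)$, $\boldsymbol z=(z_1,z_2)$ be generic. Let $(t_1,\dots,t_{n_2})$ be a Gaudin admissible solution of the system $$\frac{\lambda_1-\lambda_2-1}{t_i}+\sum_{a=1}^2\frac{m_a}{t_i-z_a}-\sum_{j\neq i}\frac{2}{t_i-t_j}=0,\qquad i=1,\dots,n_2. \tag{A}$$ Let $(V,\boldsymbol z)$, $V=\langle x^{\lambda_1}p_1(x),x^{\lambda_2}p_2(x)\rangle$, be the space of quasi-polynomials of the $(\boldsymbol n,\boldsymbol\lambda,\boldsymbol m,\boldsymbol z)$-type associated with the orbit of $(t_1,\dots,t_{n_2})$. Let $(U,\boldsymbol\lambda+\boldsymbol1)$, $\boldsymbol1=(1,1)$, $U=\langle z_1^uq_1(u),z_2^uq_2(u)\rangle$, be the special bispectral dual space to $(V,\boldsymbol z)$. Then: - the polynomial $p_1$ represents the orbit of a Gaudin admissible solution of the system $$\frac{\lambda_2-\lambda_1-1}{t_i}+\sum_{a=1}^2\frac{m_a}{t_i-z_a}-\sum_{j\neq i}\frac{2}{t_i-t_j}=0,\qquad i=1,\dots,n_1; \tag{B}$$ - the polynomial $q_2$ represents the orbit of an XXX admissible solution of the system $$\prod_{i=1}^2\frac{t_a-\lambda_i-1}{t_a-\lambda_i-1-n_i}\ \prod_{b\ne a}\frac{t_a-t_b-1}{t_a-t_b+1}=\frac{z_2}{z_1},\qquad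 a=1,\dots,m_2; \tag{C}$$ - the polynomial $q_1$ represents the orbit of an XXX admissible solution of the system $$\prod_{i=1}^2\frac{t_a-\lambda_i-1}{t_a-\lambda_i-1-n_i}\ \prod_{b\ne a}\frac{t_a-t_b-1}{t_a-t_b+1}=\frac{z_1}{z_2},\qquad a=1,\dots,m_1. \tag{D}$$
   Context: "Generic" is understood in the usual sense (all parameters outside a countable union of proper algebraic subsets); in particular $\lambda_1-\lambda_2\notin\mathbb Z$, $z_1\ne z_2$, $z_1,z_2\neq0$. A polynomial represents the orbit, under permutation of coordinates, of the tuple of its roots (polynomials are considered up to a nonzero constant). **Admissibility.** A tuple $(t_1,\dots,t_k)$ is Gaudin admissible if the $t_i$ are distinct, nonzero, and $t_i\ne z_a$ whenever $m_a>0$. A tuple $(t_1,\dots,t_k)$ is XXX admissible (here of $(\boldsymbol\lambda+\boldsymbol1)$-type) if $t_a\neq t_b$ and $t_a\ne t_b+1$ for $a\ne b$, and $t_a\neq\lambda_i+1+r$ for all $a$, $i=1,2$, $r=0,\dots,n_i$. **Special spaces of quasi-polynomials ($N=M=2$).** Let $p_i\in\mathbb C[x]$ have degree $n_i$ with $p_i(0)\ne0$, $i=1,2$, and let $V$ be the span of the multivalued functions $x^{\lambda_1}p_1,x^{\lambda_2}p_2$. The exponents of $V$ at $z\in\mathbb C^*$ are the two possible multiplicities $e_1<e_2$ at $z$ of roots of nonzero elements of $V$; $z$ is singular if $\{e_1,e_2\}\ne\{0,1\}$. $(V,\boldsymbol z)$ is of the $(\boldsymbol n,\boldsymbol\lambda,\boldsymbol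 m,\boldsymbol z)$-type if all singular points in $\mathbb C^*$ lie in $\{z_1,z_2\}$ and the exponents at $z_a$ are $0<1+m_a$, $a=1,2$. **Space associated with a solution.** For a Gaudin admissible solution of (A), put $p(x)=\prod_{i=1}^{n_2}(x-t_i)$. The associated space $V$ is the kernel of $$\Bigl(\partial_x-\ln'\Bigl(\frac{x^{\lambda_1-1}\prod_{a=1}^2(x-z_a)^{m_a}}{p}\Bigr)\Bigr)\Bigl(\partial_x-\ln'(x^{\lambda_2}p)\Bigr),$$ where $\ln'f=f'/f$. It is known that $(V,\boldsymbol z)$ is of the $(\boldsymbol n,\boldsymbol\lambda,\boldsymbol m,\boldsymbol z)$-type; $p_2$ is proportional to $p$. **Special bispectral dual.** Let $V^\star=\{f/\mathrm{Wr}_V: f\in V\}$, where $\mathrm{Wr}_V$ is the Wronskian of a basis of $V$. Fix arguments of $z_1,z_2$ and put $z_a^u=e^{u\ln z_a}$. The special bispectral dual space $U$ is the span of all $\int_{\gamma_a}x^uf(x)\,x^{-2}(x-z_1)^{-1}(x-z_2)^{-1}dx$, $a=1,2$, $f\in V^\star$, where $\gamma_a$ is a small counterclockwise circle around $z_a$ and the branch of $\ln x$ near $z_a$ is given by the fixed argument of $z_a$. Then $U=\langle z_1^uq_1(u),z_2^uq_2(u)\rangle$ with $q_a\in\mathbb C[u]$ of degree $m_a$. *)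

theory Defs
  imports "HOL-Complex_Analysis.Complex_Analysis" "HOL-Library.Function_Algebras"
begin

text \<open>The infix \<open>$\<close> is used for vector components only.\<close>

no_notation fps_nth (infixl "$" 75)

section \<open>Generic parameters\<close>

text \<open>
  A polynomial in four variables is an iterated univariate polynomial; it is evaluated at
  a point of \<open>\<complex>\<^sup>2 \<times> \<complex>\<^sup>2\<close>.
\<close>

definition eval4 :: "complex poly poly poly poly \<Rightarrow> (complex^2) \<times> (complex^2) \<Rightarrow> complex" where
  "eval4 P w =
     poly (poly (poly (poly P [:[:[:fst w $ 1:]:]:]) [:[:fst w $ 2:]:]) [:snd w $ 1:]) (snd w $ 2)"

definition algebraic_subset :: "((complex^2) \<times> (complex^2)) set \<Rightarrow> bool" where
  "algebraic_subset A \<longleftrightarrow> (\<exists>S. A = {w. \<forall>P\<in>S. eval4 P w = 0})"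

definition generically :: "((complex^2) \<times> (complex^2) \<Rightarrow> bool) \<Rightarrow> bool" where
  "generically Q \<longleftrightarrow>
     (\<exists>E. countable E \<and> (\<forall>A\<in>E. algebraic_subset A \<and> A \<noteq> UNIV) \<and> (\<forall>w. w \<notin> \<Union>E \<longrightarrow> Q w))"

section \<open>Systems of equations and admissibility\<close>

text \<open>Tuples are lists. A polynomial is considered up to a nonzero constant factor.\<close>

definition represents_orbit :: "complex poly \<Rightarrow> complex list \<Rightarrow> bool" where
  "represents_orbit p t \<longleftrightarrow> (\<exists>c. c \<noteq> 0 \<and> p = smult c (\<Prod>x\<leftarrow>t. [:- x, 1:]))"

definition gaudin_admissible :: "nat^2 \<Rightarrow> complex^2 \<Rightarrow> complex list \<Rightarrow> bool" where
  "gaudin_admissible m z t \<longleftrightarrow>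
     distinct t \<and> 0 \<notin> set t \<and> (\<forall>a. m $ a > 0 \<longrightarrow> z $ a \<notin> set t)"

text \<open>
  If \<open>m\<^sub>a = 0\<close>, the summand with index \<open>a\<close> vanishes, also when \<open>t\<^sub>i = z\<^sub>a\<close> (as \<open>0 / 0 = 0\<close>).
\<close>

definition gaudin_solution :: "complex \<Rightarrow> nat^2 \<Rightarrow> complex^2 \<Rightarrow> complex list \<Rightarrow> bool" where
  "gaudin_solution \<kappa> m z t \<longleftrightarrow>
     (\<forall>i<length t.
        \<kappa> / t ! i + (\<Sum>a\<in>UNIV. of_nat (m $ a) / (t ! i - z $ a))
        - (\<Sum>j\<in>{..<length t} - {i}. 2 / (t ! i - t ! j)) = 0)"

definition xxx_admissible :: "nat^2 \<Rightarrow> complex^2 \<Rightarrow> complex list \<Rightarrow> bool" where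
  "xxx_admissible n \<mu> t \<longleftrightarrow>
     (\<forall>a<length t. \<forall>b<length t. a \<noteq> b \<longrightarrow> t ! a \<noteq> t ! b \<and> t ! a \<noteq> t ! b + 1) \<and>
     (\<forall>a<length t. \<forall>i. \<forall>r\<le>n $ i. t ! a \<noteq> \<mu> $ i + of_nat r)"

definition xxx_solution :: "nat^2 \<Rightarrow> complex^2 \<Rightarrow> complex \<Rightarrow> complex list \<Rightarrow> bool" where
  "xxx_solution n \<mu> \<zeta> t \<longleftrightarrow>
     (\<forall>a<length t.
        (\<Prod>i\<in>UNIV. (t ! a - \<mu> $ i) / (t ! a - \<mu> $ i - of_nat (n $ i))) *
        (\<Prod>b\<in>{..<length t} - {a}. (t ! a - t ! b - 1) / (t ! a - t ! b + 1)) = \<zeta>)"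

section \<open>Multivalued functions and spaces of quasi-polynomials\<close>

text \<open>
  A multivalued function of \<open>x \<in> \<complex>\<^sup>*\<close> is a function of the coordinate \<open>s\<close> on the universal
  cover, \<open>x = exp s\<close>. Thus \<open>x\<close> to the power \<open>\<alpha>\<close> is \<open>exp (\<alpha> * s)\<close>, and the derivative with
  respect to \<open>x\<close> is \<open>exp (- s)\<close> times the derivative with respect to \<open>s\<close>.
\<close>

interpretation cfun: vector_space "\<lambda>(c::complex) (f::complex \<Rightarrow> complex) s. c * f s"
  by unfold_locales (simp_all add: fun_eq_iff algebra_simps)

definition dx :: "(complex \<Rightarrow> complex) \<Rightarrow> complex \<Rightarrow> complex" where
  "dx F = (\<lambda>s. deriv F s / exp s)"

definition quasi_poly :: "complex \<Rightarrow> complex poly \<Rightarrow> complex \<Rightarrow> complex" where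
  "quasi_poly \<alpha> p = (\<lambda>s. exp (\<alpha> * s) * poly p (exp s))"

definition quasi_poly_space :: "complex^2 \<Rightarrow> complex poly^2 \<Rightarrow> (complex \<Rightarrow> complex) set" where
  "quasi_poly_space lam p = cfun.span {quasi_poly (lam $ 1) (p $ 1), quasi_poly (lam $ 2) (p $ 2)}"

text \<open>
  Since \<open>exp\<close> is locally biholomorphic, the multiplicity of a root at \<open>x = exp s\<close> is the order
  of vanishing at \<open>s\<close>.
\<close>

definition exponents :: "(complex \<Rightarrow> complex) set \<Rightarrow> complex \<Rightarrow> int set" where
  "exponents V s = {zorder F s | F. F \<in> V \<and> F \<noteq> (\<lambda>_. 0)}"

definition quasi_poly_space_type ::
    "nat^2 \<Rightarrow> complex^2 \<Rightarrow> nat^2 \<Rightarrow> complex^2 \<Rightarrow> complex poly^2 \<Rightarrow> bool" where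
  "quasi_poly_space_type n lam m z p \<longleftrightarrow>
     (\<forall>i. degree (p $ i) = n $ i \<and> poly (p $ i) 0 \<noteq> 0) \<and>
     (\<forall>s. exp s \<notin> {z $ 1, z $ 2} \<longrightarrow> exponents (quasi_poly_space lam p) s = {0, 1}) \<and>
     (\<forall>a s. exp s = z $ a \<longrightarrow> exponents (quasi_poly_space lam p) s = {0, 1 + int (m $ a)})"

text \<open>\<open>fo_op h\<close> is the operator \<open>\<partial>\<^sub>x - ln' h\<close>, where \<open>ln' h = h' / h\<close>.\<close>

definition fo_op :: "(complex \<Rightarrow> complex) \<Rightarrow> (complex \<Rightarrow> complex) \<Rightarrow> complex \<Rightarrow> complex" where
  "fo_op h F = (\<lambda>s. dx F s - dx h s / h s * F s)"

text \<open>
  The kernel is taken among the functions that are holomorphic on the whole universal cover of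
  \<open>\<complex>\<^sup>*\<close>; the equation is imposed away from the possible poles of the coefficients. As the
  operator has order two, this is the space of all local solutions as soon as its dimension is two.
\<close>

definition gaudin_kernel ::
    "complex^2 \<Rightarrow> nat^2 \<Rightarrow> complex^2 \<Rightarrow> complex list \<Rightarrow> (complex \<Rightarrow> complex) set" where
  "gaudin_kernel lam m z t =
     (let p = (\<Prod>x\<leftarrow>t. [:- x, 1:]);
          g = (\<lambda>s. exp ((lam $ 1 - 1) * s) * (\<Prod>a\<in>UNIV. (exp s - z $ a) ^ (m $ a)) / poly p (exp s))
      in {F. F holomorphic_on UNIV \<and>
             (\<forall>s. exp s \<notin> set t \<union> {z $ 1, z $ 2} \<longrightarrow>
                  fo_op g (fo_op (quasi_poly (lam $ 2) p) F) s = 0)})"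

section \<open>The special bispectral dual space\<close>

definition wronskian ::
    "(complex \<Rightarrow> complex) \<Rightarrow> (complex \<Rightarrow> complex) \<Rightarrow> complex \<Rightarrow> complex" where
  "wronskian F G = (\<lambda>s. F s * dx G s - dx F s * G s)"

definition star_space :: "complex^2 \<Rightarrow> complex poly^2 \<Rightarrow> (complex \<Rightarrow> complex) set" where
  "star_space lam p =
     {(\<lambda>s. F s / wronskian (quasi_poly (lam $ 1) (p $ 1)) (quasi_poly (lam $ 2) (p $ 2)) s) | F.
        F \<in> quasi_poly_space lam p}"

text \<open>
  The vector \<open>l\<close> with \<open>exp (l\<^sub>a) = z\<^sub>a\<close> encodes the fixed arguments of the \<open>z\<^sub>a\<close>: \<open>l\<^sub>a\<close> is the
  chosen value of \<open>ln z\<^sub>a\<close>, and \<open>log_branch l\<^sub>a\<close> is the branch of \<open>ln\<close> on the disc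
  \<open>\<bar>x - z\<^sub>a\<bar> < \<bar>z\<^sub>a\<bar>\<close> with value \<open>l\<^sub>a\<close> at \<open>z\<^sub>a\<close>.
\<close>

definition log_branch :: "complex \<Rightarrow> complex \<Rightarrow> complex" where
  "log_branch l x = l + Ln (x / exp l)"

definition bispectral_integrand ::
    "complex^2 \<Rightarrow> complex \<Rightarrow> complex \<Rightarrow> (complex \<Rightarrow> complex) \<Rightarrow> complex \<Rightarrow> complex" where
  "bispectral_integrand z l u F x =
     exp (u * log_branch l x) * F (log_branch l x) / (x ^ 2 * (x - z $ 1) * (x - z $ 2))"

definition bispectral_dual ::
    "complex^2 \<Rightarrow> complex poly^2 \<Rightarrow> complex^2 \<Rightarrow> complex^2 \<Rightarrow> (complex \<Rightarrow> complex) set" where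
  "bispectral_dual lam p z l =
     cfun.span {h. \<exists>a. \<exists>F\<in>star_space lam p. \<forall>u.
       (\<forall>\<^sub>F \<epsilon> in at_right 0.
          (bispectral_integrand z (l $ a) u F has_contour_integral h u) (circlepath (z $ a) \<epsilon>))}"

definition exp_poly :: "complex \<Rightarrow> complex poly \<Rightarrow> complex \<Rightarrow> complex" where
  "exp_poly l q = (\<lambda>u. exp (u * l) * poly q u)"

end

theory Submission
  imports Defs "HOL-Computational_Algebra.Fundamental_Theorem_Algebra"
begin

text \<open>
  \<^bold>\<open>From the exponents to the Gaudin system.\<close> The exponents of \<open>V\<close> determine the Wronskian of
  \<open>x\<^bsup>lam 1\<^esup> p\<^sub>1\<close> and \<open>x\<^bsup>lam 2\<^esup> p\<^sub>2\<close>: up to a power of \<open>x\<close> and a nonzero constant it is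
  \<open>(x - z\<^sub>1)^m\<^sub>1 (x - z\<^sub>2)^m\<^sub>2\<close> (\<open>wronskian_of_type\<close>). The Wronskian and its derivative at a root
  of \<open>p\<^sub>1\<close> give the Gaudin equation at this root (\<open>wronskian_gives_gaudin_solution\<close>), provided
  that \<open>p\<^sub>1\<close> does not vanish at \<open>z\<^sub>1\<close> and \<open>z\<^sub>2\<close>.

  \<^bold>\<open>From the Gaudin to the XXX side.\<close> With the explicit Wronskian, Cauchy's formula evaluates the
  integral of an element of the dual over the circle around \<open>z\<^sub>a\<close> as \<open>z\<^sub>a\<^sup>u\<close> times a polynomial in
  \<open>u\<close> of degree \<open>m\<^sub>a\<close>, which must be a multiple of \<open>q\<^sub>a\<close>. At \<open>u = lam\<^sub>k + 1 + j\<close> with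
  \<open>0 \<le> j \<le> n\<^sub>k\<close> the integrand built from the other function of the basis of \<open>V\<close> is rational
  without residue at infinity, so the integrals over the two circles cancel. Hence on each of
  the two chains of points the quotient \<open>q\<^sub>2 / q\<^sub>1\<close> is a constant times \<open>(z\<^sub>1 / z\<^sub>2)^j\<close>
  (\<open>dual_chain_relations\<close>). These relations produce \<open>n\<^sub>1 + n\<^sub>2 = m\<^sub>1 + m\<^sub>2\<close> zeros of the discrete
  Wronskian \<open>z\<^sub>2 q\<^sub>1(u) q\<^sub>2(u + 1) - z\<^sub>1 q\<^sub>1(u + 1) q\<^sub>2(u)\<close>, which is therefore known up to a constant
  (\<open>discrete_wronskian_from_chains\<close>). Its values at \<open>t\<close> and \<open>t - 1\<close> for a root \<open>t\<close> of \<open>q\<^sub>2\<close> give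
  the XXX equation (\<open>chains_give_xxx_solution\<close>), provided that \<open>q\<^sub>2\<close> has simple roots and that
  \<open>q\<^sub>1\<close> and \<open>q\<^sub>2\<close> have no common zero on the chains.

  \<^bold>\<open>Genericity.\<close> What remains are the three nonvanishing statements, for parameters that may be
  taken to be algebraically independent (\<open>generically_if_alg_independent\<close>). Instead of computing
  discriminants one lets the parameters degenerate. By Chevalley's extension theorem there is a
  valuation ring \<open>B\<close> of the complex numbers for which a prescribed parameter is infinitesimal
  while all expressions with a nonzero limit are units (\<open>generic_specialisation\<close>).
  Polynomials are rescaled to be primitive and reduced modulo the maximal ideal of \<open>B\<close>. For
  \<open>lam\<^sub>2 - lam\<^sub>1 \<rightarrow> \<infinity>\<close> the Wronskian relation becomes \<open>p\<^sub>1 p\<^sub>2 = c (x - z\<^sub>1)^m\<^sub>1 (x - z\<^sub>2)^m\<^sub>2\<close>,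
  which leaves no room for a zero of \<open>p\<^sub>i\<close> at \<open>z\<^sub>a\<close> of the order \<open>m\<^sub>a + 1\<close> required by the exponents
  (\<open>wronskian_excludes_high_order\<close>). For \<open>z\<^sub>1 \<rightarrow> 0\<close> the discrete Wronskian becomes a multiple of
  \<open>q\<^sub>1(u) q\<^sub>2(u + 1)\<close>, so this product has simple zeros that are known explicitly; this makes
  the roots of \<open>q\<^sub>2\<close> simple and, combined with the chain relations, excludes common zeros
  (\<open>degenerate_nonvanishing\<close>).
\<close>

section \<open>Valuation rings\<close>

locale ring_in_field =
  fixes B :: "'a::field set"
  assumes one_mem: "1 \<in> B"
    and diff_mem: "x \<in> B \<Longrightarrow> y \<in> B \<Longrightarrow> x - y \<in> B"
    and mult_mem: "x \<in> B \<Longrightarrow> y \<in> B \<Longrightarrow> x * y \<in> B"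
begin

lemma zero_mem: "0 \<in> B"
  using diff_mem[OF one_mem one_mem] by simp

lemma uminus_mem: "x \<in> B \<Longrightarrow> - x \<in> B"
  using diff_mem[OF zero_mem] by simp

lemma add_mem: "x \<in> B \<Longrightarrow> y \<in> B \<Longrightarrow> x + y \<in> B"
  using diff_mem[OF _ uminus_mem] by fastforce

lemma sum_mem: "(\<And>i. i \<in> I \<Longrightarrow> f i \<in> B) \<Longrightarrow> sum f I \<in> B"
  by (induction I rule: infinite_finite_induct) (auto intro: zero_mem add_mem)

lemma prod_mem: "(\<And>i. i \<in> I \<Longrightarrow> f i \<in> B) \<Longrightarrow> prod f I \<in> B"
  by (induction I rule: infinite_finite_induct) (auto intro: one_mem mult_mem)

lemma power_mem: "x \<in> B \<Longrightarrow> x ^ k \<in> B"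
  by (induction k) (auto intro: one_mem mult_mem)

lemma of_nat_mem: "of_nat k \<in> B"
  by (induction k) (auto intro: zero_mem one_mem add_mem)

lemma poly_mem:
  assumes "\<And>i. coeff p i \<in> B" "x \<in> B"
  shows "poly p x \<in> B"
  unfolding poly_altdef using assms by (intro sum_mem mult_mem power_mem)

definition adjoin :: "'a \<Rightarrow> 'a set" where
  "adjoin y = {poly p y | p. \<forall>i. coeff p i \<in> B}"

lemma ring_adjoin: "ring_in_field (adjoin y)"
proof
  show "1 \<in> adjoin y"
    unfolding adjoin_def by (rule CollectI, rule exI[of _ 1]) (auto intro: zero_mem one_mem)
next
  fix a b assume "a \<in> adjoin y" "b \<in> adjoin y"
  then obtain p q where pq: "a = poly p y" "b = poly q y"
      "\<forall>i. coeff p i \<in> B" "\<forall>i. coeff q i \<in> B"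
    unfolding adjoin_def by blast
  show "a - b \<in> adjoin y"
    unfolding adjoin_def using pq by (intro CollectI exI[of _ "p - q"]) (auto intro: diff_mem)
  show "a * b \<in> adjoin y"
    unfolding adjoin_def using pq
    by (intro CollectI exI[of _ "p * q"]) (auto simp: coeff_mult intro!: sum_mem mult_mem)
qed

lemma subset_adjoin: "B \<subseteq> adjoin y"
proof
  fix b assume "b \<in> B"
  then show "b \<in> adjoin y"
    unfolding adjoin_def
    by (intro CollectI exI[of _ "[:b:]"]) (auto simp: coeff_pCons split: nat.split intro: zero_mem)
qed

lemma mem_adjoin: "y \<in> adjoin y"
  unfolding adjoin_def
  by (intro CollectI exI[of _ "[:0, 1:]"])
     (auto simp: coeff_pCons split: nat.split intro: zero_mem one_mem)

end

locale valuation_ring = ring_in_field +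
  assumes total: "x \<in> B \<or> inverse x \<in> B"
begin

definition nonunits :: "'a set" where
  "nonunits = {x. x = 0 \<or> inverse x \<notin> B}"

lemma zero_nonunit: "0 \<in> nonunits"
  by (simp add: nonunits_def)

lemma nonunit_mem: "x \<in> nonunits \<Longrightarrow> x \<in> B"
  using total zero_mem by (auto simp: nonunits_def)

lemma one_not_nonunit: "1 \<notin> nonunits"
  using one_mem by (simp add: nonunits_def)

lemma mult_nonunit: "b \<in> B \<Longrightarrow> x \<in> nonunits \<Longrightarrow> b * x \<in> nonunits"
proof (cases "b = 0")
  case False
  assume b: "b \<in> B" and x: "x \<in> nonunits"
  have "inverse x \<in> B" if "inverse (b * x) \<in> B"
    using mult_mem[OF b that] False by (simp add: field_simps)
  with x False show ?thesis by (auto simp: nonunits_def)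
qed (simp add: zero_nonunit)

lemma mult_nonunit': "x \<in> nonunits \<Longrightarrow> b \<in> B \<Longrightarrow> x * b \<in> nonunits"
  using mult_nonunit[of b x] by (simp add: mult.commute)

lemma uminus_nonunit: "x \<in> nonunits \<Longrightarrow> - x \<in> nonunits"
  using mult_nonunit[of "- 1" x] uminus_mem[OF one_mem] by simp

text \<open>
  Of two nonzero nonunits one is a multiple of the other, so their sum is a multiple of a
  nonunit. Hence the nonunits form the maximal ideal; reduction means calculation modulo it.
\<close>

lemma add_nonunit:
  assumes "x \<in> nonunits" "y \<in> nonunits"
  shows "x + y \<in> nonunits"
proof -
  have *: "a + b \<in> nonunits" if a: "a \<in> nonunits" and b: "b \<in> nonunits" "b \<noteq> 0" "a / b \<in> B" for a b
  proof -
    have "a + b = (a / b + 1) * b" using b by (simp add: field_simps)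
    then show ?thesis using mult_nonunit[OF add_mem[OF b(3) one_mem] b(1)] by simp
  qed
  consider "x = 0" | "y = 0" | "x \<noteq> 0" "y \<noteq> 0" "x / y \<in> B" | "x \<noteq> 0" "y \<noteq> 0" "y / x \<in> B"
    using total[of "x / y"] by fastforce
  then show ?thesis
    using *[of x y] *[of y x] assms by cases (auto simp: add.commute)
qed

lemma diff_nonunit: "x \<in> nonunits \<Longrightarrow> y \<in> nonunits \<Longrightarrow> x - y \<in> nonunits"
  using add_nonunit[of x "- y"] uminus_nonunit by simp

lemma sum_nonunit: "(\<And>i. i \<in> I \<Longrightarrow> f i \<in> nonunits) \<Longrightarrow> sum f I \<in> nonunits"
  by (induction I rule: infinite_finite_induct) (auto intro: zero_nonunit add_nonunit)

lemma nonunit_prime: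
  assumes "x * y \<in> nonunits" "x \<in> B" "y \<in> B"
  shows "x \<in> nonunits \<or> y \<in> nonunits"
proof (rule ccontr)
  assume "\<not> ?thesis"
  then have "x \<noteq> 0" "y \<noteq> 0" "inverse x * inverse y \<in> B"
    by (auto simp: nonunits_def intro: mult_mem)
  with assms show False by (auto simp: nonunits_def)
qed

lemma nonunit_prod:
  assumes "prod f I \<in> nonunits" "\<And>i. i \<in> I \<Longrightarrow> f i \<in> B"
  shows "\<exists>i\<in>I. f i \<in> nonunits"
  using assms
proof (induction I rule: infinite_finite_induct)
  case (insert i I)
  then show ?case using nonunit_prime[of "f i" "prod f I"] prod_mem[of I f] by auto
qed (auto simp: one_not_nonunit)

lemma nonunit_power: "x ^ k \<in> nonunits \<Longrightarrow> x \<in> B \<Longrightarrow> x \<in> nonunits"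
  using nonunit_prod[of "\<lambda>_. x" "{..<k}"] by simp

lemma unit_add_nonunit: "u \<notin> nonunits \<Longrightarrow> x \<in> nonunits \<Longrightarrow> u + x \<notin> nonunits"
  using diff_nonunit[of "u + x" x] by auto

lemma divide_unit_mem: "x \<in> B \<Longrightarrow> u \<notin> nonunits \<Longrightarrow> x / u \<in> B"
  using mult_mem[of x "inverse u"] by (auto simp: nonunits_def field_simps)

end

text \<open>
  This is Chevalley's extension theorem. Zorn's lemma gives a ring \<open>B\<close> that is maximal among
  those containing \<open>A\<close> but not \<open>1 / x\<close>. Maximality makes every \<open>1 - x b\<close> invertible in \<open>B\<close>:
  otherwise \<open>1 / x\<close> would lie in \<open>B[1 / (1 - x b)]\<close>, and clearing denominators would put \<open>1\<close>
  into \<open>x B\<close>. If neither \<open>y\<close> nor \<open>1 / y\<close> were in \<open>B\<close>, then \<open>1\<close> would be a polynomial in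
  \<open>y\<close> and a polynomial in \<open>1 / y\<close> with coefficients in \<open>x B\<close>; two such relations of minimal
  degrees can be combined to lower the larger degree.
\<close>

theorem valuation_ring_exists:
  fixes A :: "'a::field set"
  assumes A: "ring_in_field A" and xA: "x \<in> A" and x0: "x \<noteq> 0" and xi: "inverse x \<notin> A"
  obtains B where "valuation_ring B" "A \<subseteq> B" "inverse x \<notin> B"
proof -
  define \<A> where "\<A> = {B. ring_in_field B \<and> A \<subseteq> B \<and> inverse x \<notin> B}"
  have "\<exists>M\<in>\<A>. \<forall>X\<in>\<A>. M \<subseteq> X \<longrightarrow> X = M"
  proof (rule subset_Zorn_nonempty)
    show "\<A> \<noteq> {}" using A xi by (auto simp: \<A>_def)
  next
    fix \<C> assume ne: "\<C> \<noteq> {}" and ch: "subset.chain \<A> \<C>"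
    have sub: "\<C> \<subseteq> \<A>" and cmp: "X \<subseteq> Y \<or> Y \<subseteq> X" if "X \<in> \<C>" "Y \<in> \<C>" for X Y
      using ch that by (auto simp: subset.chain_def)
    have R: "ring_in_field X" if "X \<in> \<C>" for X
      using ch that by (auto simp: subset.chain_def \<A>_def)
    have pair: "\<exists>X\<in>\<C>. a \<in> X \<and> b \<in> X" if "a \<in> \<Union>\<C>" "b \<in> \<Union>\<C>" for a b
      using that cmp by (meson UnionE subsetD)
    have "ring_in_field (\<Union>\<C>)"
    proof
      show "1 \<in> \<Union>\<C>" using ne R ring_in_field.one_mem by blast
      fix a b assume "a \<in> \<Union>\<C>" "b \<in> \<Union>\<C>"
      from pair[OF this] obtain X where "X \<in> \<C>" "a \<in> X" "b \<in> X" by blast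
      then show "a - b \<in> \<Union>\<C>" "a * b \<in> \<Union>\<C>"
        using R[of X] ring_in_field.diff_mem[of X a b] ring_in_field.mult_mem[of X a b] by blast+
    qed
    then show "\<Union>\<C> \<in> \<A>"
      using ne ch by (fastforce simp: \<A>_def subset.chain_def)
  qed
  then obtain B where B: "B \<in> \<A>" and max: "\<And>X. X \<in> \<A> \<Longrightarrow> B \<subseteq> X \<Longrightarrow> X = B" by blast
  interpret ring_in_field B using B by (simp add: \<A>_def)
  have AB: "A \<subseteq> B" and xiB: "inverse x \<notin> B" using B by (auto simp: \<A>_def)
  have xB: "x \<in> B" using AB xA by blast
  have adj: "inverse x \<in> adjoin y" if "y \<notin> B" for y
  proof (rule ccontr)
    assume "inverse x \<notin> adjoin y"
    then have "adjoin y \<in> \<A>" using ring_adjoin subset_adjoin AB by (auto simp: \<A>_def)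
    with max[OF this subset_adjoin] mem_adjoin that show False by blast
  qed
  have no1: "x * b \<noteq> 1" if "b \<in> B" for b
    using that xiB x0 by (metis inverse_unique)
  have unit: "inverse (1 - x * b) \<in> B" if b: "b \<in> B" for b
  proof (rule ccontr)
    define s where "s = 1 - x * b"
    assume "\<not> ?thesis"
    then obtain p where p: "\<forall>i. coeff p i \<in> B" "inverse x = poly p (inverse s)"
      using adj[of "inverse s"] unfolding adjoin_def s_def by blast
    have s0: "s \<noteq> 0" using no1[OF b] by (simp add: s_def)
    have sB: "s \<in> B" using b xB by (auto simp: s_def intro: diff_mem one_mem mult_mem)
    define c where "c = (\<Sum>i\<le>degree p. coeff p i * s ^ (degree p - i))"
    have cB: "c \<in> B" using p sB by (auto simp: c_def intro!: sum_mem mult_mem power_mem)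
    have "inverse x * s ^ degree p = c"
      unfolding p(2) poly_altdef c_def sum_distrib_right
      using s0 by (intro sum.cong) (auto simp: power_diff field_simps)
    then have sc: "s ^ degree p = x * c" using x0 by (simp add: field_simps)
    have "\<exists>d\<in>B. s ^ k = 1 - x * d" for k
    proof (induction k)
      case 0 then show ?case using zero_mem by (intro bexI[of _ 0]) auto
    next
      case (Suc k)
      then obtain d where d: "d \<in> B" "s ^ k = 1 - x * d" by blast
      have "s ^ Suc k = s * (1 - x * d)" by (simp only: power_Suc d(2))
      also have "\<dots> = 1 - x * (b + d - x * b * d)" by (simp add: s_def algebra_simps)
      finally have "s ^ Suc k = 1 - x * (b + d - x * b * d)" .
      then show ?case using b d xB by (intro bexI[of _ "b + d - x * b * d"]) 
          (auto intro!: diff_mem add_mem mult_mem)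
    qed
    then obtain d where d: "d \<in> B" "s ^ degree p = 1 - x * d" by blast
    have "x * (c + d) = 1" using sc d(2) by (simp add: algebra_simps)
    then show False using no1[OF add_mem[OF cB d(1)]] by simp
  qed
  \<comment> \<open>\<open>rel y k\<close> bounds by \<open>k\<close> the degree of a relation showing that \<open>x\<close> generates the unit ideal of \<open>B[y]\<close>.\<close>
  define rel where "rel y k \<longleftrightarrow> (\<exists>f. (\<forall>i. f i \<in> B) \<and> 1 = (\<Sum>i\<le>k. x * f i * y ^ i))" for y k
  have rel_ex: "\<exists>k. rel y k" if y: "y \<notin> B" for y
  proof -
    obtain p where p: "\<forall>i. coeff p i \<in> B" "inverse x = poly p y"
      using adj[OF y] unfolding adjoin_def by blast
    have "x * poly p y = 1" using p(2) x0 by (metis right_inverse)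
    then show ?thesis unfolding rel_def
      using p(1) by (intro exI[of _ "degree p"] exI[of _ "coeff p"])
        (auto simp: poly_altdef sum_distrib_left mult_ac)
  qed
  have reduce: "rel y (k - 1)"
    if y: "y \<noteq> 0" and r: "rel y k" "rel (inverse y) j" and jk: "j \<le> k" and k: "k > 0" for y k j
  proof -
    obtain f where f: "\<forall>i. f i \<in> B" "1 = (\<Sum>i\<le>k. x * f i * y ^ i)"
      using r unfolding rel_def by blast
    obtain g where g: "\<forall>i. g i \<in> B" "1 = (\<Sum>i\<le>j. x * g i * inverse y ^ i)"
      using r unfolding rel_def by blast
    (* The constant coefficient of the relation for 1 / y is moved to the left and cancelled. *)
    define v where "v = inverse (1 - x * g 0)"
    have vB: "v \<in> B" using unit g by (simp add: v_def)
    have v1: "v * (1 - x * g 0) = 1" using no1 g by (simp add: v_def)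
    \<comment> \<open>From the relation for \<open>1 / y\<close>: \<open>y\<^sup>k\<close> is a combination of lower powers.\<close>
    have split: "(\<Sum>i\<le>j. x * g i * inverse y ^ i) = x * g 0 + (\<Sum>i\<in>{1..j}. x * g i * inverse y ^ i)"
      by (subst sum.atMost_shift) (simp add: sum.atLeast1_atMost_eq)
    have g1: "1 - x * g 0 = (\<Sum>i\<in>{1..j}. x * g i * inverse y ^ i)"
      using trans[OF g(2) split] by (metis add_diff_cancel_left')
    have "y ^ k * (v * (1 - x * g 0)) = (\<Sum>i\<in>{1..j}. x * (v * g i) * y ^ (k - i))"
      unfolding g1 sum_distrib_left
      using y jk by (intro sum.cong refl) (auto simp: power_diff field_simps)
    then have yk: "y ^ k = (\<Sum>i\<in>{1..j}. x * (v * g i) * y ^ (k - i))" by (simp add: v1)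
    also have "\<dots> = (\<Sum>i\<in>{k-j..k-1}. x * (v * g (k - i)) * y ^ i)"
      by (rule sum.reindex_bij_witness[of _ "\<lambda>i. k - i" "\<lambda>i. k - i"]) (use jk k in auto)
    also have "\<dots> = (\<Sum>i\<le>k - 1. x * (if k - j \<le> i then v * g (k - i) else 0) * y ^ i)"
      by (rule sum.mono_neutral_cong_left) auto
    finally have yk: "y ^ k = \<dots>" .
    define h where "h i = f i + x * f k * (if k - j \<le> i then v * g (k - i) else 0)" for i
    have "1 = (\<Sum>i\<le>k - 1. x * f i * y ^ i) + x * f k * y ^ k"
      using f(2) k by (cases k) auto
    also have "\<dots> = (\<Sum>i\<le>k - 1. x * h i * y ^ i)"
      unfolding yk h_def by (simp add: sum_distrib_left sum.distrib[symmetric] algebra_simps)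
    finally have "1 = (\<Sum>i\<le>k - 1. x * h i * y ^ i)" .
    moreover have "\<forall>i. h i \<in> B"
      using f g vB xB by (auto simp: h_def intro!: add_mem mult_mem zero_mem)
    ultimately show ?thesis unfolding rel_def by blast
  qed
  have "valuation_ring B"
  proof
    fix y
    show "y \<in> B \<or> inverse y \<in> B"
    proof (rule ccontr)
      assume "\<not> ?thesis"
      then have y: "y \<notin> B" and yi: "inverse y \<notin> B" by auto
      have y0: "y \<noteq> 0" using y zero_mem by auto
      define k where "k = (LEAST k. rel y k)"
      define j where "j = (LEAST k. rel (inverse y) k)"
      have rk: "rel y k" and rj: "rel (inverse y) j"
        using rel_ex[OF y] rel_ex[OF yi] LeastI_ex unfolding k_def j_def by blast+
      have pos: "i > 0" if r: "rel w i" for w i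
      proof (rule ccontr)
        assume "\<not> i > 0"
        then obtain b where "b \<in> B" "x * b = 1" using r unfolding rel_def by auto
        then show False using no1 by metis
      qed
      show False
      proof (cases "j \<le> k")
        case True
        have "rel y (k - 1)" using reduce[OF y0 rk rj True] pos[OF rk] by simp
        then have "k \<le> k - 1" unfolding k_def by (rule Least_le)
        with pos[OF rk] show False by simp
      next
        case False
        have "rel (inverse y) (j - 1)"
          using reduce[of "inverse y" j k] y0 rk rj False pos[OF rj] by simp
        then have "j \<le> j - 1" unfolding j_def by (rule Least_le)
        with pos[OF rj] show False by simp
      qed
    qed
  qed
  with that AB xiB show ?thesis by blast
qed

section \<open>Reduction of polynomials\<close>

context valuation_ring
begin

definition integral_poly :: "'a poly \<Rightarrow> bool" where
  "integral_poly p \<longleftrightarrow> (\<forall>i. coeff p i \<in> B)"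

definition small_poly :: "'a poly \<Rightarrow> bool" where
  "small_poly p \<longleftrightarrow> (\<forall>i. coeff p i \<in> nonunits)"

text \<open>
  Primitive polynomials are those that stay nonzero under reduction of their coefficients to the
  residue field.
\<close>

definition primitive_poly :: "'a poly \<Rightarrow> bool" where
  "primitive_poly p \<longleftrightarrow> integral_poly p \<and> \<not> small_poly p"

lemma integral_poly_add: "integral_poly p \<Longrightarrow> integral_poly q \<Longrightarrow> integral_poly (p + q)"
  by (auto simp: integral_poly_def intro: add_mem)

lemma integral_poly_diff: "integral_poly p \<Longrightarrow> integral_poly q \<Longrightarrow> integral_poly (p - q)"
  by (auto simp: integral_poly_def intro: diff_mem)

lemma integral_poly_mult: "integral_poly p \<Longrightarrow> integral_poly q \<Longrightarrow> integral_poly (p * q)"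
  by (auto simp: integral_poly_def coeff_mult intro!: sum_mem mult_mem)

lemma integral_poly_smult: "c \<in> B \<Longrightarrow> integral_poly p \<Longrightarrow> integral_poly (smult c p)"
  by (auto simp: integral_poly_def intro: mult_mem)

lemma integral_poly_0: "integral_poly 0"
  by (auto simp: integral_poly_def zero_mem)

lemma integral_poly_pCons: "a \<in> B \<Longrightarrow> integral_poly p \<Longrightarrow> integral_poly (pCons a p)"
  by (auto simp: integral_poly_def coeff_pCons split: nat.split)

lemma integral_poly_1: "integral_poly 1"
  by (auto simp: integral_poly_def zero_mem one_mem)

lemma integral_poly_pderiv: "integral_poly p \<Longrightarrow> integral_poly (pderiv p)"
  unfolding integral_poly_def coeff_pderiv
  using mult_mem[OF of_nat_mem] by (auto simp del: of_nat_Suc)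

lemma integral_poly_pcompose:
  "integral_poly p \<Longrightarrow> integral_poly q \<Longrightarrow> integral_poly (pcompose p q)"
proof (induction p)
  case (pCons a p)
  have "integral_poly p" "a \<in> B"
    using pCons.prems(1) unfolding integral_poly_def by (metis coeff_pCons_Suc, metis coeff_pCons_0)
  then show ?case using pCons
    by (auto simp: pcompose_pCons intro!: integral_poly_add integral_poly_mult integral_poly_pCons integral_poly_0)
qed (simp add: integral_poly_0)

lemma integral_poly_mem: "integral_poly p \<Longrightarrow> x \<in> B \<Longrightarrow> poly p x \<in> B"
  unfolding integral_poly_def by (intro poly_mem) auto

lemma small_poly_diff: "small_poly p \<Longrightarrow> small_poly q \<Longrightarrow> small_poly (p - q)"
  by (auto simp: small_poly_def intro: diff_nonunit)

lemma small_poly_add: "small_poly p \<Longrightarrow> small_poly q \<Longrightarrow> small_poly (p + q)"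
  by (auto simp: small_poly_def intro: add_nonunit)

lemma small_poly_smult: "c \<in> nonunits \<Longrightarrow> integral_poly p \<Longrightarrow> small_poly (smult c p)"
  by (auto simp: small_poly_def integral_poly_def intro: mult_nonunit')

lemma small_poly_nonunit:
  assumes "small_poly p" "x \<in> B"
  shows "poly p x \<in> nonunits"
  unfolding poly_altdef using assms
  by (auto simp: small_poly_def intro!: sum_nonunit mult_nonunit' power_mem)

text \<open>Gauss's lemma: the lowest coefficients that are units multiply to a unit.\<close>

lemma primitive_poly_mult:
  assumes "primitive_poly p" "primitive_poly q"
  shows "primitive_poly (p * q)"
proof -
  define i where "i = (LEAST i. coeff p i \<notin> nonunits)"
  define j where "j = (LEAST j. coeff q j \<notin> nonunits)"
  have i: "coeff p i \<notin> nonunits" and j: "coeff q j \<notin> nonunits"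
    using assms LeastI_ex unfolding i_def j_def primitive_poly_def small_poly_def by metis+
  have il: "coeff p k \<in> nonunits" if "k < i" for k
    using not_less_Least[of k "\<lambda>i. coeff p i \<notin> nonunits"] that unfolding i_def by simp
  have jl: "coeff q k \<in> nonunits" if "k < j" for k
    using not_less_Least[of k "\<lambda>i. coeff q i \<notin> nonunits"] that unfolding j_def by simp
  have pB: "coeff p k \<in> B" and qB: "coeff q k \<in> B" for k
    using assms by (auto simp: primitive_poly_def integral_poly_def)
  have "coeff (p * q) (i + j) = coeff p i * coeff q j + (\<Sum>k\<in>{..i + j} - {i}. coeff p k * coeff q (i + j - k))"
    unfolding coeff_mult by (subst sum.remove[of _ i]) auto
  moreover have "(\<Sum>k\<in>{..i + j} - {i}. coeff p k * coeff q (i + j - k)) \<in> nonunits"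
  proof (rule sum_nonunit)
    fix k assume "k \<in> {..i + j} - {i}"
    then have "k < i \<or> i + j - k < j" by auto
    then show "coeff p k * coeff q (i + j - k) \<in> nonunits"
      using il jl pB qB mult_nonunit mult_nonunit' by blast
  qed
  moreover have "coeff p i * coeff q j \<notin> nonunits"
    using nonunit_prime[of "coeff p i" "coeff q j"] i j pB qB by blast
  ultimately have "coeff (p * q) (i + j) \<notin> nonunits"
    using unit_add_nonunit by simp
  then show ?thesis
    using assms integral_poly_mult by (auto simp: primitive_poly_def small_poly_def)
qed

lemma primitive_poly_1: "primitive_poly 1"
  using integral_poly_1 one_not_nonunit
  by (auto simp: primitive_poly_def small_poly_def intro!: exI[of _ 0])

lemma primitive_poly_power: "primitive_poly p \<Longrightarrow> primitive_poly (p ^ k)"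
  by (induction k) (auto intro: primitive_poly_1 primitive_poly_mult)

lemma primitive_poly_linear: "a \<in> B \<Longrightarrow> primitive_poly [:a, 1:]"
  using one_not_nonunit
  by (auto simp: primitive_poly_def small_poly_def
       intro!: integral_poly_pCons integral_poly_0 one_mem exI[of _ 1])

text \<open>
  Divisibility is a total preorder in a valuation ring, so some coefficient divides all the
  others, and one can divide by it.
\<close>

lemma primitive_poly_scaling:
  assumes "p \<noteq> 0"
  obtains c where "c \<noteq> 0" "primitive_poly (smult c p)"
proof -
  have "\<exists>c. c \<noteq> 0 \<and> primitive_poly (smult c p)"
    using assms
  proof (induction p)
    case (pCons a p)
    have prim1: "primitive_poly (pCons 1 q)" if "integral_poly q" for q
      using that one_not_nonunit
      by (auto simp: primitive_poly_def small_poly_def intro!: integral_poly_pCons one_mem exI[of _ 0])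
    show ?case
    proof (cases "p = 0")
      case True
      then have "a \<noteq> 0" using pCons by auto
      then show ?thesis using True prim1[OF integral_poly_0]
        by (intro exI[of _ "inverse a"]) auto
    next
      case False
      then obtain c where c: "c \<noteq> 0" "primitive_poly (smult c p)" using pCons by blast
      show ?thesis
      proof (cases "c * a \<in> B")
        case True
        have "integral_poly (smult c (pCons a p))"
          using c True by (auto simp: primitive_poly_def intro: integral_poly_pCons)
        moreover have "\<not> small_poly (smult c (pCons a p))"
          using c(2) unfolding primitive_poly_def small_poly_def
          by (metis coeff_pCons_Suc smult_pCons)
        ultimately show ?thesis using c by (auto simp: primitive_poly_def)
      next
        case False
        then have a0: "a \<noteq> 0" and inv: "inverse (c * a) \<in> B" using total[of "c * a"] zero_mem by auto
        have "smult (inverse a) p = smult (inverse (c * a)) (smult c p)"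
          using c by (simp add: field_simps)
        then have "integral_poly (smult (inverse a) p)"
          using inv c(2) integral_poly_smult unfolding primitive_poly_def by metis
        then show ?thesis using prim1 a0 by (intro exI[of _ "inverse a"]) auto
      qed
    qed
  qed auto
  then show ?thesis using that by blast
qed

text \<open>
  A primitive factor can be cancelled: after dividing \<open>q\<close> by its content \<open>1 / c\<close>, Gauss's lemma
  shows that \<open>p * q\<close> has the same content up to a unit.
\<close>

lemma small_poly_cancel:
  assumes "primitive_poly p" "small_poly (p * q)"
  shows "small_poly q"
proof (cases "q = 0")
  case False
  then obtain c where c: "c \<noteq> 0" "primitive_poly (smult c q)" by (rule primitive_poly_scaling)
  have q: "q = smult (inverse c) (smult c q)" using c by simp
  have "inverse c \<in> nonunits"
  proof (rule ccontr)
    assume "inverse c \<notin> nonunits"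
    then have cB: "c \<in> B" using c(1) by (simp add: nonunits_def)
    have "smult c (p * q) = p * smult c q" by simp
    moreover have "small_poly (smult c (p * q))"
      using assms(2) cB by (auto simp: small_poly_def intro: mult_nonunit)
    ultimately show False using primitive_poly_mult[OF assms(1) c(2)] by (simp add: primitive_poly_def)
  qed
  then show ?thesis using c(2) q small_poly_smult unfolding primitive_poly_def by metis
qed (simp add: small_poly_def zero_nonunit)

end

section \<open>Generic points\<close>

datatype coord = Lam1 | Lam2 | Z1 | Z2

instance coord :: countable by countable_datatype

text \<open>
  Integer polynomials in the four parameters are represented by expressions: countability is
  then automatic, and substitution and evaluation are structural recursions.
\<close>

datatype int_expr = Var coord | Const int | Add int_expr int_expr | Mult int_expr int_expr

instance int_expr :: countable by countable_datatype

primrec ev :: "int_expr \<Rightarrow> (coord \<Rightarrow> complex) \<Rightarrow> complex" where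
  "ev (Var i) \<xi> = \<xi> i"
| "ev (Const k) \<xi> = of_int k"
| "ev (Add a b) \<xi> = ev a \<xi> + ev b \<xi>"
| "ev (Mult a b) \<xi> = ev a \<xi> * ev b \<xi>"

definition Diff :: "int_expr \<Rightarrow> int_expr \<Rightarrow> int_expr" where
  "Diff a b = Add a (Mult (Const (- 1)) b)"

lemma ev_Diff [simp]: "ev (Diff a b) \<xi> = ev a \<xi> - ev b \<xi>"
  by (simp add: Diff_def)

fun coords :: "(complex^2) \<times> (complex^2) \<Rightarrow> coord \<Rightarrow> complex" where
  "coords (lam, z) Lam1 = lam $ 1"
| "coords (lam, z) Lam2 = lam $ 2"
| "coords (lam, z) Z1 = z $ 1"
| "coords (lam, z) Z2 = z $ 2"

text \<open>
  For complex numbers this is algebraic independence over the rationals. It is phrased as a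
  transfer principle: a relation at the generic point \<open>\<xi>\<close> holds at every point \<open>\<eta>\<close>.
\<close>

definition alg_independent :: "(coord \<Rightarrow> complex) \<Rightarrow> bool" where
  "alg_independent \<xi> \<longleftrightarrow> (\<forall>e. ev e \<xi> = 0 \<longrightarrow> (\<forall>\<eta>. ev e \<eta> = 0))"

lemma alg_independentD: "alg_independent \<xi> \<Longrightarrow> ev e \<xi> = 0 \<Longrightarrow> ev e \<eta> = 0"
  by (auto simp: alg_independent_def)

lemma alg_independent_neq:
  assumes "alg_independent \<xi>" "ev e \<eta> \<noteq> 0"
  shows "ev e \<xi> \<noteq> 0"
  using assms by (auto simp: alg_independent_def)

lemma int_expr_is_polynomial: "\<exists>P. \<forall>w. eval4 P w = ev e (coords w)"
proof (induction e)
  case (Var i)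
  have z2: "eval4 [:[:[:[:0, 1:]:]:]:] w = coords w Z2"
    and z1: "eval4 [:[:[:0, 1:]:]:] w = coords w Z1"
    and l2: "eval4 [:[:0, 1:]:] w = coords w Lam2"
    and l1: "eval4 [:0, 1:] w = coords w Lam1" for w
    by (cases w; simp add: eval4_def)+
  show ?case
  proof (cases i)
    case Lam1 then show ?thesis using l1 by (intro exI[of _ "[:0, 1:]"]) (simp del: split_paired_All)
  next
    case Lam2 then show ?thesis using l2 by (intro exI[of _ "[:[:0, 1:]:]"]) (simp del: split_paired_All)
  next
    case Z1 then show ?thesis using z1 by (intro exI[of _ "[:[:[:0, 1:]:]:]"]) (simp del: split_paired_All)
  next
    case Z2 then show ?thesis using z2 by (intro exI[of _ "[:[:[:[:0, 1:]:]:]:]"]) (simp del: split_paired_All)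
  qed
next
  case (Const k)
  show ?case by (intro exI[of _ "[:[:[:[:of_int k:]:]:]:]"]) (simp add: eval4_def)
next
  case (Add a b)
  then obtain P Q where "\<forall>w. eval4 P w = ev a (coords w)" "\<forall>w. eval4 Q w = ev b (coords w)" by blast
  then show ?case by (intro exI[of _ "P + Q"]) (simp add: eval4_def)
next
  case (Mult a b)
  then obtain P Q where "\<forall>w. eval4 P w = ev a (coords w)" "\<forall>w. eval4 Q w = ev b (coords w)" by blast
  then show ?case by (intro exI[of _ "P * Q"]) (simp add: eval4_def)
qed

lemma coords_surj: "\<exists>w. coords w = \<eta>"
proof
  show "coords (vector [\<eta> Lam1, \<eta> Lam2], vector [\<eta> Z1, \<eta> Z2]) = \<eta>"
  proof
    fix i show "coords (vector [\<eta> Lam1, \<eta> Lam2], vector [\<eta> Z1, \<eta> Z2]) i = \<eta> i"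
      by (cases i) simp_all
  qed
qed

text \<open>
  There are only countably many integer polynomials, so the coordinates of a generic point
  satisfy no nontrivial algebraic relation over the integers.
\<close>

theorem generically_if_alg_independent:
  assumes "\<And>w. alg_independent (coords w) \<Longrightarrow> Q w"
  shows "generically Q"
proof -
  define N where "N e = {w. ev e (coords w) = 0}" for e
  define E where "E = N ` {e. N e \<noteq> UNIV}"
  have "countable E" unfolding E_def by (intro countable_image) auto
  moreover have "algebraic_subset A \<and> A \<noteq> UNIV" if "A \<in> E" for A
  proof -
    from that obtain e where e: "A = N e" "N e \<noteq> UNIV" by (auto simp: E_def)
    obtain P where "\<forall>w. eval4 P w = ev e (coords w)" using int_expr_is_polynomial by blast
    then have "algebraic_subset (N e)"
      unfolding algebraic_subset_def N_def by (intro exI[of _ "{P}"]) (simp del: split_paired_All)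
    with e show ?thesis by simp
  qed
  moreover have "Q w" if "w \<notin> \<Union>E" for w
  proof (rule assms, unfold alg_independent_def, intro allI impI)
    fix e \<eta> assume "ev e (coords w) = 0"
    then have "N e = UNIV" using that by (auto simp: E_def N_def)
    moreover obtain v where "coords v = \<eta>" using coords_surj by blast
    ultimately show "ev e \<eta> = 0" by (auto simp: N_def)
  qed
  ultimately show ?thesis unfolding generically_def by blast
qed

primrec subst :: "(coord \<Rightarrow> int_expr) \<Rightarrow> int_expr \<Rightarrow> int_expr" where
  "subst \<sigma> (Var i) = \<sigma> i"
| "subst \<sigma> (Const k) = Const k"
| "subst \<sigma> (Add a b) = Add (subst \<sigma> a) (subst \<sigma> b)"
| "subst \<sigma> (Mult a b) = Mult (subst \<sigma> a) (subst \<sigma> b)"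

lemma ev_subst: "ev (subst \<sigma> e) \<xi> = ev e (\<lambda>i. ev (\<sigma> i) \<xi>)"
  by (induction e) auto

lemma alg_independent_subst:
  assumes "alg_independent \<xi>" and surj: "\<And>\<eta>. \<exists>\<eta>'. (\<lambda>i. ev (\<sigma> i) \<eta>') = \<eta>"
  shows "alg_independent (\<lambda>i. ev (\<sigma> i) \<xi>)"
  unfolding alg_independent_def
proof (intro allI impI)
  fix e \<eta> assume "ev e (\<lambda>i. ev (\<sigma> i) \<xi>) = 0"
  then have "ev (subst \<sigma> e) \<xi> = 0" by (simp add: ev_subst)
  moreover obtain \<eta>' where "(\<lambda>i. ev (\<sigma> i) \<eta>') = \<eta>" using surj by blast
  ultimately show "ev e \<eta> = 0"
    using alg_independentD[OF assms(1), of "subst \<sigma> e" \<eta>'] by (simp add: ev_subst)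
qed

lemma clear_denominators:
  "\<exists>N e'. \<forall>\<eta>. \<eta> i \<noteq> 0 \<longrightarrow> \<eta> i ^ N * ev e (\<eta>(i := inverse (\<eta> i))) = ev e' \<eta>"
proof (induction e)
  case (Var j)
  show ?case
  proof (cases "j = i")
    case True
    then show ?thesis by (intro exI[of _ 1] exI[of _ "Const 1"]) auto
  next
    case False
    then show ?thesis by (intro exI[of _ 0] exI[of _ "Var j"]) auto
  qed
next
  case (Const k)
  show ?case by (intro exI[of _ 0] exI[of _ "Const k"]) auto
next
  case (Add a b)
  then obtain N a' M b' where *:
    "\<forall>\<eta>. \<eta> i \<noteq> 0 \<longrightarrow> \<eta> i ^ N * ev a (\<eta>(i := inverse (\<eta> i))) = ev a' \<eta>"
    "\<forall>\<eta>. \<eta> i \<noteq> 0 \<longrightarrow> \<eta> i ^ M * ev b (\<eta>(i := inverse (\<eta> i))) = ev b' \<eta>" by blast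
  define pow where "pow k = ((\<lambda>e. Mult (Var i) e) ^^ k) (Const 1)" for k
  have pow: "ev (pow k) \<eta> = \<eta> i ^ k" for k \<eta>
    unfolding pow_def by (induction k) auto
  show ?case
  proof (intro exI allI impI)
    fix \<eta> :: "coord \<Rightarrow> complex" assume "\<eta> i \<noteq> 0"
    with * have eqs: "ev a' \<eta> = \<eta> i ^ N * ev a (\<eta>(i := inverse (\<eta> i)))"
      "ev b' \<eta> = \<eta> i ^ M * ev b (\<eta>(i := inverse (\<eta> i)))" by auto
    show "\<eta> i ^ (N + M) * ev (Add a b) (\<eta>(i := inverse (\<eta> i)))
        = ev (Add (Mult (pow M) a') (Mult (pow N) b')) \<eta>"
      by (simp add: pow power_add algebra_simps eqs)
  qed
next
  case (Mult a b)
  then obtain N a' M b' where *: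
    "\<forall>\<eta>. \<eta> i \<noteq> 0 \<longrightarrow> \<eta> i ^ N * ev a (\<eta>(i := inverse (\<eta> i))) = ev a' \<eta>"
    "\<forall>\<eta>. \<eta> i \<noteq> 0 \<longrightarrow> \<eta> i ^ M * ev b (\<eta>(i := inverse (\<eta> i))) = ev b' \<eta>" by blast
  show ?case
  proof (intro exI allI impI)
    fix \<eta> :: "coord \<Rightarrow> complex" assume "\<eta> i \<noteq> 0"
    with * have eqs: "ev a' \<eta> = \<eta> i ^ N * ev a (\<eta>(i := inverse (\<eta> i)))"
      "ev b' \<eta> = \<eta> i ^ M * ev b (\<eta>(i := inverse (\<eta> i)))" by auto
    show "\<eta> i ^ (N + M) * ev (Mult a b) (\<eta>(i := inverse (\<eta> i))) = ev (Mult a' b') \<eta>"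
      by (simp add: power_add algebra_simps eqs)
  qed
qed

lemma isCont_ev: "isCont (\<lambda>t. ev e (\<eta>(i := t))) s"
proof (induction e)
  case (Var j)
  then show ?case by (cases "j = i") auto
qed auto

text \<open>
  Relations among the new coordinates become relations among the old ones after multiplication
  by a power of the inverted coordinate. This makes it possible to let a coordinate degenerate
  to infinity.
\<close>

lemma alg_independent_inverse:
  assumes "alg_independent \<xi>"
  shows "alg_independent (\<xi>(i := inverse (\<xi> i)))"
  unfolding alg_independent_def
proof (intro allI impI)
  fix e \<eta> assume e: "ev e (\<xi>(i := inverse (\<xi> i))) = 0"
  obtain N e' where e': "\<And>\<eta>. \<eta> i \<noteq> 0 \<Longrightarrow> \<eta> i ^ N * ev e (\<eta>(i := inverse (\<eta> i))) = ev e' \<eta>"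
    using clear_denominators by blast
  have "\<xi> i \<noteq> 0"
    using alg_independent_neq[OF assms, of "Var i" "\<lambda>_. 1"] by simp
  then have "ev e' \<xi> = 0" using e'[of \<xi>] e by simp
  then have all: "ev e' \<eta> = 0" for \<eta> using alg_independentD[OF assms] by blast
  have nz: "ev e (\<eta>(i := t)) = 0" if "t \<noteq> 0" for t
    using e'[of "\<eta>(i := inverse t)"] that all by simp
  \<comment> \<open>The remaining value \<open>0\<close> of the coordinate is reached by continuity.\<close>
  have "(\<lambda>t. ev e (\<eta>(i := t))) \<midarrow>0\<rightarrow> ev e (\<eta>(i := 0))"
    using isCont_ev[where s = 0 and e = e and \<eta> = \<eta> and i = i] by (simp add: isCont_def)
  moreover have "(\<lambda>t. ev e (\<eta>(i := t))) \<midarrow>0\<rightarrow> 0"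
    by (rule Lim_transform_eventually[OF tendsto_const])
       (auto simp: eventually_at nz intro!: exI[of _ 1])
  ultimately have "ev e (\<eta>(i := 0)) = 0" by (rule LIM_unique)
  then have "ev e (\<eta>(i := \<eta> i)) = 0" using nz[of "\<eta> i"] by (cases "\<eta> i = 0") (simp_all del: fun_upd_triv)
  then show "ev e \<eta> = 0" by simp
qed

text \<open>
  This is what genericity is used for.
  Fractions of integer polynomials whose denominator does not vanish at \<open>\<eta>\<close> form a ring, which
  does not contain the inverse of a coordinate that vanishes at \<open>\<eta>\<close>. A valuation ring above it
  makes it possible to let a generic point degenerate to \<open>\<eta>\<close> while all complex numbers that are
  algebraic over its coordinates follow.
\<close>

theorem generic_specialisation:
  assumes ind: "alg_independent \<xi>" and \<eta>: "\<eta> i = 0"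
  obtains B where "valuation_ring B" "\<xi> i \<in> valuation_ring.nonunits B"
    "\<forall>e. ev e \<xi> \<in> B" "\<forall>e. ev e \<eta> \<noteq> 0 \<longrightarrow> ev e \<xi> \<notin> valuation_ring.nonunits B"
proof -
  define A where "A = {ev a \<xi> / ev b \<xi> | a b. ev b \<eta> \<noteq> 0}"
  have ne: "ev b \<xi> \<noteq> 0" if "ev b \<eta> \<noteq> 0" for b
    using alg_independent_neq[OF ind that] .
  have A: "ring_in_field A"
  proof
    show "1 \<in> A" unfolding A_def by (intro CollectI exI[of _ "Const 1"]) simp
  next
    fix x y assume "x \<in> A" "y \<in> A"
    then obtain a b c d where *: "x = ev a \<xi> / ev b \<xi>" "y = ev c \<xi> / ev d \<xi>" "ev b \<eta> \<noteq> 0" "ev d \<eta> \<noteq> 0"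
      unfolding A_def by blast
    show "x - y \<in> A" unfolding A_def
      by (intro CollectI exI[of _ "Diff (Mult a d) (Mult c b)"] exI[of _ "Mult b d"])
         (simp add: * ne[OF *(3)] ne[OF *(4)] diff_frac_eq)
    show "x * y \<in> A" unfolding A_def
      by (intro CollectI exI[of _ "Mult a c"] exI[of _ "Mult b d"]) (use * in auto)
  qed
  have in_A: "ev e \<xi> \<in> A" for e
    unfolding A_def by (intro CollectI exI[of _ e] exI[of _ "Const 1"]) auto
  have inv_A: "inverse (ev e \<xi>) \<in> A" if "ev e \<eta> \<noteq> 0" for e
    unfolding A_def using that by (intro CollectI exI[of _ "Const 1"] exI[of _ e]) (auto simp: field_simps)
  have x0: "\<xi> i \<noteq> 0"
    using alg_independent_neq[OF ind, of "Var i" "\<lambda>_. 1"] by simp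
  have "inverse (\<xi> i) \<notin> A"
  proof
    assume "inverse (\<xi> i) \<in> A"
    then obtain a b where ab: "inverse (\<xi> i) = ev a \<xi> / ev b \<xi>" "ev b \<eta> \<noteq> 0" unfolding A_def by blast
    then have "ev (Diff b (Mult (Var i) a)) \<xi> = 0" using x0 ne[OF ab(2)] by (simp add: field_simps)
    then have "ev (Diff b (Mult (Var i) a)) \<eta> = 0" by (rule alg_independentD[OF ind])
    with ab(2) \<eta> show False by simp
  qed
  then obtain B where B: "valuation_ring B" "A \<subseteq> B" "inverse (\<xi> i) \<notin> B"
    using valuation_ring_exists[OF A _ x0] in_A[of "Var i"] by auto
  interpret valuation_ring B by (rule B)
  show ?thesis
  proof (rule that[OF B(1)])
    show "\<xi> i \<in> nonunits" using B by (simp add: nonunits_def)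
    show "\<forall>e. ev e \<xi> \<in> B" using in_A B by blast
    show "\<forall>e. ev e \<eta> \<noteq> 0 \<longrightarrow> ev e \<xi> \<notin> nonunits"
    proof (intro allI impI)
      fix e assume "ev e \<eta> \<noteq> 0"
      from inv_A[OF this] ne[OF this] B show "ev e \<xi> \<notin> nonunits" by (auto simp: nonunits_def)
    qed
  qed
qed

section \<open>The Wronskian of two quasi-polynomials\<close>

text \<open>
  With \<open>\<mu> = b - a\<close>, the Wronskian of \<open>x\<^sup>a p(x)\<close> and \<open>x\<^sup>b q(x)\<close> is this polynomial times
  the power of \<open>x\<close> with exponent \<open>a + b - 1\<close>.
\<close>

definition quasi_wronskian :: "'a::field \<Rightarrow> 'a poly \<Rightarrow> 'a poly \<Rightarrow> 'a poly" where
  "quasi_wronskian \<mu> p q = [:0, 1:] * (p * pderiv q - pderiv p * q) + smult \<mu> (p * q)"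

lemma quasi_wronskian_swap: "quasi_wronskian (- \<mu>) q p = - quasi_wronskian \<mu> p q"
  by (simp add: quasi_wronskian_def algebra_simps)

lemma quasi_wronskian_smult:
  "quasi_wronskian \<mu> (smult a p) (smult b q) = smult (a * b) (quasi_wronskian \<mu> p q)"
  by (simp add: quasi_wronskian_def pderiv_smult smult_add_right smult_diff_right algebra_simps)

context valuation_ring
begin

text \<open>
  Let \<open>\<mu>\<close> degenerate to infinity. After normalisation of \<open>p\<close> and \<open>q\<close> to primitive
  polynomials and division by \<open>\<mu>\<close>, the terms with derivatives become infinitesimal, so that
  \<open>p q\<close> reduces to a nonzero multiple of \<open>[:- z, 1:] ^ m * [:- z', 1:] ^ m'\<close>. As \<open>z\<close> and \<open>z'\<close> stay
  distinct, this has a zero of order only \<open>m\<close> at \<open>z\<close>.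
\<close>

lemma wronskian_excludes_high_order:
  assumes W: "quasi_wronskian \<mu> p q = smult c ([:- z, 1:] ^ m * [:- z', 1:] ^ m')"
    and p0: "p \<noteq> 0" and q0: "q \<noteq> 0" and mu: "\<mu> \<noteq> 0" "inverse \<mu> \<in> nonunits"
    and z: "z \<in> B" "z' \<in> B" "z - z' \<notin> nonunits"
  shows "\<not> [:- z, 1:] ^ Suc m dvd p"
proof
  assume dvd: "[:- z, 1:] ^ Suc m dvd p"
  obtain a where a: "a \<noteq> 0" "primitive_poly (smult a p)" using p0 by (rule primitive_poly_scaling)
  obtain b where b: "b \<noteq> 0" "primitive_poly (smult b q)" using q0 by (rule primitive_poly_scaling)
  define P Q where "P = smult a p" and "Q = smult b q"
  define W0 where "W0 = [:- z, 1:] ^ m * [:- z', 1:] ^ m'"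
  define d where "d = inverse \<mu> * (a * b * c)"
  define S where "S = smult (inverse \<mu>) ([:0, 1:] * (P * pderiv Q - pderiv P * Q))"
  have intP: "integral_poly P" and intQ: "integral_poly Q"
    using a b by (auto simp: P_def Q_def primitive_poly_def)
  have primPQ: "primitive_poly (P * Q)"
    using primitive_poly_mult[OF a(2) b(2)] by (simp add: P_def Q_def)
  have intX: "integral_poly [:0, 1:]"
    by (intro integral_poly_pCons integral_poly_0 zero_mem one_mem)
  have primW0: "primitive_poly W0"
    unfolding W0_def by (intro primitive_poly_mult primitive_poly_power primitive_poly_linear uminus_mem z)
  have "quasi_wronskian \<mu> P Q = smult (a * b * c) W0"
    unfolding P_def Q_def quasi_wronskian_smult W W0_def by (simp add: mult_ac)
  then have "smult (inverse \<mu>) (quasi_wronskian \<mu> P Q) = smult d W0" by (simp add: d_def)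
  then have eq: "P * Q + S = smult d W0"
    using mu by (simp add: quasi_wronskian_def S_def smult_add_right add.commute)
  have smallS: "small_poly S"
    unfolding S_def
    by (intro small_poly_smult mu integral_poly_mult integral_poly_diff intX intP intQ integral_poly_pderiv)
  have intS: "integral_poly S"
    using smallS nonunit_mem by (auto simp: small_poly_def integral_poly_def)
  have dB: "d \<in> B"
  proof -
    obtain i where i: "coeff W0 i \<notin> nonunits" using primW0 by (auto simp: primitive_poly_def small_poly_def)
    have "integral_poly (smult d W0)"
      using integral_poly_add[OF _ intS, of "P * Q"] primPQ eq by (simp add: primitive_poly_def)
    then have "d * coeff W0 i \<in> B" by (simp add: integral_poly_def)
    from divide_unit_mem[OF this i] show ?thesis using i zero_nonunit by (cases "coeff W0 i = 0") auto
  qed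
  have d: "d \<notin> nonunits"
  proof
    assume "d \<in> nonunits"
    then have "small_poly (smult d W0)"
      using primW0 small_poly_smult by (auto simp: primitive_poly_def)
    from small_poly_diff[OF this smallS] have "small_poly (P * Q)"
      unfolding eq[symmetric] add_diff_cancel_right' .
    with primPQ show False by (simp add: primitive_poly_def)
  qed
  obtain r where r: "p = [:- z, 1:] ^ Suc m * r" using dvd by blast
  define V where "V = smult d ([:- z', 1:] ^ m') - [:- z, 1:] * smult a r * Q"
  have "[:- z, 1:] ^ m * V = smult d W0 - P * Q"
    by (simp add: V_def W0_def P_def r right_diff_distrib mult_ac del: mult_pCons_left mult_pCons_right)
  also have "\<dots> = S" by (simp flip: eq)
  finally have "small_poly ([:- z, 1:] ^ m * V)" using smallS by simp
  then have "small_poly V"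
    by (rule small_poly_cancel[rotated]) (intro primitive_poly_power primitive_poly_linear uminus_mem z)
  then have "poly V z \<in> nonunits" by (rule small_poly_nonunit) (rule z)
  then have "d * (z - z') ^ m' \<in> nonunits" by (simp add: V_def)
  then have "(z - z') ^ m' \<in> nonunits"
    using nonunit_prime[OF _ dB power_mem[OF diff_mem[OF z(1,2)]]] d by blast
  then show False using nonunit_power[OF _ diff_mem[OF z(1,2)]] z by blast
qed

end

section \<open>Polynomials with simple roots\<close>

lemma degree_prod_list_linear:
  "degree (\<Prod>x\<leftarrow>s. [:- x, 1:] :: 'a::idom poly) = length s"
proof -
  have "degree (\<Prod>x\<leftarrow>s. [:- x, 1:] :: 'a poly) = length s \<and> (\<Prod>x\<leftarrow>s. [:- x, 1:] :: 'a poly) \<noteq> 0"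
    by (induction s) (auto simp: degree_mult_eq simp del: mult_pCons_left)
  then show ?thesis by simp
qed

lemma distinct_roots_list:
  fixes p :: "complex poly"
  assumes "rsquarefree p"
  obtains s where "distinct s" "set s = {x. poly p x = 0}" "length s = degree p"
    "p = smult (lead_coeff p) (\<Prod>x\<leftarrow>s. [:- x, 1:])"
proof -
  have p0: "p \<noteq> 0" using assms by (auto simp: rsquarefree_def)
  then obtain s where s: "set s = {x. poly p x = 0}" "distinct s"
    using finite_distinct_list[OF poly_roots_finite] by blast
  have "p = smult (lead_coeff p) (\<Prod>x\<leftarrow>s. [:- x, 1:])"
    using complex_poly_decompose_rsquarefree[OF assms] s by (simp add: prod.distinct_set_conv_list[symmetric])
  moreover from this p0 have "length s = degree p"
    using degree_prod_list_linear[of s] by (metis degree_smult_eq leading_coeff_0_iff)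
  ultimately show ?thesis using that s by blast
qed

lemma poly_prod_list_roots:
  "poly (\<Prod>x\<leftarrow>s. [:- x, 1:]) (y::'a::comm_ring_1) = (\<Prod>b<length s. y - s ! b)"
proof -
  have "poly (\<Prod>x\<leftarrow>s. [:- x, 1:]) y = (\<Prod>x\<leftarrow>s. y - x)"
    by (induction s) (auto simp: algebra_simps)
  also have "\<dots> = (\<Prod>b<length s. y - s ! b)"
    by (simp add: prod.list_conv_set_nth atLeast0LessThan)
  finally show ?thesis .
qed

lemma prod_list_eq_prod_nth:
  "(\<Prod>x\<leftarrow>s. f x) = (\<Prod>b<length s. (f (s ! b) :: 'a::comm_monoid_mult))"
  by (simp add: prod.list_conv_set_nth atLeast0LessThan)

text \<open>
  If \<open>p = (X - t) g\<close>, then \<open>p' = g\<close> and \<open>p'' = 2 g'\<close> at \<open>t\<close>, and the logarithmic derivative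
  of \<open>g\<close> is the sum over the remaining roots.
\<close>

lemma second_derivative_at_simple_root:
  fixes s :: "complex list"
  assumes p: "p = smult k (\<Prod>x\<leftarrow>s. [:- x, 1:])" and s: "distinct s" and a: "a < length s"
  shows "poly (pderiv (pderiv p)) (s ! a)
    = poly (pderiv p) (s ! a) * (\<Sum>j\<in>{..<length s} - {a}. 2 / (s ! a - s ! j))"
proof -
  define t where "t = s ! a"
  define J where "J = {..<length s} - {a}"
  define g where "g = (\<Prod>j\<in>J. [:- (s ! j), 1:])"
  have fJ: "finite J" by (simp add: J_def)
  have ne: "t - s ! j \<noteq> 0" if "j \<in> J" for j
    using that s a by (auto simp: J_def t_def nth_eq_iff_index_eq)
  have pg: "p = smult k ([:- t, 1:] * g)"
    unfolding p prod_list_eq_prod_nth g_def J_def t_def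
    by (subst prod.remove[of _ a]) (use a in auto)
  have d1: "poly (pderiv p) t = k * poly g t"
    unfolding pg by (simp add: pderiv_smult pderiv_mult pderiv_pCons del: mult_pCons_left)
  have d2: "poly (pderiv (pderiv p)) t = k * (2 * poly (pderiv g) t)"
    unfolding pg by (simp add: pderiv_smult pderiv_mult pderiv_pCons pderiv_add del: mult_pCons_left)
  have "poly (pderiv g) t = (\<Sum>j\<in>J. \<Prod>i\<in>J - {j}. t - s ! i)"
    unfolding g_def pderiv_prod by (simp add: poly_sum poly_prod pderiv_pCons)
  also have "\<dots> = (\<Sum>j\<in>J. poly g t * (1 / (t - s ! j)))"
  proof (rule sum.cong)
    fix j assume j: "j \<in> J"
    have "poly g t = (t - s ! j) * (\<Prod>i\<in>J - {j}. t - s ! i)"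
      unfolding g_def poly_prod by (subst prod.remove[OF fJ j]) simp
    then show "(\<Prod>i\<in>J - {j}. t - s ! i) = poly g t * (1 / (t - s ! j))" using ne[OF j] by simp
  qed simp
  finally have "2 * poly (pderiv g) t = poly g t * (\<Sum>j\<in>J. 2 / (t - s ! j))"
    by (simp add: sum_distrib_left mult_ac)
  then show ?thesis using d1 d2 by (simp add: t_def J_def)
qed

section \<open>The Gaudin system\<close>

lemma poly_pderiv_linear_power:
  "(t - z) * poly (pderiv ([:- z, 1:] ^ m)) t = of_nat m * (poly ([:- z, 1:] ^ m) (t::complex))"
proof (cases m)
  case (Suc k)
  show ?thesis unfolding Suc pderiv_power_Suc
    by (simp only: poly_smult poly_mult poly_power poly_pCons poly_0 pderiv_pCons pderiv_0
        power_Suc) (simp add: mult_ac del: of_nat_Suc)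
qed simp

text \<open>
  At a root \<open>t\<close> of \<open>p\<close> the Wronskian equals \<open>- t p' q\<close>, which is nonzero, so \<open>t\<close> is simple;
  its derivative equals \<open>q ((\<mu> - 1) p' - t p'')\<close>. The quotient of these two values is the
  logarithmic derivative of the right-hand side, and expressing \<open>p'' / p'\<close> through the other
  roots turns this into the Gaudin equation at \<open>t\<close>.
\<close>

lemma wronskian_gives_gaudin_solution:
  fixes m :: "nat^2" and z :: "complex^2"
  assumes W: "quasi_wronskian \<mu> p q = smult c ([:- (z $ 1), 1:] ^ (m $ 1) * [:- (z $ 2), 1:] ^ (m $ 2))"
    and c: "c \<noteq> 0" and p0: "poly p 0 \<noteq> 0" and pz: "\<And>a. poly p (z $ a) \<noteq> 0"
  shows "\<exists>s. length s = degree p \<and> represents_orbit p s \<and> gaudin_admissible m z s \<and>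
    gaudin_solution (\<mu> - 1) m z s"
proof -
  define W0 where "W0 = [:- (z $ 1), 1:] ^ (m $ 1) * [:- (z $ 2), 1:] ^ (m $ 2)"
  have root: "t \<noteq> 0 \<and> t \<noteq> z $ 1 \<and> t \<noteq> z $ 2 \<and> poly W0 t \<noteq> 0 \<and>
      - t * poly (pderiv p) t * poly q t = c * poly W0 t \<and>
      poly q t * (poly (pderiv p) t * (\<mu> - 1) - t * poly (pderiv (pderiv p)) t) = c * poly (pderiv W0) t"
    if t: "poly p t = 0" for t
  proof (intro conjI)
    show "t \<noteq> 0" "t \<noteq> z $ 1" "t \<noteq> z $ 2" using t p0 pz by auto
    then show "poly W0 t \<noteq> 0" by (auto simp: W0_def)
    show "- t * poly (pderiv p) t * poly q t = c * poly W0 t"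
      using arg_cong[OF W, of "\<lambda>f. poly f t"] t unfolding quasi_wronskian_def W0_def by (simp add: mult_ac)
    show "poly q t * (poly (pderiv p) t * (\<mu> - 1) - t * poly (pderiv (pderiv p)) t) = c * poly (pderiv W0) t"
      using arg_cong[OF W, of "\<lambda>f. poly (pderiv f) t"] t
      by (simp add: quasi_wronskian_def W0_def[symmetric] pderiv_add pderiv_mult pderiv_smult
          pderiv_diff pderiv_pCons algebra_simps del: mult_pCons_left)
  qed
  have "rsquarefree p"
    unfolding rsquarefree_roots
  proof (intro allI notI, elim conjE)
    fix t assume "poly p t = 0" and d: "poly (pderiv p) t = 0"
    note r = root[OF this(1)]
    have "c * poly W0 t = - t * poly (pderiv p) t * poly q t" using r by (simp only:)
    also have "\<dots> = 0" using d by simp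
    finally have "c * poly W0 t = 0" .
    moreover have "poly W0 t \<noteq> 0" using r by (elim conjE)
    ultimately show False using c by simp
  qed
  then obtain s where s: "distinct s" "set s = {x. poly p x = 0}" "length s = degree p"
    "p = smult (lead_coeff p) (\<Prod>x\<leftarrow>s. [:- x, 1:])" by (rule distinct_roots_list)
  have "p \<noteq> 0" using p0 by auto
  then have "represents_orbit p s" unfolding represents_orbit_def
    by (intro exI[of _ "lead_coeff p"] conjI s(4)) simp
  moreover have "gaudin_admissible m z s"
    unfolding gaudin_admissible_def using s(1,2) p0 pz by auto
  moreover have "gaudin_solution (\<mu> - 1) m z s"
    unfolding gaudin_solution_def
  proof (intro allI impI)
    fix i assume i: "i < length s"
    define t where "t = s ! i"
    define \<Sigma> where "\<Sigma> = (\<Sum>j\<in>{..<length s} - {i}. 2 / (t - s ! j))"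
    have "t \<in> set s" using i by (simp add: t_def)
    then have "poly p t = 0" unfolding s(2) by simp
    note r = root[OF this]
    have dd: "poly (pderiv (pderiv p)) t = poly (pderiv p) t * \<Sigma>"
      using second_derivative_at_simple_root[OF s(4,1) i] by (simp add: t_def \<Sigma>_def)
    have t0: "t \<noteq> 0" using r by (elim conjE)
    have tz: "t - z $ 1 \<noteq> 0" "t - z $ 2 \<noteq> 0" using r by (elim conjE; simp only: eq_iff_diff_eq_0[symmetric] right_minus_eq not_False_eq_True)+
    define L where "L = of_nat (m $ 1) / (t - z $ 1) + of_nat (m $ 2) / (t - z $ 2)"
    have dW: "poly (pderiv W0) t = poly W0 t * L"
    proof -
      have "poly (pderiv ([:- (z $ a), 1:] ^ (m $ a))) t
          = poly ([:- (z $ a), 1:] ^ (m $ a)) t * (of_nat (m $ a) / (t - z $ a))" if "t - z $ a \<noteq> 0" for a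
        using poly_pderiv_linear_power[of t "z $ a" "m $ a"] that by (simp add: field_simps)
      from this[OF tz(1)] this[OF tz(2)] show ?thesis
        unfolding W0_def L_def pderiv_mult poly_add poly_mult
        by (simp only: distrib_left distrib_right mult_ac add_ac)
    qed
    have "poly (pderiv p) t * poly q t \<noteq> 0"
    proof
      assume *: "poly (pderiv p) t * poly q t = 0"
      have "c * poly W0 t = - t * poly (pderiv p) t * poly q t" using r by (simp only:)
      also have "\<dots> = 0" using * by auto
      finally have "c * poly W0 t = 0" .
      moreover have "poly W0 t \<noteq> 0" using r by (elim conjE)
      ultimately show False using c by simp
    qed
    moreover have "poly (pderiv p) t * poly q t * (\<mu> - 1 - t * \<Sigma>) = poly (pderiv p) t * poly q t * (- t * L)"
    proof -
      have "poly (pderiv p) t * poly q t * (\<mu> - 1 - t * \<Sigma>)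
          = poly q t * (poly (pderiv p) t * (\<mu> - 1) - t * poly (pderiv (pderiv p)) t)"
        by (simp add: dd algebra_simps)
      also have "\<dots> = (c * poly W0 t) * L" using r dW by (simp only: mult.assoc)
      also have "c * poly W0 t = - t * poly (pderiv p) t * poly q t" using r by (simp only:)
      finally show ?thesis by (simp add: algebra_simps)
    qed
    ultimately have "\<mu> - 1 - t * \<Sigma> = - t * L" using mult_left_cancel by blast
    then have "\<mu> - 1 = t * (\<Sigma> - L)" by (simp add: algebra_simps)
    then have "(\<mu> - 1) / t + L - \<Sigma> = 0" using t0 by simp
    then show "(\<mu> - 1) / s ! i + (\<Sum>a\<in>UNIV. of_nat (m $ a) / (s ! i - z $ a)) -
        (\<Sum>j\<in>{..<length s} - {i}. 2 / (s ! i - s ! j)) = 0"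
      by (simp add: sum_2 L_def \<Sigma>_def t_def)
  qed
  ultimately show ?thesis by (intro exI[of _ s] conjI s(3))
qed

section \<open>The discrete Wronskian\<close>

definition shift_poly :: "'a::field poly \<Rightarrow> 'a poly" where
  "shift_poly p = pcompose p [:1, 1:]"

lemma poly_shift_poly [simp]: "poly (shift_poly p) x = poly p (x + 1)"
  by (simp add: shift_poly_def poly_pcompose add.commute)

lemma poly_pderiv_shift_poly [simp]: "poly (pderiv (shift_poly p)) x = poly (pderiv p) (x + 1)"
  by (simp add: shift_poly_def pderiv_pcompose poly_pcompose pderiv_pCons add.commute)

lemma degree_shift_poly [simp]: "degree (shift_poly p) = degree p"
  by (simp add: shift_poly_def degree_pcompose)

lemma lead_coeff_shift_poly [simp]: "lead_coeff (shift_poly p) = lead_coeff p"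
  unfolding shift_poly_def by (subst lead_coeff_comp) auto

lemma shift_poly_smult: "shift_poly (smult c p) = smult c (shift_poly p)"
  by (simp add: shift_poly_def pcompose_smult)

text \<open>
  This is \<open>h1(u) h2(u + 1) - h1(u + 1) h2(u)\<close> for \<open>ha(u) = za\<^sup>u qa(u)\<close>, divided by
  \<open>z1\<^sup>u z2\<^sup>u\<close>.
\<close>

definition discrete_wronskian :: "'a::field \<Rightarrow> 'a \<Rightarrow> 'a poly \<Rightarrow> 'a poly \<Rightarrow> 'a poly" where
  "discrete_wronskian z1 z2 q1 q2 = smult z2 (q1 * shift_poly q2) - smult z1 (shift_poly q1 * q2)"

lemma coeff_discrete_wronskian:
  "coeff (discrete_wronskian z1 z2 q1 q2) (degree q1 + degree q2) = (z2 - z1) * (lead_coeff q1 * lead_coeff q2)"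
proof -
  have "coeff (q1 * shift_poly q2) (degree q1 + degree q2) = lead_coeff q1 * lead_coeff q2"
    using coeff_mult_degree_sum[of q1 "shift_poly q2"] by (metis degree_shift_poly lead_coeff_shift_poly)
  moreover have "coeff (shift_poly q1 * q2) (degree q1 + degree q2) = lead_coeff q1 * lead_coeff q2"
    using coeff_mult_degree_sum[of "shift_poly q1" q2] by (metis degree_shift_poly lead_coeff_shift_poly)
  ultimately show ?thesis by (simp add: discrete_wronskian_def algebra_simps)
qed

lemma degree_discrete_wronskian_le: "degree (discrete_wronskian z1 z2 q1 q2) \<le> degree q1 + degree q2"
  unfolding discrete_wronskian_def
  by (intro degree_diff_le order_trans[OF degree_smult_le] order_trans[OF degree_mult_le]) auto

text \<open>These points will be the zeros of the discrete Wronskian.\<close>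

definition chain_points :: "('i::finite \<Rightarrow> 'a::field) \<Rightarrow> ('i \<Rightarrow> nat) \<Rightarrow> 'a set" where
  "chain_points lam n = (\<lambda>(i, r). lam i + of_nat r) ` (SIGMA i:UNIV. {1..n i})"

lemma finite_chain_points: "finite (chain_points lam n)"
  by (simp add: chain_points_def)

lemma chain_points_iff: "a \<in> chain_points lam n \<longleftrightarrow> (\<exists>i r. 1 \<le> r \<and> r \<le> n i \<and> a = lam i + of_nat r)"
  by (force simp: chain_points_def)

definition chain_poly :: "('i::finite \<Rightarrow> 'a::field) \<Rightarrow> ('i \<Rightarrow> nat) \<Rightarrow> 'a poly" where
  "chain_poly lam n = (\<Prod>a\<in>chain_points lam n. [:- a, 1:])"

lemma poly_eq_smult_prod_roots:
  fixes p :: "'a::field poly"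
  assumes A: "finite A" and deg: "degree p \<le> card A" and zero: "\<And>a. a \<in> A \<Longrightarrow> poly p a = 0"
  shows "p = smult (coeff p (card A)) (\<Prod>a\<in>A. [:- a, 1:])"
proof (rule ccontr)
  define D where "D = (\<Prod>a\<in>A. [:- a, 1:])"
  define r where "r = p - smult (coeff p (card A)) D"
  assume "\<not> ?thesis"
  then have r0: "r \<noteq> 0" by (simp add: r_def D_def)
  have dD: "degree D = card A" by (simp add: D_def degree_prod_sum_eq)
  have lD: "coeff D (card A) = 1"
    using dD lead_coeff_prod[of "\<lambda>a. [:- a, 1:]" A] by (simp add: D_def)
  have "coeff r (card A) = 0" by (simp add: r_def lD)
  moreover have "degree r \<le> card A"
    unfolding r_def using deg dD by (intro degree_diff_le) (auto intro: order_trans[OF degree_smult_le])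
  ultimately have "degree r < card A" using r0 leading_coeff_neq_0[of r] by (cases "degree r = card A") auto
  moreover have "card A \<le> card {x. poly r x = 0}"
  proof (rule card_mono)
    show "finite {x. poly r x = 0}" using r0 poly_roots_finite by blast
    show "A \<subseteq> {x. poly r x = 0}"
      using zero A by (auto simp: r_def D_def poly_prod intro!: prod_zero)
  qed
  ultimately show False using card_poly_roots_bound[OF r0] by simp
qed

context valuation_ring
begin

text \<open>
  A valuation ring is integrally closed: dividing the equation by the leading power of a root
  outside of \<open>B\<close>, whose inverse is a nonunit, would make the leading coefficient a nonunit.
\<close>

lemma root_of_monic_mem:
  assumes p: "integral_poly p" "lead_coeff p \<notin> nonunits" and t: "poly p t = 0"
  shows "t \<in> B"
proof (rule ccontr)
  assume tB: "t \<notin> B"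
  then have t0: "t \<noteq> 0" using zero_mem by auto
  have s: "inverse t \<in> nonunits" using tB by (simp add: nonunits_def)
  have p0: "p \<noteq> 0" using p zero_nonunit by auto
  have ip: "integral_poly (reflect_poly p)"
    using p zero_mem by (auto simp: integral_poly_def coeff_reflect_poly)
  obtain a r where ar: "reflect_poly p = pCons a r" by (cases "reflect_poly p")
  have a: "a = lead_coeff p" using arg_cong[OF ar, of "\<lambda>f. coeff f 0"] by simp
  have ir: "integral_poly r" using ip unfolding integral_poly_def ar by (metis coeff_pCons_Suc)
  have "poly (reflect_poly p) (inverse t) = 0"
    using poly_reflect_poly_nz[of "inverse t" p] t0 t by simp
  then have "a = - (inverse t * poly r (inverse t))" by (simp add: ar eq_neg_iff_add_eq_0)
  moreover have "inverse t * poly r (inverse t) \<in> nonunits"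
    using mult_nonunit'[OF s integral_poly_mem[OF ir nonunit_mem[OF s]]] .
  ultimately show False using uminus_nonunit a p(2) by metis
qed

text \<open>
  When \<open>z1\<close> degenerates to \<open>0\<close>, the discrete Wronskian reduces to a multiple of the product of
  \<open>q1\<close> and the shifted \<open>q2\<close>. Its zeros are assumed to stay distinct, so every zero of the
  reduced product is among them and is simple. Simplicity is expressed by the derivative of the
  product being a unit, which avoids any factorisation over the residue field.
\<close>

lemma degenerate_zeros_simple:
  fixes A :: "'a set"
  assumes A: "finite A" "A \<subseteq> B" and sep: "\<forall>a\<in>A. \<forall>b\<in>A. a \<noteq> b \<longrightarrow> a - b \<notin> nonunits"
    and D: "discrete_wronskian z1 z2 q1 q2 = smult c (\<Prod>a\<in>A. [:- a, 1:])"
    and deg: "degree q1 + degree q2 = card A"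
    and q: "primitive_poly q1" "primitive_poly q2"
    and z: "z1 \<in> nonunits" "z2 \<in> B" "z2 \<notin> nonunits"
  shows "c \<in> B" "c \<notin> nonunits" "lead_coeff q2 \<notin> nonunits"
    and "x \<in> B \<Longrightarrow> poly q1 x * poly q2 (x + 1) \<in> nonunits \<Longrightarrow> \<exists>a\<in>A. x - a \<in> nonunits"
    and "x \<in> B \<Longrightarrow> poly q1 x * poly q2 (x + 1) \<in> nonunits \<Longrightarrow>
      poly (pderiv q1) x * poly q2 (x + 1) + poly q1 x * poly (pderiv q2) (x + 1) \<notin> nonunits"
proof -
  define C where "C = (\<Prod>a\<in>A. [:- a, 1:])"
  have dP: "degree C = card A" by (simp add: C_def degree_prod_sum_eq)
  have lP: "coeff C (card A) = 1"
    using dP lead_coeff_prod[of "\<lambda>a. [:- a, 1:]" A] by (simp add: C_def)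
  have int: "integral_poly q1" "integral_poly q2" using q by (auto simp: primitive_poly_def)
  have int_shift: "integral_poly (shift_poly p)" if "integral_poly p" for p
    unfolding shift_poly_def using that
    by (intro integral_poly_pcompose integral_poly_pCons integral_poly_0 one_mem)
  have int_lin: "integral_poly (\<Prod>a\<in>A'. [:- a, 1:])" if "A' \<subseteq> A" for A'
  proof -
    have "finite A'" using A that finite_subset by blast
    then show ?thesis using that
    proof (induction A')
      case (insert a A')
      then have "a \<in> B" using A by blast
      with insert show ?case
        by (simp del: mult_pCons_left)
           (intro integral_poly_mult integral_poly_pCons integral_poly_0 uminus_mem one_mem)
    qed (simp add: integral_poly_1)
  qed
  have prim_shift: "primitive_poly (shift_poly q2)"
  proof -
    have "\<not> small_poly (shift_poly q2)"
    proof
      assume s: "small_poly (shift_poly q2)"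
      have "q2 = pcompose (shift_poly q2) [:- 1, 1:]"
        by (simp add: shift_poly_def flip: pcompose_assoc) (simp add: pcompose_pCons)
      moreover have "small_poly (pcompose f g)" if "small_poly f" "integral_poly g" for f g
        using that(1)
      proof (induction f)
        case (pCons a f)
        have f: "small_poly f" and a: "a \<in> nonunits"
          using pCons.prems unfolding small_poly_def by (metis coeff_pCons_Suc, metis coeff_pCons_0)
        have "small_poly (g * pcompose f g)"
          using pCons.IH[OF f] that(2)
          by (auto simp: small_poly_def integral_poly_def coeff_mult intro!: sum_nonunit mult_nonunit)
        moreover have "small_poly [:a:]"
          using a zero_nonunit by (auto simp: small_poly_def coeff_pCons split: nat.split)
        ultimately show ?case by (simp add: pcompose_pCons small_poly_add)
      qed (simp add: small_poly_def zero_nonunit)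
      ultimately have "small_poly q2"
        using s by (metis integral_poly_0 integral_poly_pCons one_mem uminus_mem)
      with q show False by (simp add: primitive_poly_def)
    qed
    then show ?thesis using int_shift[OF int(2)] by (simp add: primitive_poly_def)
  qed
  have eq: "smult z2 (q1 * shift_poly q2) - smult z1 (shift_poly q1 * q2) = smult c C"
    using D by (simp add: discrete_wronskian_def C_def)
  have small: "small_poly (smult z1 (shift_poly q1 * q2))"
    by (intro small_poly_smult z integral_poly_mult int_shift int)
  have coeff_c: "c = (z2 - z1) * (lead_coeff q1 * lead_coeff q2)"
  proof -
    have "coeff (discrete_wronskian z1 z2 q1 q2) (card A) = c"
      unfolding D using lP by (simp add: C_def)
    then show ?thesis using coeff_discrete_wronskian[of z1 z2 q1 q2] deg by simp
  qed
  have lB: "lead_coeff q1 \<in> B" "lead_coeff q2 \<in> B" using int by (auto simp: integral_poly_def)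
  show cB: "c \<in> B"
    unfolding coeff_c using z nonunit_mem lB by (intro mult_mem diff_mem) auto
  show c: "c \<notin> nonunits"
  proof
    assume "c \<in> nonunits"
    then have "small_poly (smult c C)" using small_poly_smult int_lin[OF order_refl] by (simp add: C_def)
    from small_poly_add[OF this small] have "small_poly (smult z2 (q1 * shift_poly q2))"
      by (simp flip: eq)
    moreover have "inverse z2 \<in> B" "z2 \<noteq> 0" using z by (auto simp: nonunits_def)
    ultimately have "small_poly (smult (inverse z2) (smult z2 (q1 * shift_poly q2)))"
      unfolding small_poly_def by (metis coeff_smult mult_nonunit)
    then have "small_poly (q1 * shift_poly q2)" using \<open>z2 \<noteq> 0\<close> by simp
    with primitive_poly_mult[OF q(1) prim_shift] show False by (simp add: primitive_poly_def)
  qed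
  show "lead_coeff q2 \<notin> nonunits"
  proof
    assume "lead_coeff q2 \<in> nonunits"
    then have "c \<in> nonunits"
      unfolding coeff_c using z nonunit_mem lB by (intro mult_nonunit diff_mem) auto
    with c show False by simp
  qed
  assume x: "x \<in> B" and nu: "poly q1 x * poly q2 (x + 1) \<in> nonunits"
  have x1: "x + 1 \<in> B" using x one_mem add_mem by blast
  have "z2 * (poly q1 x * poly q2 (x + 1)) - z1 * (poly q1 (x + 1) * poly q2 x) = c * poly C x"
    using arg_cong[OF eq, of "\<lambda>f. poly f x"] by simp
  moreover have "z2 * (poly q1 x * poly q2 (x + 1)) - z1 * (poly q1 (x + 1) * poly q2 x) \<in> nonunits"
    by (intro diff_nonunit mult_nonunit[OF z(2) nu] mult_nonunit'[OF z(1)] mult_mem integral_poly_mem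
        int x x1)
  ultimately have "c * poly C x \<in> nonunits" by simp
  then have "poly C x \<in> nonunits"
    using nonunit_prime[OF _ cB integral_poly_mem[OF int_lin[OF order_refl] x]] c by (auto simp: C_def)
  then have "(\<Prod>a\<in>A. x - a) \<in> nonunits" by (simp add: C_def poly_prod)
  then show ex: "\<exists>a\<in>A. x - a \<in> nonunits"
    using nonunit_prod x A by (metis diff_mem subsetD)
  then obtain a where a: "a \<in> A" "x - a \<in> nonunits" by blast
  define E where "E = (\<Prod>b\<in>A - {a}. [:- b, 1:])"
  have PE: "C = [:- a, 1:] * E"
    unfolding C_def E_def by (subst prod.remove[OF A(1) a(1)]) simp
  have intE: "integral_poly E" unfolding E_def by (rule int_lin) auto
  have "poly (pderiv C) x = poly E x + (x - a) * poly (pderiv E) x"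
    unfolding PE by (simp add: pderiv_mult pderiv_pCons del: mult_pCons_left)
  moreover have "poly E x \<notin> nonunits"
  proof
    assume "poly E x \<in> nonunits"
    then have "(\<Prod>b\<in>A - {a}. x - b) \<in> nonunits" by (simp add: E_def poly_prod)
    then obtain b where b: "b \<in> A - {a}" "x - b \<in> nonunits"
      using nonunit_prod[of "\<lambda>b. x - b" "A - {a}"] x A by (metis DiffD1 diff_mem subsetD)
    then have "(x - b) - (x - a) \<in> nonunits" using a diff_nonunit by blast
    with sep a b show False by auto
  qed
  moreover have "(x - a) * poly (pderiv E) x \<in> nonunits"
    using a x intE by (intro mult_nonunit' integral_poly_mem integral_poly_pderiv)
  ultimately have dP: "poly (pderiv C) x \<notin> nonunits" using unit_add_nonunit by simp
  define S where "S = poly (pderiv q1) x * poly q2 (x + 1) + poly q1 x * poly (pderiv q2) (x + 1)"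
  define T where "T = poly (pderiv q1) (x + 1) * poly q2 x + poly q1 (x + 1) * poly (pderiv q2) x"
  have TB: "T \<in> B" unfolding T_def using x x1 int
    by (intro add_mem mult_mem integral_poly_mem integral_poly_pderiv one_mem)
  have "z2 * S - z1 * T = c * poly (pderiv C) x"
    using arg_cong[OF eq, of "\<lambda>f. poly (pderiv f) x"]
    by (simp add: pderiv_diff pderiv_smult pderiv_mult S_def T_def algebra_simps)
  moreover have "c * poly (pderiv C) x \<notin> nonunits"
    using nonunit_prime[OF _ cB integral_poly_mem[OF integral_poly_pderiv[OF int_lin[OF order_refl]] x]]
      c dP by (auto simp: C_def)
  moreover have "z2 * S - z1 * T \<in> nonunits" if "S \<in> nonunits"
    using diff_nonunit[OF mult_nonunit[OF z(2) that] mult_nonunit'[OF z(1) TB]] .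
  ultimately show "S \<notin> nonunits" by auto
qed

text \<open>
  A double root of \<open>q2\<close> would give a double zero of the reduced product.
  Along the points \<open>lam i + 1, lam i + 2, \<dots>\<close> the quotient of \<open>q2\<close> and \<open>q1\<close> is a multiple of
  powers of \<open>z1 / z2\<close>. At a common zero \<open>v\<close>, simplicity would make \<open>q2\<close> a unit at \<open>v + 1\<close>
  and \<open>q1\<close> a unit at \<open>v - 1\<close>, although the quotient at \<open>v + 1\<close> is infinitesimal in comparison
  with the one at \<open>v - 1\<close>.
\<close>

lemma degenerate_nonvanishing:
  fixes lam :: "'i::finite \<Rightarrow> 'a" and n :: "'i \<Rightarrow> nat"
  assumes lam: "\<And>i. lam i \<in> B"
    and sep: "\<And>i k r s. lam i + of_nat r - (lam k + of_nat s) \<in> nonunits \<Longrightarrow>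
      lam i + of_nat r = lam k + of_nat s \<and> i = k \<and> r = s"
    and D: "discrete_wronskian z1 z2 q1 q2 = smult c (chain_poly lam n)"
    and deg: "degree q1 + degree q2 = card (chain_points lam n)"
    and q0: "q1 \<noteq> 0" "q2 \<noteq> 0"
    and z: "z1 \<in> nonunits" "z2 \<in> B" "z2 \<notin> nonunits"
    and chain: "\<And>i j. j \<le> n i \<Longrightarrow>
      poly q2 (lam i + 1 + of_nat j) = \<rho> i * (z1 / z2) ^ j * poly q1 (lam i + 1 + of_nat j)"
  shows "\<not> (poly q2 t = 0 \<and> poly (pderiv q2) t = 0)"
    and "j \<le> n i \<Longrightarrow> poly q1 (lam i + 1 + of_nat j) \<noteq> 0 \<or> poly q2 (lam i + 1 + of_nat j) \<noteq> 0"
proof -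
  obtain a where a: "a \<noteq> 0" "primitive_poly (smult a q1)" using q0(1) by (rule primitive_poly_scaling)
  obtain b where b: "b \<noteq> 0" "primitive_poly (smult b q2)" using q0(2) by (rule primitive_poly_scaling)
  define Q1 Q2 where "Q1 = smult a q1" and "Q2 = smult b q2"
  define A where "A = chain_points lam n"
  have A: "finite A" "A \<subseteq> B"
    using lam by (auto simp: A_def finite_chain_points chain_points_iff intro!: add_mem of_nat_mem)
  have sepA: "\<forall>x\<in>A. \<forall>y\<in>A. x \<noteq> y \<longrightarrow> x - y \<notin> nonunits"
  proof (intro ballI impI notI)
    fix x y assume "x \<in> A" "y \<in> A" and ne: "x \<noteq> y" and nu: "x - y \<in> nonunits"
    then obtain i r k s where "x = lam i + of_nat r" "y = lam k + of_nat s"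
      unfolding A_def chain_points_iff by blast
    with sep[of i r k s] ne nu show False by simp
  qed
  have DQ: "discrete_wronskian z1 z2 Q1 Q2 = smult (a * b * c) (\<Prod>a\<in>A. [:- a, 1:])"
  proof -
    have "discrete_wronskian z1 z2 Q1 Q2 = smult (a * b) (discrete_wronskian z1 z2 q1 q2)"
      by (simp add: discrete_wronskian_def Q1_def Q2_def shift_poly_smult smult_diff_right mult_ac)
    then show ?thesis by (simp add: D chain_poly_def A_def)
  qed
  have degQ: "degree Q1 + degree Q2 = card A" using deg a b by (simp add: Q1_def Q2_def A_def)
  note base = degenerate_zeros_simple[OF A sepA DQ degQ a(2)[folded Q1_def] b(2)[folded Q2_def] z]
  have int: "integral_poly Q1" "integral_poly Q2" using a b by (auto simp: Q1_def Q2_def primitive_poly_def)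
  show "\<not> (poly q2 t = 0 \<and> poly (pderiv q2) t = 0)"
  proof
    assume "poly q2 t = 0 \<and> poly (pderiv q2) t = 0"
    then have t: "poly Q2 t = 0" "poly (pderiv Q2) t = 0" by (auto simp: Q2_def pderiv_smult)
    have "t - 1 \<in> B" using root_of_monic_mem[OF int(2) base(3) t(1)] one_mem diff_mem by blast
    from base(5)[OF this] t zero_nonunit show False by simp
  qed
  show "poly q1 (lam i + 1 + of_nat j) \<noteq> 0 \<or> poly q2 (lam i + 1 + of_nat j) \<noteq> 0" if j: "j \<le> n i"
  proof (rule ccontr)
    define v where "v = lam i + 1 + of_nat j"
    have vj: "v = lam i + of_nat (Suc j)" by (simp add: v_def)
    assume "\<not> ?thesis"
    then have v: "poly Q1 v = 0" "poly Q2 v = 0" by (auto simp: Q1_def Q2_def v_def)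
    have vB: "v \<in> B" unfolding v_def by (intro add_mem lam one_mem of_nat_mem)
    have vB1: "v - 1 \<in> B" "v + 1 \<in> B" using vB one_mem diff_mem add_mem by blast+
    obtain x where x: "x \<in> A" "v - x \<in> nonunits" using base(4)[OF vB] v zero_nonunit by auto
    have jn: "Suc j \<le> n i"
      using x sep[of i "Suc j"] unfolding A_def chain_points_iff vj by metis
    obtain y where y: "y \<in> A" "v - 1 - y \<in> nonunits" using base(4)[OF vB1(1)] v zero_nonunit by auto
    have "v - 1 = lam i + of_nat j" by (simp add: v_def)
    then have j1: "1 \<le> j"
      using y sep[of i j] unfolding A_def chain_points_iff by metis
    have up: "poly (pderiv Q1) v * poly Q2 (v + 1) \<notin> nonunits"
      using base(5)[OF vB] v zero_nonunit by simp
    have u2: "poly Q2 (v + 1) \<notin> nonunits"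
      using up mult_nonunit[OF integral_poly_mem[OF integral_poly_pderiv[OF int(1)] vB]] by blast
    have down: "poly Q1 (v - 1) * poly (pderiv Q2) v \<notin> nonunits"
      using base(5)[OF vB1(1)] v zero_nonunit by simp
    have u1: "poly Q1 (v - 1) \<notin> nonunits"
      using down mult_nonunit'[OF _ integral_poly_mem[OF integral_poly_pderiv[OF int(2)] vB]] by blast
    define g where "g = b / a * \<rho> i * (z1 / z2) ^ (j - 1)"
    have z2: "z2 \<noteq> 0" using z zero_nonunit by auto
    have c1: "poly Q2 (v - 1) = g * poly Q1 (v - 1)"
    proof -
      have e: "v - 1 = lam i + 1 + of_nat (j - 1)" using j1 by (simp add: v_def of_nat_diff)
      have j': "j - 1 \<le> n i" using j by simp
      show ?thesis unfolding Q1_def Q2_def poly_smult e chain[OF j'] using a b by (simp add: g_def)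
    qed
    have c2: "poly Q2 (v + 1) = g * (z1 / z2) ^ 2 * poly Q1 (v + 1)"
    proof -
      have e: "v + 1 = lam i + 1 + of_nat (Suc j)" by (simp add: v_def)
      have p: "(z1 / z2) ^ Suc j = (z1 / z2) ^ (j - 1) * (z1 / z2) ^ 2"
        using j1 by (simp add: power_add[symmetric] del: power_Suc)
      show ?thesis unfolding Q1_def Q2_def poly_smult e chain[OF jn] p using a b by (simp add: g_def)
    qed
    have u0: "poly Q1 (v - 1) \<noteq> 0" using u1 zero_nonunit by auto
    have "g = poly Q2 (v - 1) / poly Q1 (v - 1)" using c1 u0 by simp
    also have "\<dots> \<in> B" using divide_unit_mem[OF integral_poly_mem[OF int(2) vB1(1)] u1] .
    finally have gB: "g \<in> B" .
    have "inverse z2 \<in> B" using z by (simp add: nonunits_def)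
    then have "z1 / z2 \<in> nonunits" using mult_nonunit'[OF z(1)] by (simp add: divide_inverse)
    then have "(z1 / z2) ^ 2 \<in> nonunits"
      unfolding power2_eq_square using mult_nonunit' nonunit_mem by blast
    then have "poly Q2 (v + 1) \<in> nonunits"
      unfolding c2 using gB integral_poly_mem[OF int(1) vB1(2)] mult_nonunit mult_nonunit' by blast
    with u2 show False by blast
  qed
qed

end

section \<open>The XXX system\<close>

text \<open>
  If \<open>q2 / q1\<close> is multiplied by \<open>z1 / z2\<close> in the step from \<open>a\<close> to \<open>a + 1\<close>, the discrete Wronskian
  vanishes at \<open>a\<close>. This gives as many zeros as the degree allows.
\<close>

lemma discrete_wronskian_from_chains:
  fixes lam :: "'i::finite \<Rightarrow> 'a::field"
  assumes z: "z1 \<noteq> 0" "z2 \<noteq> 0"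
    and deg: "degree q1 + degree q2 = card (chain_points lam n)"
    and chain: "\<And>i j. j \<le> n i \<Longrightarrow>
      poly q2 (lam i + 1 + of_nat j) = \<rho> i * (z1 / z2) ^ j * poly q1 (lam i + 1 + of_nat j)"
  shows "discrete_wronskian z1 z2 q1 q2
    = smult ((z2 - z1) * (lead_coeff q1 * lead_coeff q2)) (chain_poly lam n)"
proof -
  have "discrete_wronskian z1 z2 q1 q2
      = smult (coeff (discrete_wronskian z1 z2 q1 q2) (card (chain_points lam n))) (chain_poly lam n)"
    unfolding chain_poly_def
  proof (rule poly_eq_smult_prod_roots[OF finite_chain_points])
    show "degree (discrete_wronskian z1 z2 q1 q2) \<le> card (chain_points lam n)"
      using degree_discrete_wronskian_le deg by metis
    fix a assume "a \<in> chain_points lam n"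
    then obtain i r where r: "1 \<le> r" "r \<le> n i" "a = lam i + of_nat r" by (auto simp: chain_points_iff)
    then obtain j where j: "r = Suc j" by (cases r) auto
    have a: "a = lam i + 1 + of_nat j" "a + 1 = lam i + 1 + of_nat (Suc j)" by (simp_all add: r j)
    have "j \<le> n i" "Suc j \<le> n i" using r j by auto
    note c = chain[OF this(1), folded a(1)] chain[OF this(2), folded a(2)]
    show "poly (discrete_wronskian z1 z2 q1 q2) a = 0"
      by (simp add: discrete_wronskian_def c z)
  qed
  then show ?thesis using coeff_discrete_wronskian[of z1 z2 q1 q2] deg by simp
qed

lemma telescope_chain:
  fixes x l :: "'a::comm_ring_1"
  shows "(x - l - 1) * (\<Prod>r\<in>{1..k}. x - 1 - (l + of_nat r))
    = (\<Prod>r\<in>{1..k}. x - (l + of_nat r)) * (x - l - 1 - of_nat k)"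
proof (induction k)
  case (Suc k)
  define f g where "f = (\<Prod>r\<in>{1..k}. x - (l + of_nat r))" and "g = (\<Prod>r\<in>{1..k}. x - 1 - (l + of_nat r))"
  have "(x - l - 1) * (g * (x - 1 - (l + of_nat (Suc k)))) = (f * (x - l - 1 - of_nat k)) * (x - 1 - (l + of_nat (Suc k)))"
    using Suc by (simp add: f_def g_def mult.assoc[symmetric])
  also have "\<dots> = f * (x - (l + of_nat (Suc k))) * (x - l - 1 - of_nat (Suc k))"
    by (simp add: algebra_simps)
  finally show ?case by (simp add: f_def g_def)
qed simp

lemma poly_chain_poly:
  fixes lam :: "'i::finite \<Rightarrow> 'a::field"
  assumes inj: "inj_on (\<lambda>(i, r). lam i + of_nat r) (SIGMA i:UNIV. {1..n i})"
  shows "poly (chain_poly lam n) x = (\<Prod>i\<in>UNIV. \<Prod>r\<in>{1..n i}. x - (lam i + of_nat r))"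
proof -
  have "poly (chain_poly lam n) x = (\<Prod>a\<in>chain_points lam n. x - a)"
    by (simp add: chain_poly_def poly_prod)
  also have "\<dots> = (\<Prod>(i, r)\<in>(SIGMA i:UNIV. {1..n i}). x - (lam i + of_nat r))"
    unfolding chain_points_def by (subst prod.reindex[OF inj]) (simp add: case_prod_unfold)
  also have "\<dots> = (\<Prod>i\<in>UNIV. \<Prod>r\<in>{1..n i}. x - (lam i + of_nat r))"
    by (subst prod.Sigma) auto
  finally show ?thesis .
qed

lemma chain_poly_ratio:
  fixes lam :: "'i::finite \<Rightarrow> 'a::field"
  assumes inj: "inj_on (\<lambda>(i, r). lam i + of_nat r) (SIGMA i:UNIV. {1..n i})"
  shows "(\<Prod>i\<in>UNIV. x - lam i - 1) * poly (chain_poly lam n) (x - 1)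
    = poly (chain_poly lam n) x * (\<Prod>i\<in>UNIV. x - lam i - 1 - of_nat (n i))"
  unfolding poly_chain_poly[OF inj] prod.distrib[symmetric] telescope_chain ..

text \<open>
  At a root \<open>t\<close> of \<open>q2\<close> one term of the discrete Wronskian drops out, and at \<open>t - 1\<close> the other
  one does; the quotient of the two values contains \<open>q2(t - 1) / q2(t + 1)\<close> but not \<open>q1\<close>. On the
  other side, the quotient of the products over the chains telescopes to the first factor of
  the XXX equation. No root of \<open>q2\<close> lies on a chain, because \<open>q1\<close> would vanish there as well;
  and two roots differing by \<open>1\<close> would make the discrete Wronskian vanish at one of them.
\<close>

lemma chains_give_xxx_solution:
  fixes lam :: "complex^2" and n :: "nat^2"
  assumes z: "z1 \<noteq> 0" "z2 \<noteq> 0"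
    and inj: "inj_on (\<lambda>(i, r). lam $ i + of_nat r) (SIGMA i:UNIV. {1..n $ i})"
    and c: "c \<noteq> 0"
    and D: "discrete_wronskian z1 z2 q1 q2 = smult c (chain_poly (($) lam) (($) n))"
    and chain: "\<And>i j. j \<le> n $ i \<Longrightarrow>
      poly q2 (lam $ i + 1 + of_nat j) = \<rho> i * (z1 / z2) ^ j * poly q1 (lam $ i + 1 + of_nat j)"
    and \<rho>: "\<And>i. \<rho> i \<noteq> 0"
    and common: "\<And>i j. j \<le> n $ i \<Longrightarrow>
      poly q1 (lam $ i + 1 + of_nat j) \<noteq> 0 \<or> poly q2 (lam $ i + 1 + of_nat j) \<noteq> 0"
    and sf: "rsquarefree q2"
  shows "\<exists>s. length s = degree q2 \<and> represents_orbit q2 s \<and> xxx_admissible n (lam + 1) s \<and>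
    xxx_solution n (lam + 1) (z2 / z1) s"
proof -
  define C where "C = chain_poly (($) lam) (($) n)"
  have C_zero: "poly C x = 0 \<longleftrightarrow> x \<in> chain_points (($) lam) (($) n)" for x
    using finite_chain_points[of "($) lam" "($) n"]
    by (auto simp: C_def chain_poly_def poly_prod prod_zero_iff)
  have chain_zero: "poly q2 (lam $ i + 1 + of_nat j) \<noteq> 0" if j: "j \<le> n $ i" for i j
  proof
    assume 0: "poly q2 (lam $ i + 1 + of_nat j) = 0"
    then have "poly q1 (lam $ i + 1 + of_nat j) = 0" using chain[OF j] \<rho>[of i] z by auto
    with 0 common[OF j] show False by simp
  qed
  have not_chain: "x \<noteq> lam $ i + 1 + of_nat j" if "poly q2 x = 0" "j \<le> n $ i" for x i j
    using chain_zero that by auto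
  have C_nz: "poly C x \<noteq> 0" if x: "poly q2 x = 0" for x
  proof
    assume "poly C x = 0"
    then obtain i r where r: "1 \<le> r" "r \<le> n $ i" "x = lam $ i + of_nat r"
      by (auto simp: C_zero chain_points_iff)
    then have "x = lam $ i + 1 + of_nat (r - 1)" by (simp add: of_nat_diff)
    moreover have "r - 1 \<le> n $ i" using r by linarith
    ultimately show False using not_chain[OF x] by blast
  qed
  have C_nz': "poly C (x - 1) \<noteq> 0" if x: "poly q2 x = 0" for x
  proof
    assume "poly C (x - 1) = 0"
    then obtain i r where r: "r \<le> n $ i" "x - 1 = lam $ i + of_nat r"
      by (auto simp: C_zero chain_points_iff)
    then have "x = lam $ i + 1 + of_nat r" by (simp add: algebra_simps)
    with not_chain[OF x r(1)] show False by simp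
  qed
  have Dx: "z2 * (poly q1 x * poly q2 (x + 1)) - z1 * (poly q1 (x + 1) * poly q2 x) = c * poly C x" for x
    using arg_cong[OF D, of "\<lambda>f. poly f x"] by (simp add: discrete_wronskian_def C_def)
  obtain s where s: "distinct s" "set s = {x. poly q2 x = 0}" "length s = degree q2"
    "q2 = smult (lead_coeff q2) (\<Prod>x\<leftarrow>s. [:- x, 1:])" using sf by (rule distinct_roots_list)
  define k where "k = lead_coeff q2"
  have k0: "k \<noteq> 0" using sf by (auto simp: k_def rsquarefree_def)
  have q2_eq: "poly q2 y = k * (\<Prod>b<length s. y - s ! b)" for y
    using arg_cong[OF s(4), of "\<lambda>f. poly f y"] by (simp only: poly_smult poly_prod_list_roots k_def)
  have root: "poly q2 (s ! a) = 0" if "a < length s" for a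
    using nth_mem[OF that] unfolding s(2) by simp
  have "represents_orbit q2 s" unfolding represents_orbit_def
    by (intro exI[of _ "lead_coeff q2"] conjI s(4)) (use k0 in \<open>simp add: k_def\<close>)
  moreover have adm: "xxx_admissible n (lam + 1) s"
    unfolding xxx_admissible_def
  proof (intro conjI allI impI)
    fix a b assume ab: "a < length s" "b < length s" "a \<noteq> b"
    then show "s ! a \<noteq> s ! b" using s(1) by (simp add: nth_eq_iff_index_eq)
    show "s ! a \<noteq> s ! b + 1"
    proof
      assume e: "s ! a = s ! b + 1"
      have "c * poly C (s ! b) = 0" using Dx[of "s ! b"] root[OF ab(1)] root[OF ab(2)] by (simp add: e)
      with c C_nz[OF root[OF ab(2)]] show False by simp
    qed
  next
    fix a i r assume "a < length s" "r \<le> n $ i"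
    then show "s ! a \<noteq> (lam + 1) $ i + of_nat r" using not_chain[OF root] by simp
  qed
  moreover have "xxx_solution n (lam + 1) (z2 / z1) s"
    unfolding xxx_solution_def
  proof (intro allI impI)
    fix a assume a: "a < length s"
    define t where "t = s ! a"
    define J where "J = {..<length s} - {a}"
    have t: "poly q2 t = 0" using root[OF a] by (simp add: t_def)
    define u v where "u = (\<Prod>b\<in>J. t - s ! b - 1)" and "v = (\<Prod>b\<in>J. t - s ! b + 1)"
    have qm: "poly q2 (t - 1) = - (k * u)"
      unfolding q2_eq u_def J_def by (subst prod.remove[of _ a]) (use a in \<open>auto simp: t_def algebra_simps\<close>)
    have qp: "poly q2 (t + 1) = k * v"
      unfolding q2_eq v_def J_def by (subst prod.remove[of _ a]) (use a in \<open>auto simp: t_def algebra_simps\<close>)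
    have D1: "z2 * (poly q1 t * (k * v)) = c * poly C t"
      using Dx[of t] t by (simp add: qp)
    have D2: "z1 * (poly q1 t * (k * u)) = c * poly C (t - 1)"
      using Dx[of "t - 1"] t by (simp add: qm)
    have v0: "v \<noteq> 0" and q10: "poly q1 t \<noteq> 0" using D1 c C_nz[OF t] by auto
    have "(\<Prod>i\<in>UNIV. t - lam $ i - 1) * poly C (t - 1)
        = poly C t * (\<Prod>i\<in>UNIV. t - lam $ i - 1 - of_nat (n $ i))"
      using chain_poly_ratio[OF inj] by (simp add: C_def)
    moreover define T S where "T = (\<Prod>i\<in>UNIV. t - lam $ i - 1)"
      and "S = (\<Prod>i\<in>UNIV. t - lam $ i - 1 - of_nat (n $ i))"
    ultimately have TS: "T * poly C (t - 1) = poly C t * S" by simp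
    have S0: "S \<noteq> 0"
    proof
      assume "S = 0"
      then obtain i where "t - lam $ i - 1 - of_nat (n $ i) = 0" by (auto simp: S_def)
      then have "t = lam $ i + 1 + of_nat (n $ i)" by (simp add: algebra_simps)
      with not_chain[OF t order_refl] show False by blast
    qed
    have "(poly q1 t * k) * (T * u * z1) = T * (z1 * (poly q1 t * (k * u)))" by (simp add: mult_ac)
    also have "\<dots> = c * (T * poly C (t - 1))" unfolding D2 by (simp add: mult_ac)
    also have "\<dots> = S * (c * poly C t)" unfolding TS by (simp add: mult_ac)
    also have "\<dots> = (poly q1 t * k) * (S * v * z2)" unfolding D1[symmetric] by (simp add: mult_ac)
    finally have "T * u * z1 = S * v * z2" using q10 k0 by simp
    then have "T / S * (u / v) = z2 / z1" using S0 v0 z by (simp add: field_simps)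
    moreover have "(\<Prod>i\<in>UNIV. (t - (lam + 1) $ i) / (t - (lam + 1) $ i - of_nat (n $ i))) = T / S"
      by (simp add: T_def S_def prod_dividef diff_diff_eq)
    moreover have "(\<Prod>b\<in>J. (t - s ! b - 1) / (t - s ! b + 1)) = u / v"
      by (simp add: u_def v_def prod_dividef)
    ultimately show "(\<Prod>i\<in>UNIV. (s ! a - (lam + 1) $ i) / (s ! a - (lam + 1) $ i - of_nat (n $ i))) *
         (\<Prod>b\<in>{..<length s} - {a}. (s ! a - s ! b - 1) / (s ! a - s ! b + 1)) = z2 / z1"
      by (simp add: t_def J_def)
  qed
  ultimately show ?thesis by (intro exI[of _ s] conjI s(3))
qed

section \<open>Exponents and the Wronskian\<close>

lemma quasi_poly_has_field_derivative:
  "(quasi_poly \<alpha> p has_field_derivative exp (\<alpha> * s) * (\<alpha> * poly p (exp s) + exp s * poly (pderiv p) (exp s))) (at s)"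
  unfolding quasi_poly_def
  by (auto intro!: derivative_eq_intros DERIV_chain2[OF poly_DERIV] simp: algebra_simps)

lemma holomorphic_quasi_poly: "quasi_poly \<alpha> p holomorphic_on A"
  using quasi_poly_has_field_derivative holomorphic_on_def field_differentiable_def
    has_field_derivative_at_within by meson

lemma wronskian_quasi_poly:
  "wronskian (quasi_poly a p) (quasi_poly b q) = quasi_poly (a + b - 1) (quasi_wronskian (b - a) p q)"
proof
  fix s :: complex
  have d: "deriv (quasi_poly \<alpha> r) s = exp (\<alpha> * s) * (\<alpha> * poly r (exp s) + exp s * poly (pderiv r) (exp s))" for \<alpha> r
    by (rule DERIV_imp_deriv[OF quasi_poly_has_field_derivative])
  have e: "exp (a * s) * exp (b * s) / exp s = exp ((a + b - 1) * s)"
    by (simp add: exp_add[symmetric] exp_diff[symmetric] algebra_simps)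
  define P P' Q Q' where "P = poly p (exp s)" and "P' = poly (pderiv p) (exp s)"
    and "Q = poly q (exp s)" and "Q' = poly (pderiv q) (exp s)"
  define A B x where "A = exp (a * s)" and "B = exp (b * s)" and "x = exp s"
  have "A * P * (B * (b * Q + x * Q') / x) - A * (a * P + x * P') / x * (B * Q)
      = A * B / x * (x * (P * Q' - P' * Q) + (b - a) * (P * Q))"
    by (simp add: divide_inverse algebra_simps)
  then show "wronskian (quasi_poly a p) (quasi_poly b q) s = quasi_poly (a + b - 1) (quasi_wronskian (b - a) p q) s"
    unfolding wronskian_def dx_def d
    by (simp add: quasi_poly_def quasi_wronskian_def e[symmetric] P_def P'_def Q_def Q'_def A_def B_def x_def)
qed

lemma exp_difference_quotient: "((\<lambda>\<sigma>. (exp \<sigma> - exp s) / (\<sigma> - s)) \<longlongrightarrow> exp s) (at (s::complex))"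
  using DERIV_exp[of s] by (simp add: has_field_derivative_iff)

text \<open>
  Since \<open>exp\<close> is locally biholomorphic, vanishing of order \<open>k\<close> at \<open>s\<close> is divisibility by
  \<open>(X - exp s)\<^sup>k\<close>.
\<close>

lemma linear_power_dvd_if_vanishes:
  assumes "\<forall>\<^sub>F \<sigma> in at s. quasi_poly \<alpha> P \<sigma> = (\<sigma> - s) ^ k * h \<sigma>" and "(h \<longlongrightarrow> L) (at s)"
  shows "[:- exp s, 1:] ^ k dvd P"
  using assms
proof (induction k arbitrary: P h L)
  case (Suc k)
  have "(quasi_poly \<alpha> P \<longlongrightarrow> quasi_poly \<alpha> P s) (at s)"
    using DERIV_isCont[OF quasi_poly_has_field_derivative] isCont_def by blast
  moreover have "(quasi_poly \<alpha> P \<longlongrightarrow> 0) (at s)"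
  proof (rule Lim_transform_eventually)
    have "((\<lambda>\<sigma>. (\<sigma> - s) ^ Suc k) \<longlongrightarrow> 0) (at s)"
      by (rule tendsto_eq_intros refl | simp)+
    from tendsto_mult[OF this Suc.prems(2)]
    show "((\<lambda>\<sigma>. (\<sigma> - s) ^ Suc k * h \<sigma>) \<longlongrightarrow> 0) (at s)" by simp
    show "\<forall>\<^sub>F \<sigma> in at s. (\<sigma> - s) ^ Suc k * h \<sigma> = quasi_poly \<alpha> P \<sigma>"
      using Suc.prems(1) by eventually_elim simp
  qed
  ultimately have "quasi_poly \<alpha> P s = 0" using LIM_unique by blast
  then have "poly P (exp s) = 0" by (simp add: quasi_poly_def)
  then obtain Q where Q: "P = [:- exp s, 1:] * Q" by (auto simp: poly_eq_0_iff_dvd)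
  have ne: "\<forall>\<^sub>F \<sigma> in at s. (exp \<sigma> - exp s) / (\<sigma> - s) \<noteq> 0"
    by (rule tendsto_imp_eventually_ne[OF exp_difference_quotient]) simp
  have "[:- exp s, 1:] ^ k dvd Q"
  proof (rule Suc.IH)
    show "((\<lambda>\<sigma>. h \<sigma> / ((exp \<sigma> - exp s) / (\<sigma> - s))) \<longlongrightarrow> L / exp s) (at s)"
      by (intro tendsto_divide Suc.prems exp_difference_quotient) simp
    show "\<forall>\<^sub>F \<sigma> in at s. quasi_poly \<alpha> Q \<sigma> = (\<sigma> - s) ^ k * (h \<sigma> / ((exp \<sigma> - exp s) / (\<sigma> - s)))"
      using ne Suc.prems(1)
    proof eventually_elim
      case (elim \<sigma>)
      then have "quasi_poly \<alpha> Q \<sigma> * (exp \<sigma> - exp s) = (\<sigma> - s) ^ k * (\<sigma> - s) * h \<sigma>"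
        by (simp add: Q quasi_poly_def algebra_simps)
      with elim show ?case by (simp add: field_simps)
    qed
  qed
  then show ?case unfolding Q power_Suc by (rule mult_dvd_mono[OF dvd_refl])
qed simp

lemma cfun_span_pair:
  assumes "F \<in> cfun.span {f, g}"
  obtains a b where "F = (\<lambda>s. a * f s + b * g s)"
proof -
  obtain a where "F - (\<lambda>s. a * f s) \<in> cfun.span {g}"
    using assms cfun.span_breakdown_eq by blast
  then obtain b where "F - (\<lambda>s. a * f s) = (\<lambda>s. b * g s)"
    by (auto simp: cfun.span_singleton)
  then have "F = (\<lambda>s. a * f s + b * g s)" by (auto simp: fun_eq_iff algebra_simps)
  then show ?thesis by (rule that)
qed

lemma vanishing_order_factor:
  assumes F: "F holomorphic_on UNIV" "F \<noteq> (\<lambda>_. 0)" and k: "zorder F s = int k"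
  obtains r h where "r > 0" "h holomorphic_on ball s r" "\<forall>\<sigma>\<in>ball s r. F \<sigma> = (\<sigma> - s) ^ k * h \<sigma>"
proof -
  have "\<exists>w\<in>UNIV. F w \<noteq> 0" using F(2) by auto
  from zorder_exist_zero[OF F(1) open_UNIV connected_UNIV UNIV_I this, of s]
  obtain r where "r > 0" "zor_poly F s holomorphic_on cball s r"
    "\<forall>w\<in>cball s r. F w = zor_poly F s w * (w - s) ^ nat (zorder F s)" by auto
  then show ?thesis
    by (intro that[of r "zor_poly F s"]) (auto simp: k mult.commute intro: holomorphic_on_subset)
qed

lemma wronskian_vanishes:
  assumes F: "F holomorphic_on UNIV" and G: "G holomorphic_on UNIV"
    and r: "r > 0" and h: "h holomorphic_on ball s r"
    and Fh: "\<forall>\<sigma>\<in>ball s r. F \<sigma> = (\<sigma> - s) ^ Suc k * h \<sigma>"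
  obtains H L where "\<forall>\<^sub>F \<sigma> in at s. wronskian F G \<sigma> = (\<sigma> - s) ^ k * H \<sigma>" "(H \<longlongrightarrow> L) (at s)"
proof -
  define H where "H \<sigma> = ((\<sigma> - s) * h \<sigma> * deriv G \<sigma> - ((of_nat (Suc k)) * h \<sigma> + (\<sigma> - s) * deriv h \<sigma>) * G \<sigma>) / exp \<sigma>" for \<sigma>
  have "H holomorphic_on ball s r"
    unfolding H_def
    by (intro holomorphic_intros holomorphic_on_subset[OF G] holomorphic_deriv h
        holomorphic_on_subset[OF holomorphic_deriv[OF G]]) auto
  then have "isCont H s"
    using r by (intro continuous_on_interior[OF holomorphic_on_imp_continuous_on]) (auto simp: interior_open)
  then have 1: "(H \<longlongrightarrow> H s) (at s)" by (simp add: isCont_def)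
  have "wronskian F G \<sigma> = (\<sigma> - s) ^ k * H \<sigma>" if \<sigma>: "\<sigma> \<in> ball s r" for \<sigma>
  proof -
    have dh: "(h has_field_derivative deriv h \<sigma>) (at \<sigma>)"
      using h \<sigma> holomorphic_derivI open_ball by blast
    have "((\<lambda>\<sigma>. (\<sigma> - s) ^ Suc k * h \<sigma>) has_field_derivative
        (of_nat (Suc k) * (\<sigma> - s) ^ k * h \<sigma> + (\<sigma> - s) ^ Suc k * deriv h \<sigma>)) (at \<sigma>)"
      by (rule derivative_eq_intros dh refl)+ (simp add: algebra_simps)
    then have "(F has_field_derivative
        (of_nat (Suc k) * (\<sigma> - s) ^ k * h \<sigma> + (\<sigma> - s) ^ Suc k * deriv h \<sigma>)) (at \<sigma>)"
      by (rule has_field_derivative_transform_within_open[of _ _ _ "ball s r"]) (use \<sigma> Fh in auto)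
    then have dF: "deriv F \<sigma> = of_nat (Suc k) * (\<sigma> - s) ^ k * h \<sigma> + (\<sigma> - s) ^ Suc k * deriv h \<sigma>"
      by (rule DERIV_imp_deriv)
    show ?thesis unfolding wronskian_def dx_def dF H_def bspec[OF Fh \<sigma>] by (simp add: field_simps del: of_nat_Suc)
  qed
  then have "\<forall>\<^sub>F \<sigma> in at s. wronskian F G \<sigma> = (\<sigma> - s) ^ k * H \<sigma>"
    using r by (intro eventually_at_topological[THEN iffD2] exI[of _ "ball s r"]) auto
  with 1 show ?thesis by (rule that[rotated])
qed

lemma wronskian_lincomb:
  assumes F: "F1 holomorphic_on UNIV" "F2 holomorphic_on UNIV"
  shows "wronskian (\<lambda>s. a * F1 s + b * F2 s) F2 s = a * wronskian F1 F2 s"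
    and "wronskian (\<lambda>s. a * F1 s + b * F2 s) F1 s = - b * wronskian F1 F2 s"
proof -
  have "F1 field_differentiable at s" "F2 field_differentiable at s"
    using F by (auto simp: holomorphic_on_def)
  then have d: "deriv (\<lambda>s. a * F1 s + b * F2 s) s = a * deriv F1 s + b * deriv F2 s"
    by (simp add: field_differentiable_mult)
  show "wronskian (\<lambda>s. a * F1 s + b * F2 s) F2 s = a * wronskian F1 F2 s"
    "wronskian (\<lambda>s. a * F1 s + b * F2 s) F1 s = - b * wronskian F1 F2 s"
    unfolding wronskian_def dx_def d by (simp_all add: field_simps)
qed

text \<open>
  Replacing one basis function by a combination \<open>F\<close> changes the Wronskian by a nonzero constant,
  and the Wronskian with a function vanishing to order \<open>k + 1\<close> vanishes to order \<open>k\<close>.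
\<close>

lemma wronskian_divisible:
  assumes F: "F \<in> quasi_poly_space lam p" "F \<noteq> (\<lambda>_. 0)" and k: "zorder F s = 1 + int k"
  shows "[:- exp s, 1:] ^ k dvd quasi_wronskian (lam $ 2 - lam $ 1) (p $ 1) (p $ 2)"
proof -
  define F1 F2 where "F1 = quasi_poly (lam $ 1) (p $ 1)" and "F2 = quasi_poly (lam $ 2) (p $ 2)"
  have hol: "F1 holomorphic_on UNIV" "F2 holomorphic_on UNIV"
    by (simp_all add: F1_def F2_def holomorphic_quasi_poly)
  obtain a b where ab: "F = (\<lambda>s. a * F1 s + b * F2 s)"
    using F(1) cfun_span_pair unfolding quasi_poly_space_def F1_def F2_def by blast
  have holF: "F holomorphic_on UNIV" unfolding ab by (intro holomorphic_intros hol)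
  have "a \<noteq> 0 \<or> b \<noteq> 0" using F(2) ab by auto
  then obtain G c where G: "G holomorphic_on UNIV" "c \<noteq> 0" "\<And>\<sigma>. wronskian F G \<sigma> = c * wronskian F1 F2 \<sigma>"
    using wronskian_lincomb[OF hol, of a b] hol ab by (metis neg_equal_0_iff_equal)
  have k': "zorder F s = int (Suc k)" using k by simp
  obtain r h where rh: "r > 0" "h holomorphic_on ball s r" "\<forall>\<sigma>\<in>ball s r. F \<sigma> = (\<sigma> - s) ^ Suc k * h \<sigma>"
    using vanishing_order_factor[OF holF F(2) k'] by blast
  obtain H L where HL: "\<forall>\<^sub>F \<sigma> in at s. wronskian F G \<sigma> = (\<sigma> - s) ^ k * H \<sigma>" "(H \<longlongrightarrow> L) (at s)"
    using wronskian_vanishes[OF holF G(1) rh] by blast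
  show ?thesis
  proof (rule linear_power_dvd_if_vanishes)
    show "((\<lambda>\<sigma>. H \<sigma> / c) \<longlongrightarrow> L / c) (at s)" using G HL by (intro tendsto_divide) auto
    show "\<forall>\<^sub>F \<sigma> in at s. quasi_poly (lam $ 1 + lam $ 2 - 1) (quasi_wronskian (lam $ 2 - lam $ 1) (p $ 1) (p $ 2)) \<sigma>
        = (\<sigma> - s) ^ k * (H \<sigma> / c)"
      using HL(1)
    proof eventually_elim
      case (elim \<sigma>)
      then have "c * wronskian F1 F2 \<sigma> = (\<sigma> - s) ^ k * H \<sigma>" by (simp add: G)
      then have "wronskian F1 F2 \<sigma> = (\<sigma> - s) ^ k * (H \<sigma> / c)" using G(2) by (simp add: field_simps)
      then show ?case unfolding F1_def F2_def wronskian_quasi_poly .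
    qed
  qed
qed

lemma quasi_poly_in_space: "quasi_poly (lam $ i) (p $ i) \<in> quasi_poly_space lam p"
proof -
  have "i = 1 \<or> i = 2" using exhaust_2 by blast
  then show ?thesis unfolding quasi_poly_space_def by (auto intro: cfun.span_base)
qed

lemma quasi_poly_space_typeD:
  assumes "quasi_poly_space_type n lam m z p"
  shows "degree (p $ i) = n $ i" "poly (p $ i) 0 \<noteq> 0"
    and "exp s = z $ a \<Longrightarrow> exponents (quasi_poly_space lam p) s = {0, 1 + int (m $ a)}"
  using assms[unfolded quasi_poly_space_type_def, THEN conjunct1, rule_format, of i]
    assms[unfolded quasi_poly_space_type_def, THEN conjunct2, THEN conjunct2, rule_format, of s a]
  by simp_all

text \<open>
  The exponents at \<open>z\<^sub>1\<close> and \<open>z\<^sub>2\<close> provide the divisors. Since \<open>m\<^sub>1 + m\<^sub>2 = n\<^sub>1 + n\<^sub>2\<close>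
  bounds the degree, nothing but a constant is left; it is nonzero by the value at \<open>0\<close>.
\<close>

theorem wronskian_of_type:
  fixes n m :: "nat^2"
  assumes type: "quasi_poly_space_type n lam m z p" and nm: "n $ 1 + n $ 2 = m $ 1 + m $ 2"
    and z: "z $ 1 \<noteq> z $ 2" "z $ 1 \<noteq> 0" "z $ 2 \<noteq> 0" and lam: "lam $ 1 \<noteq> lam $ 2"
  obtains c where "c \<noteq> 0" "quasi_wronskian (lam $ 2 - lam $ 1) (p $ 1) (p $ 2)
      = smult c ([:- (z $ 1), 1:] ^ (m $ 1) * [:- (z $ 2), 1:] ^ (m $ 2))"
proof -
  define w where "w = quasi_wronskian (lam $ 2 - lam $ 1) (p $ 1) (p $ 2)"
  note dp = quasi_poly_space_typeD(1)[OF type] and p0 = quasi_poly_space_typeD(2)[OF type]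
  have dvd: "[:- (z $ a), 1:] ^ (m $ a) dvd w" for a
  proof -
    have "z $ a \<noteq> 0" using z exhaust_2[of a] by auto
    then have e: "exp (Ln (z $ a)) = z $ a" by simp
    then have "1 + int (m $ a) \<in> exponents (quasi_poly_space lam p) (Ln (z $ a))"
      using quasi_poly_space_typeD(3)[OF type] by simp
    then obtain F where "F \<in> quasi_poly_space lam p" "F \<noteq> (\<lambda>_. 0)" "zorder F (Ln (z $ a)) = 1 + int (m $ a)"
      unfolding exponents_def by auto
    from wronskian_divisible[OF this] show ?thesis by (simp add: e w_def)
  qed
  have w0: "w \<noteq> 0"
  proof
    assume "w = 0"
    then have "poly w 0 = 0" by simp
    then show False using p0 lam by (simp add: w_def quasi_wronskian_def)
  qed
  obtain u where u: "w = [:- (z $ 1), 1:] ^ (m $ 1) * u" using dvd by blast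
  have "order (z $ 2) ([:- (z $ 1), 1:] ^ (m $ 1)) = 0" using z(1) by (intro order_0I) simp
  then have "order (z $ 2) w = order (z $ 2) u" using w0 unfolding u by (subst order_mult) simp_all
  then have "[:- (z $ 2), 1:] ^ (m $ 2) dvd u" using dvd[of 2] w0 by (simp add: order_divides)
  then obtain v where "u = [:- (z $ 2), 1:] ^ (m $ 2) * v" by blast
  then have v: "w = [:- (z $ 1), 1:] ^ (m $ 1) * [:- (z $ 2), 1:] ^ (m $ 2) * v" by (simp add: u mult.assoc)
  have v0: "v \<noteq> 0" using w0 unfolding v by auto
  have "degree w \<le> n $ 1 + n $ 2"
  proof -
    have d1: "degree ([:0, 1:] * (pderiv q * r)) \<le> degree q + degree r" for q r :: "complex poly"
    proof (cases "degree q")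
      case 0
      then have "pderiv q = 0" by (simp add: pderiv_eq_0_iff)
      then show ?thesis by simp
    next
      case (Suc d)
      have "degree ([:0, 1:] * (pderiv q * r)) \<le> 1 + (degree (pderiv q) + degree r)"
        by (intro order_trans[OF degree_mult_le] add_mono) (auto intro: degree_mult_le)
      then show ?thesis using Suc by (simp add: degree_pderiv)
    qed
    have "w = [:0, 1:] * (pderiv (p $ 2) * (p $ 1)) - [:0, 1:] * (pderiv (p $ 1) * (p $ 2))
        + smult (lam $ 2 - lam $ 1) ((p $ 1) * (p $ 2))"
      by (simp add: w_def quasi_wronskian_def right_diff_distrib mult_ac del: mult_pCons_left)
    moreover have "degree ([:0, 1:] * (pderiv (p $ 2) * (p $ 1))) \<le> n $ 1 + n $ 2"
      using d1[of "p $ 2" "p $ 1"] by (simp only: dp add.commute)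
    moreover have "degree ([:0, 1:] * (pderiv (p $ 1) * (p $ 2))) \<le> n $ 1 + n $ 2"
      using d1[of "p $ 1" "p $ 2"] by (simp only: dp)
    moreover have "degree (smult (lam $ 2 - lam $ 1) ((p $ 1) * (p $ 2))) \<le> n $ 1 + n $ 2"
      using order_trans[OF degree_smult_le degree_mult_le] by (metis dp)
    ultimately show ?thesis by (simp only: degree_add_le degree_diff_le)
  qed
  moreover have "degree w = m $ 1 + m $ 2 + degree v"
    unfolding v using v0 by (simp add: degree_mult_eq degree_power_eq del: mult_pCons_left)
  ultimately have "degree v = 0" using nm by linarith
  then obtain c where c: "v = [:c:]" using degree_eq_zeroE by blast
  show ?thesis
  proof (rule that)
    show "c \<noteq> 0" using v0 c by simp
    show "quasi_wronskian (lam $ 2 - lam $ 1) (p $ 1) (p $ 2)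
        = smult c ([:- (z $ 1), 1:] ^ (m $ 1) * [:- (z $ 2), 1:] ^ (m $ 2))"
      unfolding w_def[symmetric] v c by simp
  qed
qed

lemma high_order_if_root:
  assumes type: "quasi_poly_space_type n lam m z p" and z0: "z $ a \<noteq> 0"
    and root: "poly (p $ i) (z $ a) = 0"
  shows "[:- (z $ a), 1:] ^ Suc (m $ a) dvd p $ i"
proof -
  define s where "s = Ln (z $ a)"
  define F where "F = quasi_poly (lam $ i) (p $ i)"
  have e: "exp s = z $ a" using z0 by (simp add: s_def)
  have hol: "F holomorphic_on UNIV" by (simp add: F_def holomorphic_quasi_poly)
  have "\<exists>s. F s \<noteq> 0"
  proof -
    have "p $ i \<noteq> 0" using quasi_poly_space_typeD(2)[OF type, of i] by auto
    then have "finite (insert 0 {x. poly (p $ i) x = 0})" using poly_roots_finite by auto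
    then obtain x where "x \<notin> insert 0 {x. poly (p $ i) x = 0}"
      using infinite_UNIV_char_0 by (metis UNIV_I finite_subset subsetI)
    then have "F (Ln x) \<noteq> 0" by (simp add: F_def quasi_poly_def)
    then show ?thesis by blast
  qed
  then have nz: "F \<noteq> (\<lambda>_. 0)" by auto
  have "zorder F s \<in> {0, 1 + int (m $ a)}"
  proof -
    have "zorder F s \<in> exponents (quasi_poly_space lam p) s"
      unfolding exponents_def using nz quasi_poly_in_space[of lam i p] by (auto simp: F_def)
    then show ?thesis using quasi_poly_space_typeD(3)[OF type e] by simp
  qed
  moreover have "zorder F s \<noteq> 0"
  proof -
    have "F s = 0" using root by (simp add: F_def quasi_poly_def e)
    moreover have "\<exists>w\<in>UNIV. F w \<noteq> 0" using nz by auto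
    ultimately show ?thesis
      using zorder_exist_zero[OF hol open_UNIV connected_UNIV UNIV_I, of s] by simp
  qed
  ultimately have k: "zorder F s = int (Suc (m $ a))" by auto
  obtain r h where rh: "r > 0" "h holomorphic_on ball s r"
      "\<forall>\<sigma>\<in>ball s r. F \<sigma> = (\<sigma> - s) ^ Suc (m $ a) * h \<sigma>"
    using vanishing_order_factor[OF hol nz k] by blast
  have "isCont h s"
    using rh(1,2) by (intro continuous_on_interior[OF holomorphic_on_imp_continuous_on]) (auto simp: interior_open)
  then have "(h \<longlongrightarrow> h s) (at s)" by (simp add: isCont_def)
  moreover have "\<forall>\<^sub>F \<sigma> in at s. quasi_poly (lam $ i) (p $ i) \<sigma> = (\<sigma> - s) ^ Suc (m $ a) * h \<sigma>"
    using rh by (intro eventually_at_topological[THEN iffD2] exI[of _ "ball s r"]) (auto simp: F_def)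
  ultimately have "[:- exp s, 1:] ^ Suc (m $ a) dvd p $ i" by (rule linear_power_dvd_if_vanishes[rotated])
  then show ?thesis by (simp add: e)
qed

section \<open>The bispectral dual space\<close>

lemma log_branch_props:
  assumes "x \<in> ball (exp l) (norm (exp l))"
  shows "exp (log_branch l x) = x"
    and "(log_branch l has_field_derivative 1 / x) (at x)"
proof -
  define y where "y = x / exp l"
  have "norm (y - 1) = norm (x - exp l) / norm (exp l)"
    unfolding y_def norm_divide[symmetric] by (simp add: diff_divide_distrib)
  also have "\<dots> < 1" using assms by (simp add: dist_norm norm_minus_commute)
  finally have "norm (1 - y) < 1" by (simp add: norm_minus_commute)
  then have "Re (1 - y) < 1" using abs_Re_le_cmod[of "1 - y"] by linarith
  then have y: "Re y > 0" by simp
  then have y0: "y \<noteq> 0" by auto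
  then have x0: "x \<noteq> 0" by (simp add: y_def)
  have "exp (log_branch l x) = exp l * y" using y0 by (simp add: log_branch_def exp_add y_def)
  then show "exp (log_branch l x) = x" by (simp add: y_def)
  have "y \<notin> \<real>\<^sub>\<le>\<^sub>0" using y by (auto simp: complex_nonpos_Reals_iff)
  then have "((\<lambda>x. l + Ln (x / exp l)) has_field_derivative 0 + 1 / exp l * inverse (x / exp l)) (at x)"
    by (auto intro!: derivative_eq_intros simp: y_def divide_simps)
  then have "((\<lambda>x. l + Ln (x / exp l)) has_field_derivative 1 / x) (at x)"
    by (simp add: field_simps)
  then show "(log_branch l has_field_derivative 1 / x) (at x)"
    unfolding log_branch_def[abs_def] .
qed

lemma log_branch_centre: "log_branch l (exp l) = l"
  by (simp add: log_branch_def)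

text \<open>
  Each differentiation of \<open>x\<^bsup>u - \<kappa>\<^esup> g(x)\<close> produces one factor that is linear in \<open>u\<close>; at order
  \<open>k\<close> the top coefficient comes from differentiating only the power of \<open>x\<close>.
\<close>

lemma higher_deriv_power_times:
  assumes S: "open S" "exp l \<in> S" "S \<subseteq> ball (exp l) (norm (exp l))"
    and g: "g holomorphic_on S"
  shows "\<exists>Q. degree Q \<le> k \<and> coeff Q k = g (exp l) / exp l ^ k \<and>
    (\<forall>u. (deriv ^^ k) (\<lambda>x. exp ((u - \<kappa>) * log_branch l x) * g x) (exp l) = exp ((u - \<kappa>) * l) * poly Q u)"
  using g
proof (induction k arbitrary: g)
  case 0
  show ?case by (intro exI[of _ "[:g (exp l):]"]) (simp add: log_branch_centre)
next
  case (Suc k)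
  have x0: "x \<noteq> 0" if "x \<in> S" for x using S that by (auto simp: dist_norm)
  have hx: "(\<lambda>x. g x / x) holomorphic_on S" using x0 by (intro holomorphic_intros Suc.prems) auto
  have hg': "deriv g holomorphic_on S" using Suc.prems S by (intro holomorphic_deriv)
  obtain Q1 where Q1: "degree Q1 \<le> k" "coeff Q1 k = g (exp l) / exp l / exp l ^ k"
    "\<And>u. (deriv ^^ k) (\<lambda>x. exp ((u - \<kappa>) * log_branch l x) * (g x / x)) (exp l) = exp ((u - \<kappa>) * l) * poly Q1 u"
    using Suc.IH[OF hx] by blast
  obtain Q2 where Q2: "degree Q2 \<le> k"
    "\<And>u. (deriv ^^ k) (\<lambda>x. exp ((u - \<kappa>) * log_branch l x) * deriv g x) (exp l) = exp ((u - \<kappa>) * l) * poly Q2 u"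
    using Suc.IH[OF hg'] by blast
  define Q where "Q = [:- \<kappa>, 1:] * Q1 + Q2"
  have hL: "log_branch l holomorphic_on S"
    using log_branch_props(2) S(3) by (meson field_differentiable_at_within field_differentiable_def holomorphic_on_def subsetD)
  have "(deriv ^^ Suc k) (\<lambda>x. exp ((u - \<kappa>) * log_branch l x) * g x) (exp l) = exp ((u - \<kappa>) * l) * poly Q u" for u
  proof -
    let ?e = "\<lambda>x. exp ((u - \<kappa>) * log_branch l x)"
    have he: "?e holomorphic_on S" by (intro holomorphic_intros hL)
    have d: "deriv (\<lambda>x. ?e x * g x) x = (u - \<kappa>) * (?e x * (g x / x)) + ?e x * deriv g x" if x: "x \<in> S" for x
    proof -
      have "(g has_field_derivative deriv g x) (at x)" using Suc.prems S(1) x by (rule holomorphic_derivI)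
      moreover have "(log_branch l has_field_derivative 1 / x) (at x)" using log_branch_props(2) S(3) x by blast
      ultimately have "((\<lambda>x. ?e x * g x) has_field_derivative
          ((u - \<kappa>) * (?e x * (g x / x)) + ?e x * deriv g x)) (at x)"
        by (auto intro!: derivative_eq_intros simp: algebra_simps)
      then show ?thesis by (rule DERIV_imp_deriv)
    qed
    have "(deriv ^^ Suc k) (\<lambda>x. ?e x * g x) (exp l) = (deriv ^^ k) (deriv (\<lambda>x. ?e x * g x)) (exp l)"
      by (simp add: funpow_swap1)
    also have "\<dots> = (deriv ^^ k) (\<lambda>x. (u - \<kappa>) * (?e x * (g x / x)) + ?e x * deriv g x) (exp l)"
      by (rule higher_deriv_transform_within_open[OF _ _ S(1,2) d])
         (intro holomorphic_deriv holomorphic_on_mult holomorphic_on_add holomorphic_on_const he hx hg' Suc.prems S)+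
    also have "\<dots> = (deriv ^^ k) (\<lambda>x. (u - \<kappa>) * (?e x * (g x / x))) (exp l)
        + (deriv ^^ k) (\<lambda>x. ?e x * deriv g x) (exp l)"
      by (rule higher_deriv_add[OF _ _ S(1,2)]) (intro holomorphic_on_mult holomorphic_on_const he hx hg')+
    also have "(deriv ^^ k) (\<lambda>x. (u - \<kappa>) * (?e x * (g x / x))) (exp l)
        = (u - \<kappa>) * (deriv ^^ k) (\<lambda>x. ?e x * (g x / x)) (exp l)"
      by (rule higher_deriv_cmult[OF _ S(2,1)]) (intro holomorphic_on_mult he hx)
    finally show ?thesis unfolding Q1(3) Q2(2) Q_def by (simp add: algebra_simps)
  qed
  moreover have "degree Q \<le> Suc k"
    unfolding Q_def using Q1(1) Q2(1)
    by (intro degree_add_le order_trans[OF degree_mult_le]) auto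
  moreover have "coeff Q (Suc k) = g (exp l) / exp l ^ Suc k"
    using Q1(1,2) Q2(1) by (simp add: Q_def coeff_eq_0)
  ultimately show ?case by blast
qed

lemma local_integral_exp_poly:
  assumes S: "open S" "exp l \<in> S" and g: "g holomorphic_on S" and g0: "g (exp l) \<noteq> 0"
  obtains Q where "degree Q = k" "Q \<noteq> 0"
    "\<And>u. \<forall>\<^sub>F \<epsilon> in at_right 0. ((\<lambda>x. exp ((u - \<kappa>) * log_branch l x) * g x / (x - exp l) ^ Suc k)
      has_contour_integral exp_poly l Q u) (circlepath (exp l) \<epsilon>)"
proof -
  define S' where "S' = S \<inter> ball (exp l) (norm (exp l))"
  have S': "open S'" "exp l \<in> S'" "S' \<subseteq> ball (exp l) (norm (exp l))" "S' \<subseteq> S"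
    using S by (auto simp: S'_def)
  have g': "g holomorphic_on S'" using g S'(4) by (rule holomorphic_on_subset)
  obtain Q where Q: "degree Q \<le> k" "coeff Q k = g (exp l) / exp l ^ k"
    "\<And>u. (deriv ^^ k) (\<lambda>x. exp ((u - \<kappa>) * log_branch l x) * g x) (exp l) = exp ((u - \<kappa>) * l) * poly Q u"
    using higher_deriv_power_times[OF S'(1-3) g', of k \<kappa>] by blast
  have "coeff Q k \<noteq> 0" using Q(2) g0 by simp
  then have "degree Q = k" "Q \<noteq> 0" using Q(1) by (auto intro: le_antisym le_degree)
  define c where "c = 2 * of_real pi * \<i> / fact k * exp (- \<kappa> * l)"
  have c0: "c \<noteq> 0" by (simp add: c_def)
  have hL: "log_branch l holomorphic_on S'"
    using log_branch_props(2) S'(3) by (meson field_differentiable_at_within field_differentiable_def holomorphic_on_def subsetD)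
  obtain r where r: "r > 0" "cball (exp l) r \<subseteq> S'" using S'(1,2) open_contains_cball by blast
  show ?thesis
  proof (rule that[of "smult c Q"])
    show "degree (smult c Q) = k" using c0 \<open>degree Q = k\<close> by simp
    show "smult c Q \<noteq> 0" using c0 \<open>Q \<noteq> 0\<close> by simp
    fix u
    have h: "(\<lambda>x. exp ((u - \<kappa>) * log_branch l x) * g x) holomorphic_on S'"
      by (intro holomorphic_intros hL g')
    have I: "((\<lambda>x. exp ((u - \<kappa>) * log_branch l x) * g x / (x - exp l) ^ Suc k)
      has_contour_integral exp_poly l (smult c Q) u) (circlepath (exp l) \<epsilon>)" if \<epsilon>: "0 < \<epsilon>" "\<epsilon> < r" for \<epsilon>
    proof -
      have sub: "cball (exp l) \<epsilon> \<subseteq> S'" using r \<epsilon> by (meson order_less_imp_le order_trans subset_cball)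
      have "exp_poly l (smult c Q) u = 2 * of_real pi * \<i> / fact k *
          (deriv ^^ k) (\<lambda>x. exp ((u - \<kappa>) * log_branch l x) * g x) (exp l)"
        unfolding Q(3) by (simp add: exp_poly_def c_def left_diff_distrib exp_diff exp_minus field_simps)
      then show ?thesis
        using Cauchy_has_contour_integral_higher_derivative_circlepath[of "exp l" \<epsilon>
            "\<lambda>x. exp ((u - \<kappa>) * log_branch l x) * g x" "exp l" k] \<epsilon>
          holomorphic_on_subset[OF h sub] holomorphic_on_imp_continuous_on[OF holomorphic_on_subset[OF h sub]]
          holomorphic_on_subset[OF h order_trans[OF ball_subset_cball sub]]
        by simp
    qed
    show "\<forall>\<^sub>F \<epsilon> in at_right 0. ((\<lambda>x. exp ((u - \<kappa>) * log_branch l x) * g x / (x - exp l) ^ Suc k)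
      has_contour_integral exp_poly l (smult c Q) u) (circlepath (exp l) \<epsilon>)"
      using I r(1) by (auto simp: eventually_at_right_field)
  qed
qed

text \<open>
  The degree condition makes the rational function \<open>O(1 / x\<^sup>2)\<close> at infinity, so its integral over a
  circle of radius \<open>R\<close> is \<open>O(1 / R)\<close>; by the residue theorem it does not depend on large \<open>R\<close>.
\<close>

lemma residue_sum_zero:
  fixes z :: "'i::finite \<Rightarrow> complex"
  assumes inj: "inj z" and deg: "degree P + 2 \<le> (\<Sum>k\<in>UNIV. Suc (m k))"
    and I: "\<And>k. \<forall>\<^sub>F \<epsilon> in at_right 0.
      ((\<lambda>x. poly P x / (\<Prod>k\<in>UNIV. (x - z k) ^ Suc (m k))) has_contour_integral I k) (circlepath (z k) \<epsilon>)"
  shows "(\<Sum>k\<in>UNIV. I k) = 0"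
proof -
  define D where "D = (\<Prod>k\<in>UNIV. [:- z k, 1:] ^ Suc (m k))"
  define f where "f x = poly P x / poly D x" for x
  have D: "poly D x = (\<Prod>k\<in>UNIV. (x - z k) ^ Suc (m k))" for x
    unfolding D_def poly_prod poly_power by simp
  have f: "(\<lambda>x. poly P x / (\<Prod>k\<in>UNIV. (x - z k) ^ Suc (m k))) = f"
    by (simp add: f_def D fun_eq_iff)
  have D_zero: "poly D x = 0 \<longleftrightarrow> x \<in> range z" for x by (auto simp: D)
  have hol: "f holomorphic_on (UNIV - range z)"
    unfolding f_def using D_zero by (intro holomorphic_intros) auto
  have res: "2 * pi * \<i> * residue f (z k) = I k" for k
  proof -
    define s where "s = UNIV - z ` (UNIV - {k})"
    have s: "open s" "z k \<in> s" using inj by (auto simp: s_def open_Diff finite_imp_closed inj_eq)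
    have hs: "f holomorphic_on (s - {z k})" by (rule holomorphic_on_subset[OF hol]) (auto simp: s_def)
    obtain r where r: "r > 0" "cball (z k) r \<subseteq> s" using s open_contains_cball by blast
    have "\<forall>\<^sub>F \<epsilon> in at_right 0. (f has_contour_integral I k) (circlepath (z k) \<epsilon>)"
      using I[of k] unfolding f .
    moreover have "\<forall>\<^sub>F \<epsilon> in at_right 0. 0 < \<epsilon> \<and> \<epsilon> < r"
      using r(1) by (auto simp: eventually_at_right_field)
    ultimately have "\<forall>\<^sub>F \<epsilon> in at_right 0. (f has_contour_integral I k) (circlepath (z k) \<epsilon>) \<and> 0 < \<epsilon> \<and> \<epsilon> < r"
      by eventually_elim simp
    then obtain \<epsilon> where e: "(f has_contour_integral I k) (circlepath (z k) \<epsilon>)" "0 < \<epsilon>" "\<epsilon> < r"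
      using eventually_happens'[of "at_right (0::real)"] by (auto simp: trivial_limit_at_right_real)
    have "cball (z k) \<epsilon> \<subseteq> s" using r e by (meson order_less_imp_le order_trans subset_cball)
    from base_residue[OF s e(2) hs this] e(1) show ?thesis
      by (rule has_contour_integral_unique)
  qed
  have degD: "degree D = (\<Sum>k\<in>UNIV. Suc (m k))"
    unfolding D_def by (subst degree_prod_sum_eq) (auto simp: degree_power_eq simp del: power_Suc)
  have "((\<lambda>x. poly ([:0, 1:] * P) x / poly D x) \<longlongrightarrow> 0) at_infinity"
  proof (rule poly_divide_tendsto_0_at_infinity)
    have "degree ([:0, 1:] * P) \<le> 1 + degree P" by (rule order_trans[OF degree_mult_le]) simp
    then show "degree D > degree ([:0, 1:] * P)" using deg degD by linarith
  qed
  then have lim: "((\<lambda>x. x * f x) \<longlongrightarrow> 0) at_infinity" by (simp add: f_def)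
  define T where "T = (\<Sum>k\<in>UNIV. I k)"
  have bound: "norm T \<le> e * (2 * pi)" if e: "e > 0" for e
  proof -
    have "\<forall>\<^sub>F x in at_infinity. norm (x * f x) < e"
      using tendstoD[OF lim e] by (simp add: dist_norm)
    then obtain b where b: "\<And>x. b \<le> norm x \<Longrightarrow> norm (x * f x) < e"
      unfolding eventually_at_infinity by blast
    define R where "R = max (max b 1) (Max (range (\<lambda>k. norm (z k))) + 1)"
    have R: "R \<ge> b" "R > 0" "\<And>k. norm (z k) < R"
      unfolding R_def using Max_ge[of "range (\<lambda>k. norm (z k))"] by (auto simp: less_max_iff_disj)
         (smt (verit) Max_ge finite_class.finite_UNIV finite_imageI rangeI)
    have img: "path_image (circlepath 0 R) \<subseteq> UNIV - range z"
      using R by (force simp: sphere_def)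
    have "contour_integral (circlepath 0 R) f = 2 * pi * \<i> * (\<Sum>p\<in>range z. winding_number (circlepath 0 R) p * residue f p)"
      by (rule Residue_theorem[OF open_UNIV connected_UNIV _ hol]) (use img in auto)
    also have "\<dots> = 2 * pi * \<i> * (\<Sum>p\<in>range z. residue f p)"
      using R by (intro arg_cong2[of _ _ _ _ "(*)"] sum.cong refl) (auto simp: winding_number_circlepath)
    also have "(\<Sum>p\<in>range z. residue f p) = (\<Sum>k\<in>UNIV. residue f (z k))"
      by (subst sum.reindex[OF inj]) simp
    also have "2 * pi * \<i> * (\<Sum>k\<in>UNIV. residue f (z k)) = T"
      unfolding T_def res[symmetric] by (simp add: sum_distrib_left)
    finally have cT: "contour_integral (circlepath 0 R) f = T" .
    have "continuous_on (path_image (circlepath 0 R)) f"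
      using holomorphic_on_imp_continuous_on[OF hol] img continuous_on_subset by blast
    then have "f contour_integrable_on circlepath 0 R" by (rule contour_integrable_continuous_circlepath)
    then have "(f has_contour_integral T) (circlepath 0 R)" using cT has_contour_integral_integral by metis
    then have "norm T \<le> e / R * (2 * pi * R)"
    proof (rule has_contour_integral_bound_circlepath)
      show "0 \<le> e / R" "0 < R" using e R by auto
      fix x :: complex assume "norm (x - 0) = R"
      then have "norm (x * f x) < e" "norm x = R" using b R by auto
      then show "norm (f x) \<le> e / R" using R(2) by (simp add: norm_mult field_simps)
    qed
    then show ?thesis using R(2) by simp
  qed
  have "norm T \<le> 0"
  proof (rule field_le_epsilon)
    fix e :: real assume "e > 0"
    then show "norm T \<le> 0 + e" using bound[of "e / (2 * pi)"] by simp
  qed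
  then show ?thesis by (simp add: T_def)
qed

text \<open>
  If \<open>exp (u l) A(u) = exp (u l') B(u)\<close>, the shift \<open>u \<mapsto> u + 1\<close> multiplies the two exponentials
  by different constants, whereas it does not change the leading coefficients of \<open>A\<close> and \<open>B\<close>.
\<close>

lemma exp_poly_independent:
  assumes ne: "exp l \<noteq> exp l'" and eq: "\<And>u. exp_poly l A u = exp_poly l' B u"
  shows "A = 0"
proof (rule ccontr)
  assume A: "A \<noteq> 0"
  have B: "B \<noteq> 0"
  proof
    assume "B = 0"
    then have "poly A u = 0" for u using eq[of u] by (simp add: exp_poly_def)
    then have "A = 0" using poly_all_0_iff_0 by blast
    with A show False by simp
  qed
  \<comment> \<open>Compare the quotient \<open>B / A\<close> at \<open>u\<close> and at \<open>u + 1\<close>.\<close>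
  have key: "poly (smult (exp l) (shift_poly A * B)) u = poly (smult (exp l') (shift_poly B * A)) u" for u
  proof -
    have e: "exp ((u + 1) * t) = exp (u * t) * exp t" for t
      unfolding exp_add[symmetric] by (simp add: algebra_simps)
    have "exp_poly l A (u + 1) * exp_poly l' B u = exp_poly l' B (u + 1) * exp_poly l A u"
      unfolding eq ..
    then have "(exp (u * l) * exp (u * l')) * (exp l * (poly A (u + 1) * poly B u))
        = (exp (u * l) * exp (u * l')) * (exp l' * (poly B (u + 1) * poly A u))"
      unfolding exp_poly_def e by (simp only: mult_ac)
    then have "exp l * (poly A (u + 1) * poly B u) = exp l' * (poly B (u + 1) * poly A u)"
      by (subst (asm) mult_left_cancel) simp_all
    then show ?thesis by (simp only: poly_smult poly_mult poly_shift_poly)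
  qed
  have "poly (smult (exp l) (shift_poly A * B)) = poly (smult (exp l') (shift_poly B * A))"
    by (rule ext) (rule key)
  then have "smult (exp l) (shift_poly A * B) = smult (exp l') (shift_poly B * A)"
    by (simp only: poly_eq_poly_eq_iff)
  then have "lead_coeff (smult (exp l) (shift_poly A * B)) = lead_coeff (smult (exp l') (shift_poly B * A))"
    by (rule arg_cong)
  then have "exp l * (lead_coeff A * lead_coeff B) = exp l' * (lead_coeff B * lead_coeff A)"
    by (simp only: lead_coeff_smult lead_coeff_mult lead_coeff_shift_poly)
  then have "(exp l - exp l') * (lead_coeff A * lead_coeff B) = 0" by (simp add: algebra_simps)
  then show False using ne A B by simp
qed

text \<open>
  All powers of \<open>x\<close> combine into one: the Wronskian contributes the exponent
  \<open>1 - \<kappa> - \<kappa>'\<close>, the function in the numerator \<open>\<kappa>\<close>, and the weight \<open>-2\<close>.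
\<close>

lemma bispectral_integrand_explicit:
  fixes m :: "nat^2"
  assumes x: "x \<in> ball (exp l) (norm (exp l))"
  shows "bispectral_integrand z l u (\<lambda>s. quasi_poly \<kappa> P s /
      quasi_poly (\<kappa> + \<kappa>' - 1) (smult c ([:- (z $ 1), 1:] ^ (m $ 1) * [:- (z $ 2), 1:] ^ (m $ 2))) s) x
    = exp ((u - (\<kappa>' + 1)) * log_branch l x) * poly P x / (c * (\<Prod>k\<in>UNIV. (x - z $ k) ^ Suc (m $ k)))"
proof -
  define L where "L = log_branch l x"
  have eL: "exp L = x" using log_branch_props(1)[OF x] by (simp add: L_def)
  have "exp ((u - (\<kappa>' + 1)) * L) = exp (u * L + \<kappa> * L - (\<kappa> + \<kappa>' - 1) * L - (L + L))"
    by (simp add: algebra_simps)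
  also have "\<dots> = exp (u * L) * exp (\<kappa> * L) / exp ((\<kappa> + \<kappa>' - 1) * L) / (x * x)"
    by (simp only: exp_diff exp_add eL)
  finally have e: "exp ((u - (\<kappa>' + 1)) * L) = exp (u * L) * exp (\<kappa> * L) / exp ((\<kappa> + \<kappa>' - 1) * L) / (x * x)" .
  show ?thesis
    unfolding bispectral_integrand_def quasi_poly_def L_def[symmetric] eL e
    by (simp add: UNIV_2 divide_inverse power2_eq_square mult_ac)
qed

lemma eventually_circle_in_ball:
  assumes "r > 0"
  shows "\<forall>\<^sub>F \<epsilon> in at_right 0. path_image (circlepath z \<epsilon>) \<subseteq> ball z r"
  using assms by (auto simp: eventually_at_right_field sphere_def intro!: exI[of _ r])

lemma has_contour_integral_small_circle_cong:
  assumes r: "r > 0" and eq: "\<And>x. x \<in> ball z r \<Longrightarrow> f x = g x"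
    and f: "\<forall>\<^sub>F \<epsilon> in at_right 0. (f has_contour_integral I) (circlepath z \<epsilon>)"
  shows "\<forall>\<^sub>F \<epsilon> in at_right 0. (g has_contour_integral I) (circlepath z \<epsilon>)"
  using f eventually_circle_in_ball[OF r, of z]
proof eventually_elim
  case (elim \<epsilon>)
  show ?case by (rule has_contour_integral_eq[OF elim(1)]) (use elim(2) eq in blast)
qed

lemma integral_over_star_element:
  fixes m :: "nat^2" and z l :: "complex^2"
  assumes inj: "inj (($) z)" and l: "exp (l $ a) = z $ a" and c: "c \<noteq> 0" and P: "poly P (z $ a) \<noteq> 0"
  shows "\<exists>Q. degree Q = m $ a \<and> Q \<noteq> 0 \<and>
    (\<forall>u. \<forall>\<^sub>F \<epsilon> in at_right 0. (bispectral_integrand z (l $ a) u (\<lambda>s. quasi_poly \<kappa> P s /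
      quasi_poly (\<kappa> + \<kappa>' - 1) (smult c ([:- (z $ 1), 1:] ^ (m $ 1) * [:- (z $ 2), 1:] ^ (m $ 2))) s)
      has_contour_integral exp_poly (l $ a) Q u) (circlepath (z $ a) \<epsilon>))"
proof -
  define S where "S = UNIV - ($) z ` (UNIV - {a})"
  define g where "g x = poly P x / (c * (\<Prod>k\<in>UNIV - {a}. (x - z $ k) ^ Suc (m $ k)))" for x
  have S: "open S" "z $ a \<in> S" using inj by (auto simp: S_def open_Diff finite_imp_closed inj_eq)
  have "g holomorphic_on S" unfolding g_def using c by (intro holomorphic_intros) (auto simp: S_def)
  moreover have "g (z $ a) \<noteq> 0" using P c inj by (auto simp: g_def inj_eq)
  ultimately obtain Q where Q: "degree Q = m $ a" "Q \<noteq> 0"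
    "\<And>u. \<forall>\<^sub>F \<epsilon> in at_right 0. ((\<lambda>x. exp ((u - (\<kappa>' + 1)) * log_branch (l $ a) x) * g x / (x - z $ a) ^ Suc (m $ a))
      has_contour_integral exp_poly (l $ a) Q u) (circlepath (z $ a) \<epsilon>)"
    using local_integral_exp_poly[of S "l $ a" g "m $ a" "\<kappa>' + 1"] S unfolding l by blast
  show ?thesis
  proof (intro exI conjI allI)
    show "degree Q = m $ a" "Q \<noteq> 0" by (rule Q)+
    fix u
    show "\<forall>\<^sub>F \<epsilon> in at_right 0. (bispectral_integrand z (l $ a) u (\<lambda>s. quasi_poly \<kappa> P s /
      quasi_poly (\<kappa> + \<kappa>' - 1) (smult c ([:- (z $ 1), 1:] ^ (m $ 1) * [:- (z $ 2), 1:] ^ (m $ 2))) s)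
      has_contour_integral exp_poly (l $ a) Q u) (circlepath (z $ a) \<epsilon>)"
    proof (rule has_contour_integral_small_circle_cong[OF _ _ Q(3)])
      show "norm (z $ a) > 0" by (simp flip: l)
      fix x assume "x \<in> ball (z $ a) (norm (z $ a))"
      then have x: "x \<in> ball (exp (l $ a)) (norm (exp (l $ a)))" by (simp only: l)
      have "(\<Prod>k\<in>UNIV. (x - z $ k) ^ Suc (m $ k)) = (x - z $ a) ^ Suc (m $ a) * (\<Prod>k\<in>UNIV - {a}. (x - z $ k) ^ Suc (m $ k))"
        by (rule prod.remove) auto
      then show "exp ((u - (\<kappa>' + 1)) * log_branch (l $ a) x) * g x / (x - z $ a) ^ Suc (m $ a)
        = bispectral_integrand z (l $ a) u (\<lambda>s. quasi_poly \<kappa> P s /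
      quasi_poly (\<kappa> + \<kappa>' - 1) (smult c ([:- (z $ 1), 1:] ^ (m $ 1) * [:- (z $ 2), 1:] ^ (m $ 2))) s) x"
        unfolding bispectral_integrand_explicit[OF x] by (simp add: g_def mult_ac del: power_Suc)
    qed
  qed
qed

text \<open>
  At \<open>u = \<kappa>' + 1 + j\<close> the integrand is a rational function, the same for both circles. It is
  \<open>O(1 / x\<^sup>2)\<close> at infinity as long as \<open>j\<close> is small.
\<close>

lemma chain_relation:
  fixes m :: "nat^2" and z l :: "complex^2"
  assumes inj: "inj (($) z)" and l: "\<And>a. exp (l $ a) = z $ a"
    and j: "degree P + j \<le> m $ 1 + m $ 2"
    and Q: "\<And>a u. \<forall>\<^sub>F \<epsilon> in at_right 0. (bispectral_integrand z (l $ a) u (\<lambda>s. quasi_poly \<kappa> P s /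
      quasi_poly (\<kappa> + \<kappa>' - 1) (smult c ([:- (z $ 1), 1:] ^ (m $ 1) * [:- (z $ 2), 1:] ^ (m $ 2))) s)
      has_contour_integral exp_poly (l $ a) (Q a) u) (circlepath (z $ a) \<epsilon>)"
  shows "(\<Sum>a\<in>UNIV. exp_poly (l $ a) (Q a) (\<kappa>' + 1 + of_nat j)) = 0"
proof (rule residue_sum_zero[OF inj])
  define R where "R = smult (1 / c) (monom 1 j * P)"
  have "degree R \<le> j + degree P"
    unfolding R_def by (intro order_trans[OF degree_smult_le] order_trans[OF degree_mult_le] add_mono degree_monom_le order_refl)
  then show "degree R + 2 \<le> (\<Sum>k\<in>UNIV. Suc (m $ k))" using j by (simp add: sum_2)
  fix a
  define u where "u = \<kappa>' + 1 + of_nat j"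
  show "\<forall>\<^sub>F \<epsilon> in at_right 0. ((\<lambda>x. poly R x / (\<Prod>k\<in>UNIV. (x - z $ k) ^ Suc (m $ k))) has_contour_integral
      exp_poly (l $ a) (Q a) (\<kappa>' + 1 + of_nat j)) (circlepath (z $ a) \<epsilon>)"
  proof (rule has_contour_integral_small_circle_cong[OF _ _ Q])
    show "norm (z $ a) > 0" by (simp flip: l)
    fix x assume "x \<in> ball (z $ a) (norm (z $ a))"
    then have x: "x \<in> ball (exp (l $ a)) (norm (exp (l $ a)))" by (simp only: l)
    have "exp (of_nat j * log_branch (l $ a) x) = x ^ j"
      by (simp add: exp_of_nat_mult log_branch_props(1)[OF x])
    then show "bispectral_integrand z (l $ a) (\<kappa>' + 1 + of_nat j) (\<lambda>s. quasi_poly \<kappa> P s /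
      quasi_poly (\<kappa> + \<kappa>' - 1) (smult c ([:- (z $ 1), 1:] ^ (m $ 1) * [:- (z $ 2), 1:] ^ (m $ 2))) s) x
        = poly R x / (\<Prod>k\<in>UNIV. (x - z $ k) ^ Suc (m $ k))"
      unfolding bispectral_integrand_explicit[OF x] by (simp add: R_def poly_monom del: power_Suc)
  qed
qed

lemma cases_of_2: "(i::2) \<noteq> k \<Longrightarrow> i = 1 \<and> k = 2 \<or> i = 2 \<and> k = 1"
  using exhaust_2[of i] exhaust_2[of k] by auto

lemma dual_contains_exp_poly:
  fixes m :: "nat^2"
  assumes W: "quasi_wronskian (lam $ 2 - lam $ 1) (p $ 1) (p $ 2)
      = smult c ([:- (z $ 1), 1:] ^ (m $ 1) * [:- (z $ 2), 1:] ^ (m $ 2))"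
    and ik: "i \<noteq> k"
    and Q: "\<And>u. \<forall>\<^sub>F \<epsilon> in at_right 0. (bispectral_integrand z (l $ a) u (\<lambda>s. quasi_poly (lam $ i) (p $ i) s /
      quasi_poly (lam $ i + lam $ k - 1) (smult c ([:- (z $ 1), 1:] ^ (m $ 1) * [:- (z $ 2), 1:] ^ (m $ 2))) s)
      has_contour_integral exp_poly (l $ a) Q u) (circlepath (z $ a) \<epsilon>)"
  shows "exp_poly (l $ a) Q \<in> bispectral_dual lam p z l"
proof -
  have s: "lam $ i + lam $ k = lam $ 1 + lam $ 2" using cases_of_2[OF ik] by auto
  have "(\<lambda>s. quasi_poly (lam $ i) (p $ i) s / quasi_poly (lam $ i + lam $ k - 1)
      (smult c ([:- (z $ 1), 1:] ^ (m $ 1) * [:- (z $ 2), 1:] ^ (m $ 2))) s) \<in> star_space lam p"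
    unfolding star_space_def wronskian_quasi_poly W s using quasi_poly_in_space by blast
  then show ?thesis unfolding bispectral_dual_def using Q by (intro cfun.span_base) blast
qed

lemma dual_polynomial_unique:
  fixes l :: "complex^2" and q :: "complex poly^2"
  assumes z: "exp (l $ 1) \<noteq> exp (l $ 2)"
    and mem: "exp_poly (l $ a) Q \<in> cfun.span {exp_poly (l $ 1) (q $ 1), exp_poly (l $ 2) (q $ 2)}"
  obtains \<gamma> where "Q = smult \<gamma> (q $ a)"
proof -
  obtain \<alpha> \<beta> where ab: "exp_poly (l $ a) Q = (\<lambda>u. \<alpha> * exp_poly (l $ 1) (q $ 1) u + \<beta> * exp_poly (l $ 2) (q $ 2) u)"
    using mem by (rule cfun_span_pair)
  have ab: "exp_poly (l $ a) Q u = \<alpha> * exp_poly (l $ 1) (q $ 1) u + \<beta> * exp_poly (l $ 2) (q $ 2) u" for u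
    using fun_cong[OF ab, of u] .
  consider "a = 1" | "a = 2" using exhaust_2 by blast
  then show ?thesis
  proof cases
    case 1
    have "exp_poly (l $ 1) (Q - smult \<alpha> (q $ 1)) u = exp_poly (l $ 2) (smult \<beta> (q $ 2)) u" for u
      using ab[of u] by (simp add: 1 exp_poly_def algebra_simps)
    then have "Q - smult \<alpha> (q $ 1) = 0" using exp_poly_independent[OF z] by blast
    then show ?thesis using 1 by (intro that[of \<alpha>]) simp
  next
    case 2
    have "exp_poly (l $ 2) (Q - smult \<beta> (q $ 2)) u = exp_poly (l $ 1) (smult \<alpha> (q $ 1)) u" for u
      using ab[of u] by (simp add: 2 exp_poly_def algebra_simps)
    then have "Q - smult \<beta> (q $ 2) = 0" using exp_poly_independent[OF z[symmetric]] by blast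
    then show ?thesis using 2 by (intro that[of \<beta>]) simp
  qed
qed

text \<open>
  Both \<open>x\<^bsup>lam 1\<^esup> p\<^sub>1\<close> and \<open>x\<^bsup>lam 2\<^esup> p\<^sub>2\<close> are integrated over both circles. As the functions
  \<open>z\<^sub>a\<^sup>u q\<^sub>a\<close> are determined by the dual space up to constants, the two choices produce the same
  \<open>q\<^sub>1, q\<^sub>2\<close>. The choice of the function with index \<open>i\<close> yields the relations on the chain of
  the other index \<open>k\<close>.
\<close>

theorem dual_chain_relations:
  fixes m n :: "nat^2" and z l lam :: "complex^2" and p q :: "complex poly^2"
  assumes W: "quasi_wronskian (lam $ 2 - lam $ 1) (p $ 1) (p $ 2)
      = smult c ([:- (z $ 1), 1:] ^ (m $ 1) * [:- (z $ 2), 1:] ^ (m $ 2))" and c: "c \<noteq> 0"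
    and inj: "inj (($) z)" and l: "\<And>a. exp (l $ a) = z $ a"
    and pz: "\<And>i a. poly (p $ i) (z $ a) \<noteq> 0"
    and deg: "\<And>i. degree (p $ i) = n $ i" and nm: "n $ 1 + n $ 2 = m $ 1 + m $ 2"
    and dual: "bispectral_dual lam p z l = cfun.span {exp_poly (l $ 1) (q $ 1), exp_poly (l $ 2) (q $ 2)}"
  shows "\<And>a. degree (q $ a) = m $ a" and "\<And>a. q $ a \<noteq> 0"
    and "\<exists>\<rho>. \<forall>k. \<rho> k \<noteq> 0 \<and> (\<forall>j\<le>n $ k. poly (q $ 2) (lam $ k + 1 + of_nat j)
      = \<rho> k * (z $ 1 / z $ 2) ^ j * poly (q $ 1) (lam $ k + 1 + of_nat j))"
proof -
  have zne: "exp (l $ 1) \<noteq> exp (l $ 2)" unfolding l using inj by (simp add: inj_eq)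
  have rel: "\<exists>\<gamma>. \<forall>a. \<gamma> a \<noteq> 0 \<and> degree (q $ a) = m $ a \<and> q $ a \<noteq> 0 \<and>
      (\<forall>j\<le>n $ k. (\<Sum>a\<in>UNIV. \<gamma> a * exp_poly (l $ a) (q $ a) (lam $ k + 1 + of_nat j)) = 0)"
    if ik: "i \<noteq> k" for i k
  proof -
    let ?F = "\<lambda>s. quasi_poly (lam $ i) (p $ i) s / quasi_poly (lam $ i + lam $ k - 1)
      (smult c ([:- (z $ 1), 1:] ^ (m $ 1) * [:- (z $ 2), 1:] ^ (m $ 2))) s"
    have "\<forall>a. \<exists>Q. degree Q = m $ a \<and> Q \<noteq> 0 \<and> (\<forall>u. \<forall>\<^sub>F \<epsilon> in at_right 0.
        (bispectral_integrand z (l $ a) u ?F has_contour_integral exp_poly (l $ a) Q u) (circlepath (z $ a) \<epsilon>))"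
      by (rule allI, rule integral_over_star_element[OF inj l c pz])
    from choice[OF this] obtain Q where "\<forall>a. degree (Q a) = m $ a \<and> Q a \<noteq> 0 \<and> (\<forall>u. \<forall>\<^sub>F \<epsilon> in at_right 0.
        (bispectral_integrand z (l $ a) u ?F has_contour_integral exp_poly (l $ a) (Q a) u) (circlepath (z $ a) \<epsilon>))"
      by (rule exE)
    then have Q: "\<And>a. degree (Q a) = m $ a" "\<And>a. Q a \<noteq> 0"
      "\<And>a u. \<forall>\<^sub>F \<epsilon> in at_right 0.
        (bispectral_integrand z (l $ a) u ?F has_contour_integral exp_poly (l $ a) (Q a) u) (circlepath (z $ a) \<epsilon>)"
      by simp_all
    have "\<forall>a. \<exists>\<gamma>. Q a = smult \<gamma> (q $ a)"
    proof
      fix a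
      show "\<exists>\<gamma>. Q a = smult \<gamma> (q $ a)"
        using dual_polynomial_unique[OF zne dual_contains_exp_poly[OF W ik Q(3), unfolded dual]] by blast
    qed
    from choice[OF this] obtain \<gamma> where \<gamma>: "\<And>a. Q a = smult (\<gamma> a) (q $ a)" by auto
    have nz: "\<gamma> a \<noteq> 0" "q $ a \<noteq> 0" for a using Q(2)[of a] by (auto simp: \<gamma>)
    have dq: "degree (q $ a) = m $ a" for a using Q(1)[of a] nz by (simp add: \<gamma>)
    have "(\<Sum>a\<in>UNIV. \<gamma> a * exp_poly (l $ a) (q $ a) (lam $ k + 1 + of_nat j)) = 0" if "j \<le> n $ k" for j
    proof -
      have "n $ i + n $ k = m $ 1 + m $ 2" using nm cases_of_2[OF ik] by auto
      then have "degree (p $ i) + j \<le> m $ 1 + m $ 2" using that deg[of i] by linarith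
      from chain_relation[OF inj l this Q(3)] show ?thesis by (simp add: \<gamma> exp_poly_def mult_ac)
    qed
    then show ?thesis using nz dq by (intro exI[of _ \<gamma>]) blast
  qed
  have other: "\<exists>i::2. i \<noteq> k" for k by (cases "k = 1") (auto intro: exI[of _ 1] exI[of _ 2])
  show "degree (q $ a) = m $ a" "q $ a \<noteq> 0" for a
    using rel[of 1 2] by auto
  have "\<exists>r. r \<noteq> 0 \<and> (\<forall>j\<le>n $ k. poly (q $ 2) (lam $ k + 1 + of_nat j)
      = r * (z $ 1 / z $ 2) ^ j * poly (q $ 1) (lam $ k + 1 + of_nat j))" for k
  proof -
    obtain i where "i \<noteq> k" using other by blast
    from rel[OF this] obtain \<gamma> where \<gamma>: "\<And>a. \<gamma> a \<noteq> 0"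
      "\<And>j. j \<le> n $ k \<Longrightarrow> (\<Sum>a\<in>UNIV. \<gamma> a * exp_poly (l $ a) (q $ a) (lam $ k + 1 + of_nat j)) = 0" by blast
    define v where "v = lam $ k + 1"
    define r where "r = - (\<gamma> 1 * exp (v * l $ 1)) / (\<gamma> 2 * exp (v * l $ 2))"
    have z2: "z $ 2 \<noteq> 0" by (simp flip: l)
    have "poly (q $ 2) (v + of_nat j) = r * (z $ 1 / z $ 2) ^ j * poly (q $ 1) (v + of_nat j)" if "j \<le> n $ k" for j
    proof -
      have e: "exp ((v + of_nat j) * l $ a) = exp (v * l $ a) * (z $ a) ^ j" for a
        by (simp add: distrib_right exp_add exp_of_nat_mult l)
      have "\<gamma> 1 * (exp (v * l $ 1) * (z $ 1) ^ j * poly (q $ 1) (v + of_nat j))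
          + \<gamma> 2 * (exp (v * l $ 2) * (z $ 2) ^ j * poly (q $ 2) (v + of_nat j)) = 0"
        using \<gamma>(2)[OF that, folded v_def] by (simp add: sum_2 exp_poly_def e)
      then have "\<gamma> 2 * (exp (v * l $ 2) * (z $ 2) ^ j * poly (q $ 2) (v + of_nat j))
          = - (\<gamma> 1 * (exp (v * l $ 1) * (z $ 1) ^ j * poly (q $ 1) (v + of_nat j)))"
        by (metis add.commute eq_neg_iff_add_eq_0)
      then show ?thesis using \<gamma>(1)[of 2] z2 by (simp add: r_def power_divide field_simps)
    qed
    moreover have "r \<noteq> 0" using \<gamma>(1) by (simp add: r_def)
    ultimately show ?thesis unfolding v_def by blast
  qed
  then show "\<exists>\<rho>. \<forall>k. \<rho> k \<noteq> 0 \<and> (\<forall>j\<le>n $ k. poly (q $ 2) (lam $ k + 1 + of_nat j)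
      = \<rho> k * (z $ 1 / z $ 2) ^ j * poly (q $ 1) (lam $ k + 1 + of_nat j))"
    by (intro choice allI) blast
qed

section \<open>Generic parameters\<close>

text \<open>
  A root at \<open>z\<^sub>a\<close> would have multiplicity at least \<open>m\<^sub>a + 1\<close>, the higher exponent. The degeneration
  \<open>lam\<^sub>2 - lam\<^sub>1 \<rightarrow> \<infinity>\<close> excludes this.
\<close>

lemma generic_nonvanishing:
  fixes m n :: "nat^2"
  assumes gen: "alg_independent (coords (lam, z))"
    and type: "quasi_poly_space_type n lam m z p"
    and W: "quasi_wronskian (lam $ 2 - lam $ 1) (p $ 1) (p $ 2)
      = smult c ([:- (z $ 1), 1:] ^ (m $ 1) * [:- (z $ 2), 1:] ^ (m $ 2))"
    and z0: "\<And>a. z $ a \<noteq> 0"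
  shows "poly (p $ i) (z $ a) \<noteq> 0"
proof
  assume root: "poly (p $ i) (z $ a) = 0"
  define \<sigma> where "\<sigma> = Var(Lam1 := Diff (Var Lam2) (Var Lam1))"
  define \<xi> where "\<xi> = (\<lambda>k. ev (\<sigma> k) (coords (lam, z)))"
  have "alg_independent \<xi>"
    unfolding \<xi>_def
  proof (rule alg_independent_subst[OF gen])
    fix \<eta> :: "coord \<Rightarrow> complex"
    show "\<exists>\<eta>'. (\<lambda>k. ev (\<sigma> k) \<eta>') = \<eta>"
      by (intro exI[of _ "\<eta>(Lam1 := \<eta> Lam2 - \<eta> Lam1)"]) (auto simp: \<sigma>_def fun_eq_iff)
  qed
  define \<zeta> where "\<zeta> = \<xi>(Lam1 := inverse (\<xi> Lam1))"
  have ind: "alg_independent \<zeta>"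
    unfolding \<zeta>_def using \<open>alg_independent \<xi>\<close> by (rule alg_independent_inverse)
  (* Only Lam1 = 0, that is lambda_2 - lambda_1 = infinity, and distinct values at Z1 and Z2 matter. *)
  define \<eta> :: "coord \<Rightarrow> complex" where "\<eta> = (\<lambda>_. 0)(Z2 := 1)"
  have "\<eta> Lam1 = 0" by (simp add: \<eta>_def)
  from ind this obtain B where B: "valuation_ring B" "\<zeta> Lam1 \<in> valuation_ring.nonunits B"
    "\<forall>e. ev e \<zeta> \<in> B" "\<forall>e. ev e \<eta> \<noteq> 0 \<longrightarrow> ev e \<zeta> \<notin> valuation_ring.nonunits B"
    by (rule generic_specialisation)
  interpret valuation_ring B by (rule B)
  define \<mu> where "\<mu> = lam $ 2 - lam $ 1"
  have \<zeta>: "\<zeta> Lam1 = inverse \<mu>" "\<zeta> Z1 = z $ 1" "\<zeta> Z2 = z $ 2"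
    by (simp_all add: \<zeta>_def \<xi>_def \<sigma>_def \<mu>_def)
  have zB: "z $ 1 \<in> B" "z $ 2 \<in> B" using B(3)[rule_format, of "Var Z1"] B(3)[rule_format, of "Var Z2"] by (simp_all add: \<zeta>)
  have zu: "z $ 1 - z $ 2 \<notin> nonunits" "z $ 2 - z $ 1 \<notin> nonunits"
    using B(4)[rule_format, of "Diff (Var Z1) (Var Z2)"] B(4)[rule_format, of "Diff (Var Z2) (Var Z1)"] by (simp_all add: \<zeta> \<eta>_def)
  have mu: "inverse \<mu> \<in> nonunits" "inverse (- \<mu>) \<in> nonunits"
    using B(2) uminus_nonunit[of "inverse \<mu>"] by (simp_all add: \<zeta>)
  have mu0: "\<mu> \<noteq> 0" "- \<mu> \<noteq> 0"
    using alg_independent_neq[OF gen, of "Diff (Var Lam2) (Var Lam1)" "\<lambda>k. if k = Lam1 then 1 else 0"]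
    by (auto simp: \<mu>_def)
  have p0: "p $ k \<noteq> 0" for k using quasi_poly_space_typeD(2)[OF type, of k] by auto
  have W1: "quasi_wronskian \<mu> (p $ 1) (p $ 2)
      = smult c ([:- (z $ 1), 1:] ^ (m $ 1) * [:- (z $ 2), 1:] ^ (m $ 2))" using W by (simp only: \<mu>_def)
  have W2: "quasi_wronskian (- \<mu>) (p $ 2) (p $ 1)
      = smult (- c) ([:- (z $ 1), 1:] ^ (m $ 1) * [:- (z $ 2), 1:] ^ (m $ 2))"
    unfolding quasi_wronskian_swap W1 by simp
  have W1': "quasi_wronskian \<mu> (p $ 1) (p $ 2)
      = smult c ([:- (z $ 2), 1:] ^ (m $ 2) * [:- (z $ 1), 1:] ^ (m $ 1))" unfolding W1 by (simp only: mult.commute)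
  have W2': "quasi_wronskian (- \<mu>) (p $ 2) (p $ 1)
      = smult (- c) ([:- (z $ 2), 1:] ^ (m $ 2) * [:- (z $ 1), 1:] ^ (m $ 1))" unfolding W2 by (simp only: mult.commute)
  note high = high_order_if_root[OF type z0 root]
  consider "i = 1" "a = 1" | "i = 1" "a = 2" | "i = 2" "a = 1" | "i = 2" "a = 2" using exhaust_2 by blast
  then show False
  proof cases
    case 1
    with wronskian_excludes_high_order[OF W1 p0 p0 mu0(1) mu(1) zB zu(1)] high show False by (simp only:)
  next
    case 2
    with wronskian_excludes_high_order[OF W1' p0 p0 mu0(1) mu(1) zB(2,1) zu(2)] high
    show False by (simp only:)
  next
    case 3
    with wronskian_excludes_high_order[OF W2 p0 p0 mu0(2) mu(2) zB zu(1)] high show False by (simp only:)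
  next
    case 4
    with wronskian_excludes_high_order[OF W2' p0 p0 mu0(2) mu(2) zB(2,1) zu(2)] high
    show False by (simp only:)
  qed
qed

lemma inj_on_chain:
  fixes lam :: "complex^2" and n :: "nat^2"
  assumes "lam $ 1 - lam $ 2 \<notin> \<int>"
  shows "inj_on (\<lambda>(i, r). lam $ i + of_nat r) (SIGMA i:UNIV. {1..n $ i})"
proof -
  have no: False if "lam $ 1 + of_nat r = lam $ 2 + of_nat s" for r s :: nat
  proof -
    have "lam $ 1 - lam $ 2 = (lam $ 1 + of_nat r) - (lam $ 2 + of_nat r)" by simp
    also have "\<dots> = of_nat s - of_nat r" unfolding that by simp
    also have "\<dots> \<in> \<int>" by simp
    finally show False using assms by simp
  qed
  have key: "i = k \<and> r = s" if eq: "lam $ i + of_nat r = lam $ k + of_nat s" for i k r s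
  proof -
    have "i = k"
    proof (rule ccontr)
      assume "i \<noteq> k"
      from cases_of_2[OF this] show False
      proof (elim disjE conjE)
        assume "i = 1" "k = 2"
        then show False using no[of r s] eq by simp
      next
        assume "i = 2" "k = 1"
        then show False using no[of s r] eq[symmetric] by simp
      qed
    qed
    with eq show ?thesis by simp
  qed
  show ?thesis
  proof (rule inj_onI)
    fix x y :: "2 \<times> nat"
    assume "(case x of (i, r) \<Rightarrow> lam $ i + of_nat r) = (case y of (i, r) \<Rightarrow> lam $ i + of_nat r)"
    then have "lam $ fst x + of_nat (snd x) = lam $ fst y + of_nat (snd y)" by (simp only: case_prod_unfold)
    from key[OF this] show "x = y" by (simp add: prod_eq_iff)
  qed
qed

definition lam_coord :: "2 \<Rightarrow> coord" where
  "lam_coord i = (if i = 1 then Lam1 else Lam2)"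

definition z_coord :: "2 \<Rightarrow> coord" where
  "z_coord a = (if a = 1 then Z1 else Z2)"

lemma coords_lam: "coords (lam, z) (lam_coord i) = lam $ i"
  using exhaust_2[of i] by (auto simp: lam_coord_def)

lemma coords_z: "coords (lam, z) (z_coord a) = z $ a"
  using exhaust_2[of a] by (auto simp: z_coord_def)

lemma card_chain_points:
  fixes lam :: "complex^2" and n :: "nat^2"
  assumes "lam $ 1 - lam $ 2 \<notin> \<int>"
  shows "card (chain_points (($) lam) (($) n)) = n $ 1 + n $ 2"
  unfolding chain_points_def by (subst card_image[OF inj_on_chain[OF assms]]) (simp add: sum_2)

text \<open>
  The degeneration is \<open>z\<^sub>a \<rightarrow> 0\<close>. Taking \<open>a\<close> and \<open>b\<close> in both orders treats \<open>q\<^sub>1\<close> and \<open>q\<^sub>2\<close>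
  symmetrically.
\<close>

lemma generic_xxx_solution:
  fixes lam z :: "complex^2" and n :: "nat^2"
  assumes gen: "alg_independent (coords (lam, z))" and ab: "a \<noteq> b"
    and int: "lam $ 1 - lam $ 2 \<notin> \<int>" and z: "z $ 1 \<noteq> z $ 2" "\<And>a. z $ a \<noteq> 0"
    and q0: "qa \<noteq> 0" "qb \<noteq> 0" and deg: "degree qa + degree qb = n $ 1 + n $ 2"
    and \<rho>: "\<And>k. \<rho> k \<noteq> 0"
    and chain: "\<And>k j. j \<le> n $ k \<Longrightarrow>
      poly qb (lam $ k + 1 + of_nat j) = \<rho> k * (z $ a / z $ b) ^ j * poly qa (lam $ k + 1 + of_nat j)"
  shows "\<exists>s. length s = degree qb \<and> represents_orbit qb s \<and> xxx_admissible n (lam + 1) s \<and>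
    xxx_solution n (lam + 1) (z $ b / z $ a) s"
proof -
  define c where "c = (z $ b - z $ a) * (lead_coeff qa * lead_coeff qb)"
  have card: "degree qa + degree qb = card (chain_points (($) lam) (($) n))"
    by (simp only: deg card_chain_points[OF int])
  have D: "discrete_wronskian (z $ a) (z $ b) qa qb = smult c (chain_poly (($) lam) (($) n))"
    unfolding c_def by (rule discrete_wronskian_from_chains[OF z(2) z(2) card chain])
  have "z $ b \<noteq> z $ a" using z(1) cases_of_2[OF ab] by auto
  then have c0: "c \<noteq> 0" using q0 by (simp add: c_def)
  (* The value \<i> for lambda_1 keeps the points of the two chains apart in the limit. *)
  define \<eta> :: "coord \<Rightarrow> complex" where "\<eta> k = (if k = z_coord b then 1 else if k = Lam1 then \<i> else 0)" for k
  have \<eta>: "\<eta> (z_coord a) = 0" "\<eta> (z_coord b) = 1" "\<eta> Lam1 = \<i>" "\<eta> Lam2 = 0"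
    using cases_of_2[OF ab] by (auto simp: \<eta>_def z_coord_def)
  obtain B where B: "valuation_ring B"
    "coords (lam, z) (z_coord a) \<in> valuation_ring.nonunits B"
    "\<forall>e. ev e (coords (lam, z)) \<in> B"
    "\<forall>e. ev e \<eta> \<noteq> 0 \<longrightarrow> ev e (coords (lam, z)) \<notin> valuation_ring.nonunits B"
    using gen \<eta>(1) by (rule generic_specialisation)
  interpret valuation_ring B by (rule B)
  have lamB: "lam $ k \<in> B" for k using B(3)[rule_format, of "Var (lam_coord k)"] by (simp add: coords_lam)
  have za: "z $ a \<in> nonunits" using B(2) by (simp add: coords_z)
  have zb: "z $ b \<in> B" using B(3)[rule_format, of "Var (z_coord b)"] by (simp add: coords_z)
  have zb': "z $ b \<notin> nonunits" using B(4)[rule_format, of "Var (z_coord b)"] by (simp add: coords_z \<eta>)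
  have sep: "lam $ i + of_nat r = lam $ k + of_nat s \<and> i = k \<and> r = s"
    if nu: "lam $ i + of_nat r - (lam $ k + of_nat s) \<in> nonunits" for i k r s
  proof -
    define e where "e = Diff (Add (Var (lam_coord i)) (Const (int r))) (Add (Var (lam_coord k)) (Const (int s)))"
    have "ev e (coords (lam, z)) = lam $ i + of_nat r - (lam $ k + of_nat s)"
      by (simp add: e_def coords_lam)
    then have "ev e \<eta> = 0" using B(4)[rule_format, of e] nu by auto
    then have 0: "\<eta> (lam_coord i) + of_nat r = \<eta> (lam_coord k) + of_nat s" by (simp add: e_def)
    have ik: "i = k"
    proof (rule ccontr)
      assume "i \<noteq> k"
      then have "Im (\<eta> (lam_coord i) + of_nat r) \<noteq> Im (\<eta> (lam_coord k) + of_nat s)"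
        using cases_of_2[of i k] \<eta> by (auto simp: lam_coord_def)
      with 0 show False by simp
    qed
    with 0 show ?thesis by simp
  qed
  note nondeg = degenerate_nonvanishing[where lam = "($) lam" and n = "($) n", OF lamB sep D card q0 za zb zb' chain]
  have "rsquarefree qb" unfolding rsquarefree_roots using nondeg(1) by blast
  from chains_give_xxx_solution[OF z(2) z(2) inj_on_chain[OF int] c0 D chain \<rho> nondeg(2) this]
  show ?thesis .
qed

lemma generic_basic:
  assumes gen: "alg_independent (coords (lam, z))"
  shows "lam $ 1 - lam $ 2 \<notin> \<int>" "z $ 1 \<noteq> z $ 2" "z $ 1 \<noteq> 0" "z $ 2 \<noteq> 0"
proof -
  show "lam $ 1 - lam $ 2 \<notin> \<int>"
  proof
    assume "lam $ 1 - lam $ 2 \<in> \<int>"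
    then obtain k where "lam $ 1 - lam $ 2 = of_int k" by (auto elim: Ints_cases)
    then have "ev (Diff (Diff (Var Lam1) (Var Lam2)) (Const k)) (coords (lam, z)) = 0" by simp
    from alg_independentD[OF gen this, of "\<lambda>i. if i = Lam1 then of_int k + 1 else 0"] show False by simp
  qed
  show "z $ 1 \<noteq> z $ 2"
    using alg_independent_neq[OF gen, of "Diff (Var Z1) (Var Z2)" "\<lambda>i. if i = Z1 then 1 else 0"] by simp
  show "z $ 1 \<noteq> 0" using alg_independent_neq[OF gen, of "Var Z1" "\<lambda>_. 1"] by simp
  show "z $ 2 \<noteq> 0" using alg_independent_neq[OF gen, of "Var Z2" "\<lambda>_. 1"] by simp
qed

lemma duality_at_generic_point:
  fixes n m :: "nat^2" and lam z l :: "complex^2" and p q :: "complex poly^2"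
  assumes gen: "alg_independent (coords (lam, z))"
    and nm: "n $ 1 + n $ 2 = m $ 1 + m $ 2"
    and type: "quasi_poly_space_type n lam m z p" and l: "\<forall>a. exp (l $ a) = z $ a"
    and dual: "bispectral_dual lam p z l = cfun.span {exp_poly (l $ 1) (q $ 1), exp_poly (l $ 2) (q $ 2)}"
  shows "\<exists>s. length s = n $ 1 \<and> represents_orbit (p $ 1) s \<and> gaudin_admissible m z s \<and>
      gaudin_solution (lam $ 2 - lam $ 1 - 1) m z s"
    and "\<exists>s. length s = m $ 2 \<and> represents_orbit (q $ 2) s \<and> xxx_admissible n (lam + 1) s \<and>
      xxx_solution n (lam + 1) (z $ 2 / z $ 1) s"
    and "\<exists>s. length s = m $ 1 \<and> represents_orbit (q $ 1) s \<and> xxx_admissible n (lam + 1) s \<and>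
      xxx_solution n (lam + 1) (z $ 1 / z $ 2) s"
proof -
  note int = generic_basic(1)[OF gen] and z12 = generic_basic(2)[OF gen]
    and z1 = generic_basic(3)[OF gen] and z2 = generic_basic(4)[OF gen]
  have z0: "z $ a \<noteq> 0" for a using z1 z2 exhaust_2[of a] by auto
  have inj: "inj (($) z)"
  proof (rule injI, rule ccontr)
    fix a b assume "z $ a = z $ b" "a \<noteq> b"
    with cases_of_2[of a b] z12 show False by auto
  qed
  have lam12: "lam $ 1 \<noteq> lam $ 2" using int by auto
  obtain c where c: "c \<noteq> 0" and W: "quasi_wronskian (lam $ 2 - lam $ 1) (p $ 1) (p $ 2)
      = smult c ([:- (z $ 1), 1:] ^ (m $ 1) * [:- (z $ 2), 1:] ^ (m $ 2))"
    by (rule wronskian_of_type[OF type nm z12 z1 z2 lam12])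
  have pz: "poly (p $ i) (z $ a) \<noteq> 0" for i a by (rule generic_nonvanishing[OF gen type W z0])
  note deg = quasi_poly_space_typeD(1)[OF type]
  show "\<exists>s. length s = n $ 1 \<and> represents_orbit (p $ 1) s \<and> gaudin_admissible m z s \<and>
      gaudin_solution (lam $ 2 - lam $ 1 - 1) m z s"
    using wronskian_gives_gaudin_solution[OF W c quasi_poly_space_typeD(2)[OF type] pz] by (simp only: deg)
  note dq = dual_chain_relations[OF W c inj l[rule_format] pz deg nm dual]
  from dq(3) obtain \<rho> where r: "\<forall>k. \<rho> k \<noteq> 0 \<and> (\<forall>j\<le>n $ k. poly (q $ 2) (lam $ k + 1 + of_nat j)
      = \<rho> k * (z $ 1 / z $ 2) ^ j * poly (q $ 1) (lam $ k + 1 + of_nat j))" by (rule exE)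
  have \<rho>: "\<rho> k \<noteq> 0" for k using r by simp
  have chain: "poly (q $ 2) (lam $ k + 1 + of_nat j)
      = \<rho> k * (z $ 1 / z $ 2) ^ j * poly (q $ 1) (lam $ k + 1 + of_nat j)" if "j \<le> n $ k" for k j
    by (rule r[rule_format, THEN conjunct2, rule_format, OF that])
  have chain': "poly (q $ 1) (lam $ k + 1 + of_nat j)
      = inverse (\<rho> k) * (z $ 2 / z $ 1) ^ j * poly (q $ 2) (lam $ k + 1 + of_nat j)" if "j \<le> n $ k" for k j
    unfolding chain[OF that] using \<rho>[of k] z1 z2 by (simp add: power_divide)
  have \<rho>': "inverse (\<rho> k) \<noteq> 0" for k using \<rho> by simp
  have sum: "degree (q $ 1) + degree (q $ 2) = n $ 1 + n $ 2" "degree (q $ 2) + degree (q $ 1) = n $ 1 + n $ 2"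
    using nm by (simp_all only: dq(1) add.commute)
  have ne: "(1::2) \<noteq> 2" "(2::2) \<noteq> 1" by simp_all
  show "\<exists>s. length s = m $ 2 \<and> represents_orbit (q $ 2) s \<and> xxx_admissible n (lam + 1) s \<and>
      xxx_solution n (lam + 1) (z $ 2 / z $ 1) s"
    using generic_xxx_solution[OF gen ne(1) int z12 z0 dq(2) dq(2) sum(1) \<rho> chain] by (simp only: dq(1))
  show "\<exists>s. length s = m $ 1 \<and> represents_orbit (q $ 1) s \<and> xxx_admissible n (lam + 1) s \<and>
      xxx_solution n (lam + 1) (z $ 1 / z $ 2) s"
    using generic_xxx_solution[OF gen ne(2) int z12 z0 dq(2) dq(2) sum(2) \<rho>' chain'] by (simp only: dq(1))
qed

theorem theorem10p7:
  fixes n m :: "nat^2"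
  assumes "n $ 1 + n $ 2 = m $ 1 + m $ 2"
  shows "generically (\<lambda>(lam, z).
    lam $ 1 - lam $ 2 \<notin> \<int> \<and> z $ 1 \<noteq> z $ 2 \<and> z $ 1 \<noteq> 0 \<and> z $ 2 \<noteq> 0 \<and>
    (\<forall>(t :: complex list) (p :: complex poly^2) (l :: complex^2) (q :: complex poly^2).
       length t = n $ 2 \<and> gaudin_admissible m z t \<and>
       gaudin_solution (lam $ 1 - lam $ 2 - 1) m z t \<and>
       quasi_poly_space_type n lam m z p \<and>
       quasi_poly_space lam p = gaudin_kernel lam m z t \<and>
       (\<forall>a. exp (l $ a) = z $ a) \<and>
       bispectral_dual lam p z l = cfun.span {exp_poly (l $ 1) (q $ 1), exp_poly (l $ 2) (q $ 2)}
       \<longrightarrow>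
       (\<exists>s. length s = n $ 1 \<and> represents_orbit (p $ 1) s \<and> gaudin_admissible m z s \<and>
            gaudin_solution (lam $ 2 - lam $ 1 - 1) m z s) \<and>
       (\<exists>s. length s = m $ 2 \<and> represents_orbit (q $ 2) s \<and> xxx_admissible n (lam + 1) s \<and>
            xxx_solution n (lam + 1) (z $ 2 / z $ 1) s) \<and>
       (\<exists>s. length s = m $ 1 \<and> represents_orbit (q $ 1) s \<and> xxx_admissible n (lam + 1) s \<and>
            xxx_solution n (lam + 1) (z $ 1 / z $ 2) s)))"
  (is "generically ?Q")
proof (rule generically_if_alg_independent)
  fix w :: "(complex^2) \<times> (complex^2)"
  assume gen: "alg_independent (coords w)"
  obtain lam z where w: "w = (lam, z)" by (rule prod.exhaust)
  note gen = gen[unfolded w]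
  show "?Q w"
    unfolding w prod.case
    by (intro conjI allI impI generic_basic[OF gen]; elim conjE;
        rule duality_at_generic_point[OF gen assms], assumption+)
qed

end
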